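(* Let $B_R\subset\mathbb{R}^n$ be the ball of radius $R$ centered at $0$, let $(\Omega_t)_t$ be a perturbation of $B_R$ with first-order field $v$, and let $\lambda(t)$ be the principal eigenvalue of $\Omega_t$ for the Robin problem $\Delta\tilde u+\lambda\tilde u=0$ in $\Omega_t$, $\partial_{\nu_t}\tilde u+\alpha\tilde u=0$ on $\partial\Omega_t$. Then for $\alpha>0$ $(<0)$ we have $$\dot\lambda(0)<0\ \ (>0)$$ for all volume increasing (decreasing) perturbations, i.e. $\oint_{\partial B_R}v\cdot\nu\,dS>0$ $(<0)$.
   Context: $\nu=x/R$ is the outer unit normal of $\partial B_R$, and $\nu_t$ that of $\partial\Omega_t$. Perturbations of $\Omega=B_R$: $\Omega_t=\{y=x+tv(x)+\frac{t^2}{2}w(x)+o(t^2): x\in\Omega\}$ for $|t|$ small, where $v,w$ are $C^{2,\gamma}$ vector fields and $x\mapsto y$ is a diffeomorphism. Sufficient regularity is assumed for the differentiations in $t$. A dot denotes $d/dt$.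
   Formalization: Read with all parentheses paired, the case α<0 with volume decreasing perturbations is false (n=1, u=cosh kx); the formal theorem states the correct signs: for α<0, λ̇(0)>0 if volume increasing and <0 if decreasing; for α>0, λ̇(0)<0 if increasing and >0 if decreasing. *)

theory Defs
  imports "HOL-Analysis.Analysis"
begin

definition has_C1_derivative_on ::
    "('a::real_normed_vector \<Rightarrow> 'b::real_normed_vector) \<Rightarrow> ('a \<Rightarrow> 'a \<Rightarrow>\<^sub>L 'b) \<Rightarrow> 'a set \<Rightarrow> bool" where
  "has_C1_derivative_on f Df S \<longleftrightarrow>
     (\<forall>x\<in>S. (f has_derivative blinfun_apply (Df x)) (at x within S)) \<and> continuous_on S Df"

definition C2_on :: "'a set \<Rightarrow> ('a::real_normed_vector \<Rightarrow> 'b::real_normed_vector) \<Rightarrow> bool" where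
  "C2_on S f \<longleftrightarrow> (\<exists>Df D2f. has_C1_derivative_on f Df S \<and> has_C1_derivative_on Df D2f S)"

(* The class C^{2,g} on S.  It is used on closed balls and their diffeomorphic images, where
   derivatives within S are the continuous extensions of the interior derivatives. *)
definition C2_Holder_on ::
    "real \<Rightarrow> 'a set \<Rightarrow> ('a::real_normed_vector \<Rightarrow> 'b::real_normed_vector) \<Rightarrow> bool" where
  "C2_Holder_on g S f \<longleftrightarrow>
     (\<exists>Df D2f. has_C1_derivative_on f Df S \<and> has_C1_derivative_on Df D2f S \<and>
        (\<exists>C. \<forall>x\<in>S. \<forall>y\<in>S. norm (D2f x - D2f y) \<le> C * norm (x - y) powr g))"

definition C2_Holder_diffeo_on ::
    "real \<Rightarrow> 'a set \<Rightarrow> ('a::real_normed_vector \<Rightarrow> 'b::real_normed_vector) \<Rightarrow> bool" where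
  "C2_Holder_diffeo_on g S f \<longleftrightarrow>
     inj_on f S \<and> C2_Holder_on g S f \<and> C2_Holder_on g (f ` S) (inv_into S f)"

(* Perturbation of the ball of radius R: Phi t x = x + t v(x) + t^2/2 w(x) + o(t^2) for small |t|.
   The remainder is o(t^2) uniformly on the closed ball together with its first derivative in x,
   so that the expansion may be differentiated in x.  (At t = 0 this gives Phi 0 x = x.)
   The perturbed domain is Phi t ` ball 0 R. *)
definition ball_perturbation ::
    "real \<Rightarrow> real \<Rightarrow> ('a::euclidean_space \<Rightarrow> 'a) \<Rightarrow> ('a \<Rightarrow> 'a) \<Rightarrow> (real \<Rightarrow> 'a \<Rightarrow> 'a) \<Rightarrow> bool" where
  "ball_perturbation R g v w Phi \<longleftrightarrow>
     C2_Holder_on g (cball 0 R) v \<and>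
     C2_Holder_on g (cball 0 R) w \<and>
     (\<forall>\<^sub>F t in nhds 0. C2_Holder_diffeo_on g (cball 0 R) (Phi t)) \<and>
     (\<exists>r Dr.
        (\<forall>\<^sub>F t in nhds 0. has_C1_derivative_on (r t) (Dr t) (cball 0 R) \<and>
           (\<forall>x\<in>cball 0 R. Phi t x = x + t *\<^sub>R v x + (t\<^sup>2 / 2) *\<^sub>R w x + r t x)) \<and>
        (\<forall>e>0. \<forall>\<^sub>F t in nhds 0. \<forall>x\<in>cball 0 R.
           norm (r t x) \<le> e * t\<^sup>2 \<and> norm (Dr t x) \<le> e * t\<^sup>2))"

(* n is the outer unit normal of Om at the boundary point y: near y, Om is the sublevel set
   {phi < 0} of a C^1 function whose gradient at y is a positive multiple of n. *)
definition outer_unit_normal :: "'a::euclidean_space set \<Rightarrow> 'a \<Rightarrow> 'a \<Rightarrow> bool" where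
  "outer_unit_normal Om y n \<longleftrightarrow>
     norm n = 1 \<and>
     (\<exists>U \<phi> D\<phi>. open U \<and> y \<in> U \<and> has_C1_derivative_on \<phi> D\<phi> U \<and>
        Om \<inter> U = {x \<in> U. \<phi> x < (0::real)} \<and> \<phi> y = 0 \<and>
        (\<exists>c>0. \<forall>h. blinfun_apply (D\<phi> y) h = c * (n \<bullet> h)))"

definition laplacian :: "('a::euclidean_space \<Rightarrow> real) \<Rightarrow> 'a \<Rightarrow> real" where
  "laplacian u x =
     (\<Sum>b\<in>Basis. frechet_derivative (\<lambda>z. frechet_derivative u (at z) b) (at x) b)"

(* Classical solutions, of class C^2 in Om and C^1 up to the boundary. *)
definition robin_eigenfunction ::
    "real \<Rightarrow> 'a::euclidean_space set \<Rightarrow> real \<Rightarrow> ('a \<Rightarrow> real) \<Rightarrow> bool" where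
  "robin_eigenfunction \<alpha> Om l u \<longleftrightarrow>
     (\<exists>x\<in>Om. u x \<noteq> 0) \<and>
     C2_on Om u \<and>
     (\<forall>x\<in>Om. laplacian u x + l * u x = 0) \<and>
     (\<exists>Du. has_C1_derivative_on u Du (closure Om) \<and>
        (\<forall>y\<in>frontier Om. \<exists>n. outer_unit_normal Om y n \<and>
           blinfun_apply (Du y) n + \<alpha> * u y = 0))"

(* The principal eigenvalue: the lowest eigenvalue, with an eigenfunction of constant sign. *)
definition robin_principal_eigenvalue ::
    "real \<Rightarrow> 'a::euclidean_space set \<Rightarrow> real \<Rightarrow> bool" where
  "robin_principal_eigenvalue \<alpha> Om l \<longleftrightarrow>
     (\<exists>u. robin_eigenfunction \<alpha> Om l u \<and> (\<forall>x\<in>Om. 0 < u x)) \<and>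
     (\<forall>m u. robin_eigenfunction \<alpha> Om m u \<longrightarrow> l \<le> m)"

(* Surface measure of the sphere of radius R, via cones: a Borel subset A of the sphere has
   measure (n / R) times the volume of {s x | 0 < s < 1, x in A}, where n is the dimension. *)
definition sphere_measure :: "real \<Rightarrow> 'a::euclidean_space measure" where
  "sphere_measure R =
     scale_measure (ennreal (real DIM('a) / R))
       (distr (restrict_space lborel (ball 0 R)) borel (\<lambda>x. (R / norm x) *\<^sub>R x))"

end

(* For a positive Robin eigenfunction u the field V = - grad u / u satisfies div V = lam + |V|^2 and
   V . n = alpha on the boundary.  Testing this Riccati equation on the perturbed domain with the
   square of the radial eigenfunction phi of the ball (Picone's identity) bounds lam(t) from above by
   a quantity that is explicit to first order in t.  The same bound holds for t of either sign, so
   that, lam being differentiable, it determines the derivative: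
     lam'(0) * int phi^2 = - phi(R)^2 * k'(R) * flux,   where k = - phi'/phi as a function of r.
   No regularity of the perturbed eigenfunctions in t is needed.  The sign of k'(R) is that of alpha,
   by the Riccati equation k' + (n-1)/r k = lam + k^2. *)

theory Submission
  imports Defs
begin

section \<open>Fields of class C1 and their divergence\<close>


text \<open>No surface integral over the perturbed boundary is formed. Gauss' theorem enters only as
  an inequality: a field pointing strictly inward on the boundary has divergence of nonpositive
  integral. The outward component of Picone's field phi^2 V + phi grad phi at a boundary point y is,
  up to O(t^2), a function of |y| alone, phi^2 (alpha - k), which vanishes at |y| = R. Displacing
  the boundary changes it to first order in t, so a comparison field X = c t g x + eps |t| phi^2 x
  is subtracted, where g is the normal component of v extended along rays. The constant c is chosen
  to cancel the first-order change; the eps term makes the sign strict. The divergence of X is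
  explicit, so its integral converges as the domain tends to the ball; both signs of t and then eps
  -> 0 give an equation. As g is in general discontinuous at the origin, it is cut off there. Being
  constant along rays it satisfies div (g x) = n g away from 0, and the cone description of surface
  measure turns the integral of n g over the ball into R times the flux.\<close>

text \<open>The derivative is the unrestricted one (\<open>at x\<close>), and its continuity is
  asked direction by direction, which in finite dimension is the usual C1 condition on open sets.
  This keeps the product and chain rules free of bounded linear function types.\<close>

definition C1_on ::
    "'a::real_normed_vector set \<Rightarrow> ('a \<Rightarrow> 'b::real_normed_vector) \<Rightarrow> ('a \<Rightarrow> 'a \<Rightarrow> 'b) \<Rightarrow> bool" where
  "C1_on S f f' \<longleftrightarrow>
     (\<forall>x\<in>S. (f has_derivative f' x) (at x)) \<and> (\<forall>h. continuous_on S (\<lambda>x. f' x h))"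

lemma C1_onI:
  assumes "\<And>x. x \<in> S \<Longrightarrow> (f has_derivative f' x) (at x)" "\<And>h. continuous_on S (\<lambda>x. f' x h)"
  shows "C1_on S f f'"
  using assms unfolding C1_on_def by blast

lemma C1_onD:
  assumes "C1_on S f f'"
  shows "x \<in> S \<Longrightarrow> (f has_derivative f' x) (at x)" "continuous_on S (\<lambda>x. f' x h)"
    "continuous_on S f"
proof -
  show "x \<in> S \<Longrightarrow> (f has_derivative f' x) (at x)" "continuous_on S (\<lambda>x. f' x h)"
    using assms unfolding C1_on_def by blast+
  show "continuous_on S f"
    using assms unfolding C1_on_def
    by (meson continuous_at_imp_continuous_on has_derivative_continuous)
qed

lemma C1_on_subset: "C1_on T f f' \<Longrightarrow> S \<subseteq> T \<Longrightarrow> C1_on S f f'"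
  unfolding C1_on_def by (meson continuous_on_subset in_mono)

lemma C1_on_cong:
  assumes "open S" "C1_on S f f'" "\<And>x. x \<in> S \<Longrightarrow> g x = f x" "\<And>x h. x \<in> S \<Longrightarrow> g' x h = f' x h"
  shows "C1_on S g g'"
proof (rule C1_onI)
  fix x assume x: "x \<in> S"
  then have "(f has_derivative g' x) (at x)"
    using C1_onD(1)[OF assms(2) x] assms(4) by (metis ext)
  then show "(g has_derivative g' x) (at x)"
    using has_derivative_transform_within_open[OF _ assms(1) x] assms(3) by metis
next
  fix h show "continuous_on S (\<lambda>x. g' x h)"
    using C1_onD(2)[OF assms(2)] assms(4) by (simp cong: continuous_on_cong)
qed

lemma C1_on_Un:
  assumes "open S" "open T" "C1_on S f f'" "C1_on T f f'"
  shows "C1_on (S \<union> T) f f'"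
  using assms unfolding C1_on_def by (auto intro!: continuous_on_open_Un)

lemma C1_on_const: "C1_on S (\<lambda>x. c) (\<lambda>x h. 0)"
  by (rule C1_onI) auto

lemma C1_on_add:
  assumes "C1_on S f f'" "C1_on S g g'"
  shows "C1_on S (\<lambda>x. f x + g x) (\<lambda>x h. f' x h + g' x h)"
  using assms unfolding C1_on_def
  by (auto intro!: continuous_intros derivative_eq_intros)

lemma C1_on_scaleR:
  assumes "C1_on S a a'" "C1_on S f f'"
  shows "C1_on S (\<lambda>x. a x *\<^sub>R f x) (\<lambda>x h. a x *\<^sub>R f' x h + a' x h *\<^sub>R f x)"
proof (rule C1_onI)
  fix x assume "x \<in> S"
  then show "((\<lambda>x. a x *\<^sub>R f x) has_derivative (\<lambda>h. a x *\<^sub>R f' x h + a' x h *\<^sub>R f x)) (at x)"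
    by (intro has_derivative_scaleR C1_onD(1)[OF assms(1)] C1_onD(1)[OF assms(2)])
next
  fix h show "continuous_on S (\<lambda>x. a x *\<^sub>R f' x h + a' x h *\<^sub>R f x)"
    by (intro continuous_intros C1_onD[OF assms(1)] C1_onD[OF assms(2)])
qed

lemma C1_on_compose_real:
  fixes f :: "'a::real_normed_vector \<Rightarrow> real"
  assumes "C1_on S f f'" "\<And>x. x \<in> S \<Longrightarrow> (g has_real_derivative g' (f x)) (at (f x))"
    "continuous_on (f ` S) g'"
  shows "C1_on S (\<lambda>x. g (f x)) (\<lambda>x h. g' (f x) * f' x h)"
proof (rule C1_onI)
  fix x assume x: "x \<in> S"
  show "((\<lambda>x. g (f x)) has_derivative (\<lambda>h. g' (f x) * f' x h)) (at x)"
    using has_derivative_compose[OF C1_onD(1)[OF assms(1) x], of g "(*) (g' (f x))"] assms(2)[OF x]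
    by (simp add: has_field_derivative_def)
next
  fix h show "continuous_on S (\<lambda>x. g' (f x) * f' x h)"
    by (intro continuous_intros C1_onD[OF assms(1)] continuous_on_compose2[OF assms(3)]) auto
qed

text \<open>With the full derivative hidden and the divergence \<open>d\<close> an explicit
  function, formulas for \<open>d\<close> can be rewritten pointwise and glued over open
  sets.\<close>

definition has_divergence_on ::
    "('a::euclidean_space \<Rightarrow> 'a) \<Rightarrow> ('a \<Rightarrow> real) \<Rightarrow> 'a set \<Rightarrow> bool" where
  "has_divergence_on Z d S \<longleftrightarrow>
     (\<exists>Z'. C1_on S Z Z' \<and> (\<forall>x\<in>S. d x = (\<Sum>b\<in>Basis. Z' x b \<bullet> b)))"

lemma has_divergence_on_subset:
  "has_divergence_on Z d T \<Longrightarrow> S \<subseteq> T \<Longrightarrow> has_divergence_on Z d S"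
  unfolding has_divergence_on_def by (meson C1_on_subset in_mono)

lemma has_divergence_on_cong:
  assumes "open S" "has_divergence_on Z d S" "\<And>x. x \<in> S \<Longrightarrow> Y x = Z x" "\<And>x. x \<in> S \<Longrightarrow> e x = d x"
  shows "has_divergence_on Y e S"
  using assms unfolding has_divergence_on_def by (metis C1_on_cong)

text \<open>On the overlap the two derivatives agree by uniqueness, so they patch together. In this
  way fields extended by zero, and fields cut off at the origin, become C1 on the whole
  space.\<close>

lemma has_divergence_on_Un:
  assumes "open S" "open T" "has_divergence_on Z d S" "has_divergence_on Z d T"
  shows "has_divergence_on Z d (S \<union> T)"
proof -
  obtain F G where FG: "C1_on S Z F" "C1_on T Z G"
    "\<And>x. x \<in> S \<Longrightarrow> d x = (\<Sum>b\<in>Basis. F x b \<bullet> b)" "\<And>x. x \<in> T \<Longrightarrow> d x = (\<Sum>b\<in>Basis. G x b \<bullet> b)"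
    using assms(3,4) unfolding has_divergence_on_def by auto
  have eq: "F x = G x" if "x \<in> S" "x \<in> T" for x
    using C1_onD(1)[OF FG(1)] C1_onD(1)[OF FG(2)] that has_derivative_unique by blast
  define Z' where "Z' x = (if x \<in> S then F x else G x)" for x
  have "C1_on (S \<union> T) Z Z'"
    using assms(1,2) eq
    by (intro C1_on_Un C1_on_cong[OF _ FG(1)] C1_on_cong[OF _ FG(2)]) (auto simp: Z'_def)
  then show ?thesis
    unfolding has_divergence_on_def using FG by (intro exI[of _ Z']) (auto simp: Z'_def)
qed

lemma has_divergence_on_continuous_divergence:
  assumes "has_divergence_on Z d S" shows "continuous_on S d"
proof -
  obtain Z' where Z': "C1_on S Z Z'" "\<And>x. x \<in> S \<Longrightarrow> d x = (\<Sum>b\<in>Basis. Z' x b \<bullet> b)"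
    using assms unfolding has_divergence_on_def by auto
  have "continuous_on S (\<lambda>x. \<Sum>b\<in>Basis. Z' x b \<bullet> b)"
    by (intro continuous_intros C1_onD(2)[OF Z'(1)])
  then show ?thesis using Z'(2) by (simp cong: continuous_on_cong)
qed

lemma has_divergence_on_continuous: "has_divergence_on Z d S \<Longrightarrow> continuous_on S Z"
  unfolding has_divergence_on_def using C1_onD(3) by blast

lemma has_divergence_on_add:
  assumes "has_divergence_on Y d S" "has_divergence_on Z e S"
  shows "has_divergence_on (\<lambda>x. Y x + Z x) (\<lambda>x. d x + e x) S"
proof -
  obtain Y' Z' where C: "C1_on S Y Y'" "C1_on S Z Z'"
    and "\<forall>x\<in>S. d x = (\<Sum>b\<in>Basis. Y' x b \<bullet> b)" "\<forall>x\<in>S. e x = (\<Sum>b\<in>Basis. Z' x b \<bullet> b)"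
    using assms unfolding has_divergence_on_def by blast
  then have "\<forall>x\<in>S. d x + e x = (\<Sum>b\<in>Basis. (Y' x b + Z' x b) \<bullet> b)"
    by (simp add: inner_add_left sum.distrib)
  with C1_on_add[OF C] show ?thesis
    unfolding has_divergence_on_def by blast
qed

lemma has_divergence_on_scaleR:
  assumes "C1_on S a a'" "has_divergence_on Z d S"
  shows "has_divergence_on (\<lambda>x. a x *\<^sub>R Z x) (\<lambda>x. a x * d x + a' x (Z x)) S"
proof -
  obtain Z' where C: "C1_on S Z Z'" and d: "\<forall>x\<in>S. d x = (\<Sum>b\<in>Basis. Z' x b \<bullet> b)"
    using assms unfolding has_divergence_on_def by blast
  have "a x * d x + a' x (Z x) = (\<Sum>b\<in>Basis. (a x *\<^sub>R Z' x b + a' x b *\<^sub>R Z x) \<bullet> b)" if "x \<in> S" for x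
  proof -
    have lin: "linear (a' x)"
      using C1_onD(1)[OF assms(1) that] has_derivative_linear by blast
    have "a' x (Z x) = a' x (\<Sum>b\<in>Basis. (Z x \<bullet> b) *\<^sub>R b)"
      by (simp add: euclidean_representation)
    also have "\<dots> = (\<Sum>b\<in>Basis. a' x b * (Z x \<bullet> b))"
      by (simp add: linear_sum[OF lin] linear_cmul[OF lin] mult.commute)
    finally show ?thesis
      using d that by (simp add: inner_add_left sum.distrib sum_distrib_left)
  qed
  with C1_on_scaleR[OF assms(1) C] show ?thesis
    unfolding has_divergence_on_def by blast
qed

lemma has_divergence_on_cmul:
  "has_divergence_on Z d S \<Longrightarrow> has_divergence_on (\<lambda>x. c *\<^sub>R Z x) (\<lambda>x. c * d x) S"
  using has_divergence_on_scaleR[OF C1_on_const[of S c]] by simp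

lemma has_divergence_on_id: "has_divergence_on (\<lambda>x. x) (\<lambda>x. real DIM('a)) (S :: 'a::euclidean_space set)"
  unfolding has_divergence_on_def
  by (rule exI[of _ "\<lambda>x h. h"]) (auto intro!: C1_onI)

section \<open>Compactly supported fields: the integral of the divergence vanishes\<close>

text \<open>Mean value theorem along a segment; it supplies the uniform bound for dominated
  convergence of difference quotients.\<close>

lemma bounded_line_derivative:
  fixes f :: "'a::real_normed_vector \<Rightarrow> real"
  assumes "\<And>x. (f has_derivative f' x) (at x)" "\<And>x. \<bar>f' x h\<bar> \<le> C" "e > 0"
  shows "\<bar>(f (x + e *\<^sub>R h) - f x) / e\<bar> \<le> C"
proof -
  have D: "((\<lambda>s. f (x + s *\<^sub>R h)) has_derivative (\<lambda>d. f' (x + s *\<^sub>R h) (d *\<^sub>R h))) (at s)" for s :: real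
    by (rule has_derivative_compose[of "\<lambda>s. x + s *\<^sub>R h", OF _ assms(1)])
      (auto intro!: derivative_eq_intros)
  have "f' y (d *\<^sub>R h) = d * f' y h" for y d
    using linear_cmul[OF has_derivative_linear[OF assms(1)], of y d h] by simp
  then have "DERIV (\<lambda>s. f (x + s *\<^sub>R h)) s :> f' (x + s *\<^sub>R h) h" for s
    using D[of s] by (simp add: has_field_derivative_def mult.commute[of _ "f' _ _"])
  from MVT2[of 0 e "\<lambda>s. f (x + s *\<^sub>R h)", OF assms(3) this]
  obtain z where "f (x + e *\<^sub>R h) - f x = e * f' (x + z *\<^sub>R h) h" by auto
  then show ?thesis using assms(2)[of "x + z *\<^sub>R h"] assms(3) by simp
qed

text \<open>The difference quotients of a compactly supported function have integral zero by translation
  invariance, and they converge boundedly to the directional derivative.\<close>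

lemma integral_directional_derivative_eq_0:
  fixes f :: "'a::euclidean_space \<Rightarrow> real"
  assumes f: "C1_on UNIV f f'" and K: "compact K" "\<And>x. x \<notin> K \<Longrightarrow> f x = 0"
  shows "integrable lborel (\<lambda>x. f' x h)" "integral\<^sup>L lborel (\<lambda>x. f' x h) = 0"
proof -
  have fd: "(f has_derivative f' x) (at x)" for x
    using C1_onD(1)[OF f] by simp
  have zero: "f' x h = 0" if "x \<notin> K" for x
  proof -
    have "(f has_derivative (\<lambda>_. 0)) (at x)"
      using has_derivative_transform_within_open[of "\<lambda>_. 0" "\<lambda>_. 0" x UNIV "- K" f] K that
      by (simp add: compact_imp_closed open_Compl)
    then show ?thesis
      using has_derivative_unique[OF fd] by metis
  qed
  have cf': "continuous_on UNIV (\<lambda>x. f' x h)" and cf: "continuous_on UNIV f"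
    using C1_onD[OF f] by auto
  have "bounded ((\<lambda>x. f' x h) ` K)"
    by (intro compact_imp_bounded compact_continuous_image K(1) continuous_on_subset[OF cf']) auto
  then obtain C0 where C0: "\<And>x. x \<in> K \<Longrightarrow> \<bar>f' x h\<bar> \<le> C0"
    by (auto simp: bounded_iff)
  define C where "C = max C0 0"
  have C: "\<bar>f' x h\<bar> \<le> C" for x
    using C0[of x] zero[of x] by (cases "x \<in> K") (auto simp: C_def)
  obtain B where B: "\<And>x. x \<in> K \<Longrightarrow> norm x \<le> B"
    using compact_imp_bounded[OF K(1)] by (auto simp: bounded_iff)
  define e where "e n = inverse (real (Suc n))" for n
  have e: "e n > 0" "e n \<le> 1" for n by (auto simp: e_def field_simps)
  define q where "q n x = (f (x + e n *\<^sub>R h) - f x) / e n" for n x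
  \<comment> \<open>The step sizes \<open>e n\<close> are at most 1, so all quotients
    \<open>q n\<close> vanish outside the ball of radius \<open>B + norm h\<close>; inside they are
    bounded by \<open>C\<close>.\<close>
  define w :: "'a \<Rightarrow> real" where "w x = indicator (cball 0 (B + norm h)) x *\<^sub>R C" for x
  have [measurable]: "f \<in> borel_measurable borel"
    by (rule borel_measurable_continuous_onI[OF cf])
  have m1: "(\<lambda>x. f' x h) \<in> borel_measurable lborel"
    using borel_measurable_continuous_onI[OF cf'] by simp
  have m2: "q n \<in> borel_measurable lborel" for n
    unfolding q_def by measurable
  have w: "integrable lborel w"
    unfolding w_def[abs_def] by (rule borel_integrable_compact[of _ "\<lambda>_. C"]) auto
  have lim: "(\<lambda>n. q n x) \<longlonglongrightarrow> f' x h" for x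
  proof -
    have "e \<longlonglongrightarrow> 0" unfolding e_def by (rule LIMSEQ_inverse_real_of_nat)
    then have "filterlim e (at 0) sequentially"
      using e by (auto simp: filterlim_at less_imp_neq[symmetric])
    moreover have "((\<lambda>s. (f (x + s *\<^sub>R h) - f x) / s) \<longlongrightarrow> f' x h) (at 0)"
    proof -
      have D: "((\<lambda>s. f (x + s *\<^sub>R h)) has_derivative (\<lambda>d. f' (x + 0 *\<^sub>R h) (d *\<^sub>R h))) (at (0::real))"
        by (rule has_derivative_compose[of "\<lambda>s. x + s *\<^sub>R h", OF _ fd])
          (auto intro!: derivative_eq_intros)
      have "f' x (d *\<^sub>R h) = d * f' x h" for d
        using linear_cmul[OF has_derivative_linear[OF fd], of x d h] by simp
      then have "DERIV (\<lambda>s. f (x + s *\<^sub>R h)) 0 :> f' x h"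
        using D by (simp add: has_field_derivative_def mult.commute[of _ "f' _ _"])
      then show ?thesis by (simp add: DERIV_def)
    qed
    ultimately show ?thesis
      unfolding q_def by (rule filterlim_compose[rotated])
  qed
  have bnd: "norm (q n x) \<le> w x" for n x
  proof (cases "x \<in> cball 0 (B + norm h)")
    case True
    then show ?thesis
      using bounded_line_derivative[of f f' h C "e n" x, OF fd C e(1)] by (simp add: w_def q_def)
  next
    case False
    then have "x \<notin> K" using B[of x] norm_ge_zero[of h] by (auto simp del: norm_ge_zero)
    have "norm x \<le> norm (x + e n *\<^sub>R h) + norm (e n *\<^sub>R h)"
      by (metis add_diff_cancel_right' norm_triangle_ineq4)
    also have "norm (e n *\<^sub>R h) \<le> norm h"
      using e[of n] by (simp add: mult_left_le_one_le)
    finally have "x + e n *\<^sub>R h \<notin> K" using False B by force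
    then show ?thesis using \<open>x \<notin> K\<close> K(2) False by (simp add: q_def w_def)
  qed
  have f_int: "integrable lborel f"
  proof -
    have "integrable lborel (\<lambda>x. indicator K x *\<^sub>R f x)"
      by (rule borel_integrable_compact[OF K(1) continuous_on_subset[OF cf]]) auto
    also have "(\<lambda>x. indicator K x *\<^sub>R f x) = f"
      by (rule ext) (use K(2) in \<open>auto simp: indicator_def\<close>)
    finally show ?thesis .
  qed
  have trans: "integral\<^sup>L lborel (q n) = 0" for n
  proof -
    have "integral\<^sup>L lborel (\<lambda>x. f (x + e n *\<^sub>R h)) = integral\<^sup>L lborel f"
      using integral_distr[of "(+) (e n *\<^sub>R h)" lborel borel f]
      by (simp add: lborel_distr_plus add.commute)
    moreover have "integrable lborel (\<lambda>x. f (x + e n *\<^sub>R h))"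
      using integrable_distr_eq[of "(+) (e n *\<^sub>R h)" lborel borel f] f_int
      by (simp add: lborel_distr_plus add.commute)
    ultimately show ?thesis
      unfolding q_def using f_int by simp
  qed
  show "integrable lborel (\<lambda>x. f' x h)"
    by (rule integrable_dominated_convergence[where s=q, OF m1 m2 w AE_I2 AE_I2[OF bnd]]) (rule lim)
  have "(\<lambda>n. integral\<^sup>L lborel (q n)) \<longlonglongrightarrow> integral\<^sup>L lborel (\<lambda>x. f' x h)"
    by (rule integral_dominated_convergence[where s=q, OF m1 m2 w AE_I2 AE_I2[OF bnd]]) (rule lim)
  then show "integral\<^sup>L lborel (\<lambda>x. f' x h) = 0"
    using LIMSEQ_unique by (auto simp: trans)
qed

lemma integral_divergence_compact_support:
  assumes "has_divergence_on Z d UNIV" "compact K" "\<And>x. x \<notin> K \<Longrightarrow> Z x = 0"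
  shows "integrable lborel d" "integral\<^sup>L lborel d = 0"
proof -
  obtain Z' where C: "C1_on UNIV Z Z'" and d: "d = (\<lambda>x. \<Sum>b\<in>Basis. Z' x b \<bullet> b)"
    using assms(1) unfolding has_divergence_on_def by auto
  have C1: "C1_on UNIV (\<lambda>x. Z x \<bullet> b) (\<lambda>x h. Z' x h \<bullet> b)" for b
    using C unfolding C1_on_def by (auto intro!: continuous_intros derivative_eq_intros)
  note * = integral_directional_derivative_eq_0[OF C1 assms(2)]
  show "integrable lborel d"
    unfolding d by (intro Bochner_Integration.integrable_sum *) (simp add: assms)
  show "integral\<^sup>L lborel d = 0"
    unfolding d by (subst Bochner_Integration.integral_sum) (auto intro!: * sum.neutral simp: assms)
qed

section \<open>A C1 step function\<close>

definition sq_pos :: "real \<Rightarrow> real" where "sq_pos \<tau> = (max 0 \<tau>)\<^sup>2"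

lemma DERIV_sq_pos: "DERIV sq_pos \<tau> :> 2 * max 0 \<tau>"
proof -
  consider "\<tau> < 0" | "\<tau> > 0" | "\<tau> = 0" by linarith
  then show ?thesis
  proof cases
    case 1
    have "DERIV (\<lambda>_. 0) \<tau> :> 2 * max 0 \<tau>" using 1 by simp
    then show ?thesis
      by (rule has_field_derivative_transform_within_open[of _ _ _ "{..<0}"])
        (use 1 in \<open>auto simp: sq_pos_def\<close>)
  next
    case 2
    have "DERIV (\<lambda>x. x\<^sup>2) \<tau> :> 2 * max 0 \<tau>"
      using 2 by (auto intro!: derivative_eq_intros)
    then show ?thesis
      by (rule has_field_derivative_transform_within_open[of _ _ _ "{0<..}"])
        (use 2 in \<open>auto simp: sq_pos_def\<close>)
  next
    case 3
    have "((\<lambda>h. sq_pos h / h) \<longlongrightarrow> 0) (at 0)"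
    proof (rule Lim_null_comparison[of _ "\<lambda>h. \<bar>h\<bar>"])
      show "\<forall>\<^sub>F h in at 0. norm (sq_pos h / h) \<le> \<bar>h\<bar>"
        by (intro always_eventually) (auto simp: sq_pos_def max_def power2_eq_square)
      show "((\<lambda>h::real. \<bar>h\<bar>) \<longlongrightarrow> 0) (at 0)" by (intro tendsto_eq_intros) auto
    qed
    then show ?thesis using 3 by (simp add: DERIV_def sq_pos_def)
  qed
qed

text \<open>Nested squared positive parts are C1. The function is 0 on the negative axis and 1
  beyond 1, with derivative in [0, 4]; the cutoff arguments use both the sign and the bound of the
  derivative.\<close>

definition smooth_step :: "real \<Rightarrow> real" where
  "smooth_step \<tau> = 1 - sq_pos (1 - sq_pos \<tau>)"

definition smooth_step' :: "real \<Rightarrow> real" where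
  "smooth_step' \<tau> = 4 * max 0 (1 - sq_pos \<tau>) * max 0 \<tau>"

lemma DERIV_smooth_step: "DERIV smooth_step \<tau> :> smooth_step' \<tau>"
proof -
  have "DERIV (\<lambda>\<tau>. 1 - sq_pos (1 - sq_pos \<tau>)) \<tau> :> 0 - (2 * max 0 (1 - sq_pos \<tau>)) * (0 - 2 * max 0 \<tau>)"
    by (intro DERIV_diff DERIV_const DERIV_sq_pos DERIV_chain2[OF DERIV_sq_pos])
  then show ?thesis
    unfolding smooth_step_def[abs_def] smooth_step'_def by (simp add: algebra_simps)
qed

lemma continuous_on_sq_pos [continuous_intros]:
  "continuous_on S f \<Longrightarrow> continuous_on S (\<lambda>x. sq_pos (f x))"
  unfolding sq_pos_def by (intro continuous_intros)

lemma continuous_smooth_step': "continuous_on S smooth_step'"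
  unfolding smooth_step'_def by (intro continuous_intros)

lemma smooth_step_simps:
  "\<tau> \<le> 0 \<Longrightarrow> smooth_step \<tau> = 0" "\<tau> \<ge> 1 \<Longrightarrow> smooth_step \<tau> = 1"
  "\<tau> \<le> 0 \<Longrightarrow> smooth_step' \<tau> = 0" "\<tau> \<ge> 1 \<Longrightarrow> smooth_step' \<tau> = 0"
proof -
  have "sq_pos \<tau> \<ge> 1" if "\<tau> \<ge> 1" using that by (simp add: sq_pos_def one_le_power)
  then show "\<tau> \<ge> 1 \<Longrightarrow> smooth_step \<tau> = 1" "\<tau> \<ge> 1 \<Longrightarrow> smooth_step' \<tau> = 0"
    by (auto simp: smooth_step_def smooth_step'_def sq_pos_def[of "1 - sq_pos \<tau>"])
qed (auto simp: smooth_step_def smooth_step'_def sq_pos_def)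

lemma smooth_step_bounds:
  "0 \<le> smooth_step \<tau>" "smooth_step \<tau> \<le> 1" "0 \<le> smooth_step' \<tau>" "smooth_step' \<tau> \<le> 4"
proof -
  have s: "sq_pos x \<ge> 0" for x by (simp add: sq_pos_def)
  have "sq_pos (1 - sq_pos \<tau>) \<le> 1"
    using s[of \<tau>] unfolding sq_pos_def[of "1 - sq_pos \<tau>"]
    by (intro power_le_one) (auto simp: max_def)
  then show "0 \<le> smooth_step \<tau>" by (simp add: smooth_step_def)
  show "smooth_step \<tau> \<le> 1" using s by (simp add: smooth_step_def)
  show "0 \<le> smooth_step' \<tau>" by (simp add: smooth_step'_def)
  show "smooth_step' \<tau> \<le> 4"
  proof (cases "\<tau> \<ge> 1")
    case True then show ?thesis by (simp add: smooth_step_simps)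
  next
    case False
    then have "max 0 (1 - sq_pos \<tau>) * max 0 \<tau> \<le> 1 * 1"
      using s[of \<tau>] by (intro mult_mono) (auto simp: max_def)
    then show ?thesis by (simp add: smooth_step'_def)
  qed
qed

section \<open>The divergence inequality and the Hopf lemma\<close>


lemma compact_positive_lower_bound:
  fixes f :: "'a::topological_space \<Rightarrow> real"
  assumes "compact K" "continuous_on K f" "\<And>x. x \<in> K \<Longrightarrow> f x > 0"
  obtains c where "c > 0" "\<And>x. x \<in> K \<Longrightarrow> f x \<ge> c"
proof (cases "K = {}")
  case True
  then show ?thesis using that[of 1] by auto
next
  case False
  with continuous_attains_inf[OF assms(1) _ assms(2)] assms(3) that show ?thesis by metis
qed

text \<open>If the second derivative along some basis direction were negative, the first derivative,
  zero at the minimum, would be negative just beyond it and \<open>w\<close> would drop below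
  \<open>w z\<close>. So every diagonal entry of the Hessian is nonnegative.\<close>

lemma divergence_nonneg_at_minimum:
  assumes S: "open S" "z \<in> S" and w: "C1_on S w (\<lambda>x h. G x \<bullet> h)"
    and G: "has_divergence_on G D S" and min: "\<And>x. x \<in> S \<Longrightarrow> w z \<le> w x"
  shows "D z \<ge> (0::real)"
proof -
  obtain G' where G': "C1_on S G G'" and D: "\<And>x. x \<in> S \<Longrightarrow> D x = (\<Sum>b\<in>Basis. G' x b \<bullet> b)"
    using G unfolding has_divergence_on_def by auto
  obtain e where e: "e > 0" "ball z e \<subseteq> S"
    using S openE by blast
  have "G' z b \<bullet> b \<ge> 0" if b: "b \<in> Basis" for b
  proof (rule ccontr)
    assume neg: "\<not> G' z b \<bullet> b \<ge> 0"
    have inS: "z + s *\<^sub>R b \<in> S" if "\<bar>s\<bar> < e" for s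
      using e b that by (auto simp: dist_norm)
    have k1: "DERIV (\<lambda>s. w (z + s *\<^sub>R b)) s :> G (z + s *\<^sub>R b) \<bullet> b" if "\<bar>s\<bar> < e" for s
    proof -
      have "((\<lambda>s. w (z + s *\<^sub>R b)) has_derivative (\<lambda>d. G (z + s *\<^sub>R b) \<bullet> (d *\<^sub>R b))) (at s)"
        by (rule has_derivative_compose[of "\<lambda>s. z + s *\<^sub>R b", OF _ C1_onD(1)[OF w inS[OF that]]])
          (auto intro!: derivative_eq_intros)
      then show ?thesis by (simp add: has_field_derivative_def mult.commute[of _ "_ \<bullet> _"])
    qed
    have k2: "DERIV (\<lambda>s. G (z + s *\<^sub>R b) \<bullet> b) 0 :> G' z b \<bullet> b"
    proof -
      have "((\<lambda>s. G (z + s *\<^sub>R b)) has_derivative (\<lambda>d. G' (z + 0 *\<^sub>R b) (d *\<^sub>R b))) (at (0::real))"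
        by (rule has_derivative_compose[of "\<lambda>s. z + s *\<^sub>R b", OF _ C1_onD(1)[OF G' inS]])
          (use e in \<open>auto intro!: derivative_eq_intros\<close>)
      from has_derivative_inner_left[OF this, of b]
      have "((\<lambda>s. G (z + s *\<^sub>R b) \<bullet> b) has_derivative (\<lambda>d. G' z (d *\<^sub>R b) \<bullet> b)) (at (0::real))"
        by simp
      moreover have "G' z (d *\<^sub>R b) = d *\<^sub>R G' z b" for d
        using linear_cmul[OF has_derivative_linear[OF C1_onD(1)[OF G' S(2)]]] by simp
      ultimately show ?thesis by (simp add: has_field_derivative_def mult.commute[of _ "_ \<bullet> _"])
    qed
    have zero: "G z \<bullet> b = 0"
      using DERIV_local_min[OF k1[of 0], of e] e min inS by auto
    obtain r where r: "r > 0" "\<And>h. 0 < h \<Longrightarrow> h < r \<Longrightarrow> G (z + h *\<^sub>R b) \<bullet> b < 0"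
      using has_real_derivative_neg_dec_right[OF k2] neg zero by auto
    define h where "h = min r e / 2"
    have h: "h > 0" "h < r" "h < e" using r e by (auto simp: h_def min_def)
    obtain x where x: "0 < x" "x < h" "w (z + h *\<^sub>R b) - w z = h * (G (z + x *\<^sub>R b) \<bullet> b)"
      using MVT2[of 0 h "\<lambda>s. w (z + s *\<^sub>R b)" "\<lambda>s. G (z + s *\<^sub>R b) \<bullet> b"] k1 h by auto
    have "h * (G (z + x *\<^sub>R b) \<bullet> b) < 0"
      using r(2)[of x] x h by (simp add: mult_pos_neg)
    with x min[OF inS[of h]] h show False by auto
  qed
  then show ?thesis
    unfolding D[OF S(2)] by (intro sum_nonneg) auto
qed

section \<open>One-sided derivatives and outer normals\<close>

text \<open>Meant for boundary points, where a function is differentiable only within the closed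
  domain: a ray that enters \<open>T\<close> still gives a convergent one-sided quotient.\<close>

lemma directional_derivative_limit:
  fixes f :: "'a::real_normed_vector \<Rightarrow> real"
  assumes f: "(f has_derivative f') (at y within T)"
    and T: "\<forall>\<^sub>F s in at_right 0. y + s *\<^sub>R h \<in> T"
  shows "((\<lambda>s. (f (y + s *\<^sub>R h) - f y) / s) \<longlongrightarrow> f' h) (at_right 0)"
proof -
  obtain r where r: "r > 0" "\<And>s. 0 < s \<Longrightarrow> s < r \<Longrightarrow> y + s *\<^sub>R h \<in> T"
    using T by (auto simp: eventually_at_right_field)
  have "((\<lambda>s. f (y + s *\<^sub>R h)) has_derivative (\<lambda>d. f' (d *\<^sub>R h))) (at (0::real) within {0<..<r})"
  proof (rule has_derivative_in_compose[of "\<lambda>s. y + s *\<^sub>R h"])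
    show "(f has_derivative f') (at (y + 0 *\<^sub>R h) within (\<lambda>s. y + s *\<^sub>R h) ` {0<..<r})"
      using has_derivative_subset[OF f, of "(\<lambda>s. y + s *\<^sub>R h) ` {0<..<r}"] r by fastforce
  qed (auto intro!: derivative_eq_intros)
  moreover have "f' (d *\<^sub>R h) = d * f' h" for d
    using linear_cmul[OF has_derivative_linear[OF f], of d h] by simp
  ultimately have "((\<lambda>s. f (y + s *\<^sub>R h)) has_real_derivative f' h) (at 0 within {0<..<r})"
    by (simp add: has_field_derivative_def mult.commute[of _ "f' _"])
  moreover have "at (0::real) within {0<..<r} = at_right 0"
    
    by (rule at_within_nhd[of 0 "{..<r}"]) (use r(1) in auto)
  ultimately show ?thesis
    by (simp add: has_field_derivative_iff)
qed

text \<open>The local defining function behind the normal has negative derivative along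
  \<open>h\<close>, so it is negative after small positive steps.\<close>

lemma outer_unit_normal_inward:
  assumes "outer_unit_normal Om y n" "n \<bullet> h < 0"
  shows "\<forall>\<^sub>F s in at_right 0. y + s *\<^sub>R h \<in> Om"
proof -
  obtain U \<phi> D\<phi> c where U: "open U" "y \<in> U" "has_C1_derivative_on \<phi> D\<phi> U"
    "Om \<inter> U = {x \<in> U. \<phi> x < (0::real)}" "\<phi> y = 0" "c > 0"
    "\<And>h. blinfun_apply (D\<phi> y) h = c * (n \<bullet> h)"
    using assms(1) unfolding outer_unit_normal_def by auto
  have lim: "((\<lambda>s. y + s *\<^sub>R h) \<longlongrightarrow> y) (at_right (0::real))"
    by (intro tendsto_eq_intros) auto
  then have inU: "\<forall>\<^sub>F s in at_right (0::real). y + s *\<^sub>R h \<in> U"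
    using U topological_tendstoD by blast
  have "(\<phi> has_derivative D\<phi> y) (at y within U)"
    using U unfolding has_C1_derivative_on_def by auto
  from directional_derivative_limit[OF this inU]
  have "((\<lambda>s. \<phi> (y + s *\<^sub>R h) / s) \<longlongrightarrow> c * (n \<bullet> h)) (at_right 0)"
    using U by simp
  moreover have "c * (n \<bullet> h) < 0" using U assms by (simp add: mult_pos_neg)
  ultimately have "\<forall>\<^sub>F s in at_right 0. \<phi> (y + s *\<^sub>R h) / s < 0"
    by (rule order_tendstoD)
  then show ?thesis
    using inU eventually_at_right_less[of 0]
  proof eventually_elim
    case (elim s)
    then have "\<phi> (y + s *\<^sub>R h) < 0" by (simp add: divide_less_0_iff)
    then show ?case using elim U by blast
  qed
qed

text \<open>\<open>rho\<close> is a defining function whose gradient \<open>P\<close> points inward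
  on the frontier. Two instances occur: the ball with R^2 - |x|^2, and its diffeomorphic images with
  that function pulled back by the inverse map. The bound on the Laplacian \<open>d\<close> of
  \<open>rho\<close> serves the Hopf barrier.\<close>

locale C2_domain =
  fixes Om :: "'a::euclidean_space set" and rho :: "'a \<Rightarrow> real" and P :: "'a \<Rightarrow> 'a" and d :: "'a \<Rightarrow> real"
  assumes open_Om: "open Om" and bounded_Om: "bounded Om"
    and rho_deriv: "\<And>x. x \<in> closure Om \<Longrightarrow> (rho has_derivative (\<lambda>h. P x \<bullet> h)) (at x within closure Om)"
    and rho_pos: "\<And>x. x \<in> Om \<Longrightarrow> rho x > 0"
    and rho_zero: "\<And>x. x \<in> frontier Om \<Longrightarrow> rho x = 0"
    and P_cont: "continuous_on (closure Om) P"
    and P_nonzero: "\<And>x. x \<in> frontier Om \<Longrightarrow> P x \<noteq> 0"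
    and P_div: "has_divergence_on P d Om"
    and d_bound: "\<exists>M. \<forall>x\<in>Om. \<bar>d x\<bar> \<le> M"
begin

lemma compact_closure_Om: "compact (closure Om)"
  using bounded_Om by (simp add: compact_closure)

lemma closure_cases: "x \<in> closure Om \<Longrightarrow> x \<in> Om \<or> x \<in> frontier Om"
  using open_Om by (auto simp: frontier_def interior_open)

lemma frontier_subset_closure: "x \<in> frontier Om \<Longrightarrow> x \<in> closure Om"
  by (auto simp: frontier_def)

lemma rho_nonneg: "x \<in> closure Om \<Longrightarrow> rho x \<ge> 0"
  using closure_cases rho_pos rho_zero by (metis less_imp_le order_refl)

lemma rho_cont: "continuous_on (closure Om) rho"
  using rho_deriv by (meson continuous_on_eq_continuous_within has_derivative_continuous)

lemma closure_derivative_at: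
  "x \<in> Om \<Longrightarrow> (f has_derivative f') (at x within closure Om) \<longleftrightarrow> (f has_derivative f') (at x)"
  by (metis at_within_interior closure_subset in_mono interior_maximal open_Om)

lemma rho_C1: "C1_on Om rho (\<lambda>x h. P x \<bullet> h)"
proof (rule C1_onI)
  fix x assume "x \<in> Om"
  then show "(rho has_derivative (\<bullet>) (P x)) (at x)"
    using rho_deriv[of x] closure_subset[of Om] closure_derivative_at by blast
qed (intro continuous_intros continuous_on_subset[OF P_cont] closure_subset)

text \<open>The set where \<open>q\<close> is not positive is compact and misses the frontier, so
  \<open>rho\<close> is bounded below on it by a positive number.\<close>

lemma strip:
  assumes "continuous_on (closure Om) q" "\<And>x. x \<in> frontier Om \<Longrightarrow> q x > (0::real)"
  obtains \<delta> where "\<delta> > 0" "\<And>x. x \<in> closure Om \<Longrightarrow> rho x \<le> \<delta> \<Longrightarrow> q x > 0"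
proof -
  define T where "T = {x \<in> closure Om. q x \<le> 0}"
  have T: "compact T"
    unfolding T_def
    by (rule closedin_compact[OF compact_closure_Om])
      (use continuous_closedin_preimage[OF assms(1), of "{..0}"] in
        \<open>auto simp: vimage_def Int_def conj_commute elim!: back_subst[of "closedin _"]\<close>)
  obtain c where "c > 0" "\<And>x. x \<in> T \<Longrightarrow> rho x \<ge> c"
  proof (rule compact_positive_lower_bound[OF T])
    show "continuous_on T rho"
      using rho_cont by (rule continuous_on_subset) (auto simp: T_def)
    show "rho x > 0" if "x \<in> T" for x
      using that assms(2)[of x] closure_cases[of x] rho_pos[of x] by (auto simp: T_def)
  qed auto
  then show ?thesis using that[of "c / 2"] by (force simp: T_def)
qed

lemma set_integrable_Om:
  assumes "continuous_on (closure Om) (f :: 'a \<Rightarrow> real)"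
  shows "set_integrable lborel Om f"
proof -
  have "set_integrable lborel (closure Om) f"
    unfolding set_integrable_def by (rule borel_integrable_compact[OF compact_closure_Om assms])
  then show ?thesis
    by (rule set_integrable_subset) (use open_Om closure_subset in auto)
qed

text \<open>A one-sided form of the divergence theorem. Multiplied by a cutoff increasing in
  \<open>rho\<close>, the field \<open>Z\<close> has total divergence 0, and differentiating the
  cutoff contributes a nonnegative term, because that happens in a strip where
  \<open>Z x \<bullet> P x\<close> is positive. Shrinking the strip leaves the integral of
  \<open>D\<close>.\<close>

lemma integral_divergence_le_0:
  assumes Z: "continuous_on (closure Om) Z" "has_divergence_on Z D Om"
    and D: "continuous_on (closure Om) D"
    and bd: "\<And>y. y \<in> frontier Om \<Longrightarrow> Z y \<bullet> P y > 0"
  shows "(LINT x:Om|lborel. D x) \<le> 0"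
proof -
  obtain \<delta> where \<delta>: "\<delta> > 0" "\<And>x. x \<in> closure Om \<Longrightarrow> rho x \<le> \<delta> \<Longrightarrow> Z x \<bullet> P x > 0"
    using strip[of "\<lambda>x. Z x \<bullet> P x"] bd Z P_cont by (auto intro: continuous_intros)
  define e where "e n = \<delta> / 2 * inverse (real (Suc n))" for n
  have e: "e n > 0" "e n \<le> \<delta> / 2" for n
  proof -
    show "e n > 0" using \<delta> by (simp add: e_def)
    have "inverse (real (Suc n)) \<le> 1" by (simp add: inverse_eq_divide)
    then show "e n \<le> \<delta> / 2" using \<delta> unfolding e_def by (intro mult_left_le) auto
  qed
  \<comment> \<open>The cutoff is 0 for \<open>rho x \<le> e n\<close> and 1 for
    \<open>rho x \<ge> 2 * e n\<close>; as \<open>2 * e n \<le> \<delta>\<close>, the transition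
    takes place inside the strip.\<close>
  define cut where "cut n x = smooth_step (rho x / e n - 1)" for n x
  have le: "(LINT x:Om|lborel. cut n x * D x) \<le> 0" and
    cut_int: "set_integrable lborel Om (\<lambda>x. cut n x * D x)" for n
  proof -
    have ccut: "continuous_on (closure Om) (cut n)"
      unfolding cut_def smooth_step_def using e(1)[of n]
      by (intro continuous_intros rho_cont) auto
    then show cut_int: "set_integrable lborel Om (\<lambda>x. cut n x * D x)"
      by (intro set_integrable_Om continuous_intros D)
    \<comment> \<open>Extension by zero: \<open>F\<close> and \<open>E\<close> vanish off the
      compact subset \<open>K\<close> of \<open>Om\<close>, so the statements on \<open>Om\<close>
      and on \<open>- K\<close> glue to the whole space.\<close>
    define F where "F x = (if x \<in> Om then cut n x *\<^sub>R Z x else 0)" for x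
    define E :: "'a \<Rightarrow> real" where "E x = (if x \<in> Om then cut n x * D x +
      smooth_step' (rho x / e n - 1) * (P x \<bullet> Z x / e n) else 0)" for x
    define K where "K = {x \<in> closure Om. rho x \<ge> e n}"
    have K: "compact K"
      unfolding K_def
      by (rule closedin_compact[OF compact_closure_Om])
        (use continuous_closedin_preimage[OF rho_cont, of "{e n..}"] in
          \<open>auto simp: vimage_def Int_def conj_commute elim!: back_subst[of "closedin _"]\<close>)
    have KOm: "K \<subseteq> Om"
      using closure_cases rho_zero e(1)[of n] by (fastforce simp: K_def)
    have F0: "F x = 0" if "x \<notin> K" for x
      using that closure_subset[of Om] e(1)[of n]
      by (auto simp: F_def cut_def K_def smooth_step_simps divide_simps)
    have E0: "E x = 0" if "x \<notin> K" for x
      using that closure_subset[of Om] e(1)[of n]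
      by (auto simp: E_def cut_def K_def smooth_step_simps divide_simps)
    have "C1_on Om (\<lambda>x. rho x / e n - 1) (\<lambda>x h. P x \<bullet> h / e n)"
    proof (rule C1_onI)
      fix x assume "x \<in> Om"
      then show "((\<lambda>x. rho x / e n - 1) has_derivative (\<lambda>h. P x \<bullet> h / e n)) (at x)"
        using e(1)[of n] C1_onD(1)[OF rho_C1, of x] by (auto intro!: derivative_eq_intros)
    qed (use e(1)[of n] in \<open>auto intro!: continuous_on_divide C1_onD(2)[OF rho_C1]\<close>)
    from C1_on_compose_real[OF this DERIV_smooth_step continuous_smooth_step']
    have "C1_on Om (cut n) (\<lambda>x h. smooth_step' (rho x / e n - 1) * (P x \<bullet> h / e n))"
      unfolding cut_def[abs_def] .
    from has_divergence_on_scaleR[OF this Z(2)]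
    have 1: "has_divergence_on F E Om"
      by (rule has_divergence_on_cong[OF open_Om]) (auto simp: F_def E_def)
    have 2: "has_divergence_on F E (- K)"
    proof (rule has_divergence_on_cong)
      show "has_divergence_on (\<lambda>x. 0 *\<^sub>R x) (\<lambda>x. 0 * real DIM('a)) (- K)"
        by (intro has_divergence_on_cmul has_divergence_on_id)
    qed (use K F0 E0 in \<open>auto simp: compact_imp_closed\<close>)
    have "has_divergence_on F E (Om \<union> - K)"
      using 1 2 K open_Om by (intro has_divergence_on_Un) (auto simp: compact_imp_closed)
    moreover have "Om \<union> - K = UNIV" using KOm by auto
    ultimately have div: "has_divergence_on F E UNIV" by simp
    have "(LINT x:Om|lborel. cut n x * D x) \<le> integral\<^sup>L lborel E"
      unfolding set_lebesgue_integral_def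
    proof (rule integral_mono)
      show "integrable lborel (\<lambda>x. indicator Om x *\<^sub>R (cut n x * D x))"
        using cut_int unfolding set_integrable_def .
      show "integrable lborel E"
        using integral_divergence_compact_support(1)[OF div K F0] .
      fix x
      \<comment> \<open>The term produced by the cutoff: within the strip all its factors have the
        right sign, and beyond \<open>rho x = \<delta>\<close> the factor
        \<open>smooth_step'\<close> is 0.\<close>
      have "0 \<le> smooth_step' (rho x / e n - 1) * (P x \<bullet> Z x / e n)" if "x \<in> Om"
      proof (cases "rho x \<le> \<delta>")
        case True
        then have "Z x \<bullet> P x > 0" using \<delta>(2)[of x] that closure_subset[of Om] by auto
        then show ?thesis
          using e(1)[of n] smooth_step_bounds(3) by (simp add: inner_commute)
      next
        case False
        then have "rho x / e n - 1 \<ge> 1"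
          using e[of n] by (simp add: divide_simps)
        then show ?thesis by (simp add: smooth_step_simps)
      qed
      then show "indicator Om x *\<^sub>R (cut n x * D x) \<le> E x"
        by (auto simp: E_def indicator_def)
    qed
    also have "\<dots> = 0"
      using integral_divergence_compact_support(2)[OF div K F0] .
    finally show "(LINT x:Om|lborel. cut n x * D x) \<le> 0" .
  qed
  have "(\<lambda>n. LINT x:Om|lborel. cut n x * D x) \<longlonglongrightarrow> (LINT x:Om|lborel. D x)"
    unfolding set_lebesgue_integral_def
  proof (rule integral_dominated_convergence[where w="\<lambda>x. norm (indicator Om x *\<^sub>R D x)"])
    have Dint: "integrable lborel (\<lambda>x. indicator Om x *\<^sub>R D x)"
      using set_integrable_Om[OF D] unfolding set_integrable_def .
    then show "integrable lborel (\<lambda>x. norm (indicator Om x *\<^sub>R D x))"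
      "(\<lambda>x. indicator Om x *\<^sub>R D x) \<in> borel_measurable lborel" by auto
    show "(\<lambda>x. indicator Om x *\<^sub>R (cut n x * D x)) \<in> borel_measurable lborel" for n
      using cut_int[of n] unfolding set_integrable_def by auto
    have "\<bar>cut n x * D x\<bar> \<le> \<bar>D x\<bar>" for n x
      using smooth_step_bounds[of "rho x / e n - 1"]
      by (auto simp: cut_def abs_mult intro!: mult_left_le_one_le)
    then show "AE x in lborel. norm (indicator Om x *\<^sub>R (cut n x * D x)) \<le> norm (indicator Om x *\<^sub>R D x)" for n
      by (auto simp: indicator_def)
    have "(\<lambda>n. indicator Om x *\<^sub>R (cut n x * D x)) \<longlonglongrightarrow> indicator Om x *\<^sub>R D x" for x
    proof (cases "x \<in> Om")
      case True
      have "e \<longlonglongrightarrow> \<delta> / 2 * 0"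
        unfolding e_def by (intro tendsto_intros LIMSEQ_inverse_real_of_nat)
      then have "\<forall>\<^sub>F n in sequentially. e n < rho x / 2"
        using order_tendstoD(2)[of e 0 sequentially "rho x / 2"] rho_pos[OF True] by simp
      then have "\<forall>\<^sub>F n in sequentially. cut n x = 1"
      proof eventually_elim
        case (elim n)
        then show ?case
          unfolding cut_def using e(1)[of n] by (intro smooth_step_simps) (simp add: divide_simps)
      qed
      then have "(\<lambda>n. cut n x) \<longlonglongrightarrow> 1" by (rule tendsto_eventually)
      then show ?thesis
        using tendsto_mult_right[of "\<lambda>n. cut n x" 1 sequentially "D x"] True by simp
    qed simp
    then show "AE x in lborel. (\<lambda>n. indicator Om x *\<^sub>R (cut n x * D x)) \<longlonglongrightarrow> indicator Om x *\<^sub>R D x"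
      by simp
  qed
  then show ?thesis
    by (rule LIMSEQ_le_const2) (use le in auto)
qed

text \<open>The normal comes from some local defining function that need not be \<open>rho\<close>;
  what it provides is a set of inward directions. Since \<open>rho\<close> is nonnegative on the
  closure and 0 at \<open>y\<close>, the gradient \<open>P y\<close> has nonnegative product with
  all of them, which forces it onto the ray opposite to \<open>n\<close>.\<close>

lemma gradient_outer_unit_normal:
  assumes y: "y \<in> frontier Om" and n: "outer_unit_normal Om y n"
  obtains c where "c > 0" "P y = - c *\<^sub>R n"
proof -
  have nn: "n \<bullet> n = 1"
    using n by (simp add: outer_unit_normal_def norm_eq_1)
  have key: "P y \<bullet> h \<ge> 0" if "n \<bullet> h < 0" for h
  proof (rule tendsto_lowerbound)
    have in': "\<forall>\<^sub>F s in at_right 0. y + s *\<^sub>R h \<in> closure Om"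
      using outer_unit_normal_inward[OF n that] by (rule eventually_mono) (use closure_subset in auto)
    show "((\<lambda>s. (rho (y + s *\<^sub>R h) - rho y) / s) \<longlongrightarrow> P y \<bullet> h) (at_right 0)"
      by (rule directional_derivative_limit[OF rho_deriv[OF frontier_subset_closure[OF y]] in'])
    show "\<forall>\<^sub>F s in at_right 0. 0 \<le> (rho (y + s *\<^sub>R h) - rho y) / s"
      using in' eventually_at_right_less[of 0]
      by eventually_elim (simp add: rho_zero[OF y] rho_nonneg)
  qed simp
  define q where "q = P y - (P y \<bullet> n) *\<^sub>R n"
  have qn: "q \<bullet> n = 0" by (simp add: q_def inner_diff_left nn)
  have Pq: "P y \<bullet> q = q \<bullet> q"
    using qn by (simp add: q_def inner_diff_left inner_diff_right inner_commute)
  have "q \<bullet> q \<le> e * \<bar>P y \<bullet> n\<bar>" if "e > 0" for e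
  proof -
    \<comment> \<open>This direction leans inward only by \<open>e\<close> and is otherwise opposite
      to the tangential part \<open>q\<close> of the gradient; letting \<open>e\<close> tend to 0
      shows \<open>q \<bullet> q \<le> 0\<close>.\<close>
    have "P y \<bullet> (- (q + e *\<^sub>R n)) \<ge> 0"
      using that qn by (intro key) (simp add: inner_add_right inner_diff_right nn inner_commute)
    then have "q \<bullet> q \<le> e * - (P y \<bullet> n)" by (simp add: inner_add_right inner_diff_right Pq)
    also have "\<dots> \<le> e * \<bar>P y \<bullet> n\<bar>" using that by (intro mult_left_mono) auto
    finally show ?thesis .
  qed
  from this[of "\<epsilon> / (\<bar>P y \<bullet> n\<bar> + 1)" for \<epsilon>] have "q \<bullet> q \<le> 0 + \<epsilon>" if "\<epsilon> > 0" for \<epsilon>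
  proof -
    have "q \<bullet> q \<le> \<epsilon> / (\<bar>P y \<bullet> n\<bar> + 1) * \<bar>P y \<bullet> n\<bar>"
      using that by (intro \<open>\<And>e. e > 0 \<Longrightarrow> q \<bullet> q \<le> e * \<bar>P y \<bullet> n\<bar>\<close>) simp
    also have "\<dots> \<le> \<epsilon>" using that by (simp add: field_simps)
    finally show ?thesis by simp
  qed
  then have "q \<bullet> q \<le> 0" by (rule field_le_epsilon)
  then have "q = 0" using inner_gt_zero_iff[of q] by linarith
  then have P: "P y = (P y \<bullet> n) *\<^sub>R n" by (simp add: q_def)
  have "P y \<bullet> n \<le> 0" using key[of "- n"] nn by simp
  moreover have "P y \<bullet> n \<noteq> 0" using P P_nonzero[OF y] by auto
  ultimately show ?thesis using that[of "- (P y \<bullet> n)"] P by simp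
qed

text \<open>Hopf's boundary point lemma, with the barrier \<^term>\<open>exp (K * rho x) - 1\<close> near the boundary.\<close>

lemma hopf_boundary_point:
  assumes u: "continuous_on (closure Om) u" "C1_on Om u (\<lambda>x h. U x \<bullet> h)"
    "has_divergence_on U (\<lambda>x. - (l * u x)) Om" "\<And>x. x \<in> Om \<Longrightarrow> u x > 0"
    and y: "y \<in> frontier Om" "u y = 0" "(u has_derivative u') (at y within closure Om)"
    and n: "outer_unit_normal Om y n"
  shows "u' n < 0"
proof -
  obtain M where M: "\<And>x. x \<in> Om \<Longrightarrow> \<bar>d x\<bar> \<le> M" using d_bound by auto
  have u_nonneg: "u x \<ge> 0" if "x \<in> closure Om" for x
    using continuous_ge_on_closure[OF u(1) that, of 0] u(4) less_imp_le by blast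
  obtain \<delta> where \<delta>: "\<delta> > 0" "\<And>x. x \<in> closure Om \<Longrightarrow> rho x \<le> \<delta> \<Longrightarrow> P x \<bullet> P x > 0"
    using strip[of "\<lambda>x. P x \<bullet> P x"] P_nonzero P_cont by (auto intro: continuous_intros)
  define S where "S = {x \<in> closure Om. rho x \<le> \<delta>}"
  have S: "compact S"
    unfolding S_def
    by (rule closedin_compact[OF compact_closure_Om])
      (use continuous_closedin_preimage[OF rho_cont, of "{..\<delta>}"] in
        \<open>auto simp: vimage_def Int_def conj_commute elim!: back_subst[of "closedin _"]\<close>)
  have T: "compact {x \<in> closure Om. rho x \<ge> \<delta>}"
    by (rule closedin_compact[OF compact_closure_Om])
      (use continuous_closedin_preimage[OF rho_cont, of "{\<delta>..}"] in
        \<open>auto simp: vimage_def Int_def conj_commute elim!: back_subst[of "closedin _"]\<close>)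
  obtain c where c: "c > 0" "\<And>x. x \<in> S \<Longrightarrow> P x \<bullet> P x \<ge> c"
  proof (rule compact_positive_lower_bound[OF S])
    show "continuous_on S (\<lambda>x. P x \<bullet> P x)"
      by (intro continuous_intros continuous_on_subset[OF P_cont]) (auto simp: S_def)
  qed (use \<delta> in \<open>auto simp: S_def\<close>)
  obtain m where m: "m > 0" "\<And>x. x \<in> closure Om \<Longrightarrow> rho x \<ge> \<delta> \<Longrightarrow> u x \<ge> m"
  proof (rule compact_positive_lower_bound[OF T, of u])
    show "continuous_on {x \<in> closure Om. \<delta> \<le> rho x} u"
      by (intro continuous_on_subset[OF u(1)]) auto
    show "u x > 0" if "x \<in> {x \<in> closure Om. \<delta> \<le> rho x}" for x
      using that closure_cases[of x] rho_zero[of x] \<delta>(1) u(4)[of x] by auto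
  qed auto
  \<comment> \<open>The Laplacian of exp(K rho) is K exp(K rho) (d + K |P|^2); this \<open>K\<close>
    makes the last factor at least |l| + 1 in the strip.\<close>
  define K where "K = max 1 ((\<bar>l\<bar> + \<bar>M\<bar> + 1) / c)"
  have K: "K \<ge> 1" "K * c \<ge> \<bar>l\<bar> + \<bar>M\<bar> + 1"
  proof -
    show "K \<ge> 1" by (simp add: K_def)
    have "K \<ge> (\<bar>l\<bar> + \<bar>M\<bar> + 1) / c" by (simp add: K_def)
    then show "K * c \<ge> \<bar>l\<bar> + \<bar>M\<bar> + 1" using c by (simp add: field_simps)
  qed
  \<comment> \<open>Scales the barrier to equal \<open>m\<close>, the lower bound of
    \<open>u\<close>, on the inner edge \<open>rho x = \<delta>\<close>.\<close>
  define \<eta> where "\<eta> = m / (exp (K * \<delta>) - 1)"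
  have ex: "exp (K * \<delta>) - 1 > 0" using K \<delta> by simp
  then have \<eta>: "\<eta> > 0" using m by (simp add: \<eta>_def)
  define w where "w x = u x - \<eta> * (exp (K * rho x) - 1)" for x
  have cw: "continuous_on S w"
    unfolding w_def
    by (intro continuous_intros continuous_on_subset[OF u(1)] continuous_on_subset[OF rho_cont])
      (auto simp: S_def)
  have yS: "y \<in> S" using y \<delta> rho_zero frontier_subset_closure by (auto simp: S_def)
  obtain z where z: "z \<in> S" "\<And>x. x \<in> S \<Longrightarrow> w z \<le> w x"
    using continuous_attains_inf[OF S _ cw] yS by blast
  \<comment> \<open>On both edges of the strip \<open>u\<close> dominates the barrier, so a negative
    minimum of \<open>w\<close> would lie strictly inside, where the Laplacian of \<open>w\<close>
    would have to be nonnegative.\<close>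
  have "w z \<ge> 0"
  proof (rule ccontr)
    assume neg: "\<not> w z \<ge> 0"
    have zOm: "z \<in> Om"
    proof (rule ccontr)
      assume "z \<notin> Om"
      then have "z \<in> frontier Om" using z closure_cases by (auto simp: S_def)
      then have "w z = u z" by (simp add: w_def rho_zero)
      then show False using neg u_nonneg[of z] z by (simp add: S_def)
    qed
    have z\<delta>: "rho z < \<delta>"
    proof (rule ccontr)
      assume "\<not> rho z < \<delta>"
      then have "rho z = \<delta>" using z by (simp add: S_def)
      then have "w z = u z - m" using less_imp_neq[OF ex] unfolding w_def \<eta>_def by simp
      then show False using neg m(2)[of z] z \<open>rho z = \<delta>\<close> by (simp add: S_def)
    qed
    define W where "W = Om \<inter> rho -` {..<\<delta>}"
    have W: "open W" "z \<in> W" "W \<subseteq> Om" "W \<subseteq> S"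
      unfolding W_def
      using continuous_open_preimage[OF C1_onD(3)[OF rho_C1] open_Om, of "{..<\<delta>}"] zOm z\<delta> closure_subset[of Om]
      by (auto simp: S_def)
    define a where "a x = - (\<eta> * K * exp (K * rho x))" for x
    have a: "C1_on W a (\<lambda>x h. - (\<eta> * K * K * exp (K * rho x)) * (P x \<bullet> h))"
      unfolding a_def
      by (rule C1_on_compose_real[OF C1_on_subset[OF rho_C1 W(3)], where g="\<lambda>r. - (\<eta> * K * exp (K * r))"
            and g'="\<lambda>r. - (\<eta> * K * K * exp (K * r))"])
        (auto intro!: derivative_eq_intros continuous_intros)
    have "C1_on W (\<lambda>x. - \<eta> * (exp (K * rho x) - 1)) (\<lambda>x h. - \<eta> * K * exp (K * rho x) * (P x \<bullet> h))"
      by (rule C1_on_compose_real[OF C1_on_subset[OF rho_C1 W(3)], where g="\<lambda>r. - \<eta> * (exp (K * r) - 1)"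
            and g'="\<lambda>r. - \<eta> * K * exp (K * r)"])
        (auto intro!: derivative_eq_intros continuous_intros)
    from C1_on_add[OF C1_on_subset[OF u(2) W(3)] this]
    have w: "C1_on W w (\<lambda>x h. (U x + a x *\<^sub>R P x) \<bullet> h)"
      by (rule C1_on_cong[OF W(1)]) (auto simp: w_def a_def inner_add_left inner_diff_left)
    have "has_divergence_on (\<lambda>x. U x + a x *\<^sub>R P x)
      (\<lambda>x. - (l * u x) + (a x * d x + - (\<eta> * K * K * exp (K * rho x)) * (P x \<bullet> P x))) W"
      by (intro has_divergence_on_add has_divergence_on_scaleR[OF a]
          has_divergence_on_subset[OF u(3) W(3)] has_divergence_on_subset[OF P_div W(3)])
    from divergence_nonneg_at_minimum[OF W(1,2) w this] z W
    have ge: "- (l * u z) - \<eta> * K * exp (K * rho z) * (d z + K * (P z \<bullet> P z)) \<ge> 0"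
      by (auto simp: a_def algebra_simps)
    have "d z + K * (P z \<bullet> P z) \<ge> - \<bar>M\<bar> + K * c"
      using M[OF zOm] mult_left_mono[OF c(2)[OF z(1)], of K] K by linarith
    then have "d z + K * (P z \<bullet> P z) \<ge> \<bar>l\<bar> + 1" using K by linarith
    then have "\<eta> * K * exp (K * rho z) * (d z + K * (P z \<bullet> P z)) \<ge> \<eta> * 1 * exp (K * rho z) * (\<bar>l\<bar> + 1)"
      using \<eta> K by (intro mult_mono) auto
    \<comment> \<open>A negative \<open>w z\<close> also bounds \<open>u z\<close> by the barrier,
      which controls the zero-order term for either sign of \<open>l\<close>.\<close>
    moreover have "- (l * u z) \<le> \<bar>l\<bar> * (\<eta> * exp (K * rho z))"
    proof -
      have "u z \<le> \<eta> * exp (K * rho z)" using neg \<eta> by (simp add: w_def algebra_simps)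
      then have "\<bar>l\<bar> * u z \<le> \<bar>l\<bar> * (\<eta> * exp (K * rho z))" by (intro mult_left_mono) auto
      moreover have "- l * u z \<le> \<bar>l\<bar> * u z"
        using u(4)[OF zOm] by (intro mult_right_mono) auto
      ultimately show ?thesis by simp
    qed
    moreover have "\<eta> * exp (K * rho z) > 0" using \<eta> by simp
    ultimately show False using ge by (simp add: algebra_simps)
  qed
  then have barrier: "u x \<ge> \<eta> * (K * rho x)" if "x \<in> S" for x
  proof -
    have "exp (K * rho x) - 1 \<ge> K * rho x" using exp_ge_add_one_self[of "K * rho x"] by linarith
    then have "\<eta> * (K * rho x) \<le> \<eta> * (exp (K * rho x) - 1)" using \<eta> by (intro mult_left_mono) auto
    then show ?thesis using \<open>w z \<ge> 0\<close> z(2)[OF that] by (simp add: w_def)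
  qed
  have nn: "n \<bullet> - n < 0"
    using n by (simp add: outer_unit_normal_def norm_eq_1)
  have in': "\<forall>\<^sub>F s in at_right 0. y + s *\<^sub>R (- n) \<in> closure Om"
    using outer_unit_normal_inward[OF n nn] by (rule eventually_mono) (use closure_subset in auto)
  have lim1: "((\<lambda>s. (u (y + s *\<^sub>R (- n)) - u y) / s) \<longlongrightarrow> u' (- n)) (at_right 0)"
    by (rule directional_derivative_limit[OF y(3) in'])
  have lim2: "((\<lambda>s. (rho (y + s *\<^sub>R (- n)) - rho y) / s) \<longlongrightarrow> P y \<bullet> - n) (at_right 0)"
    by (rule directional_derivative_limit[OF rho_deriv[OF frontier_subset_closure[OF y(1)]] in'])
  have small: "\<forall>\<^sub>F s in at_right (0::real). rho (y + s *\<^sub>R (- n)) < \<delta>"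
  proof -
    have "((\<lambda>s. y + s *\<^sub>R (- n)) \<longlongrightarrow> y) (at_right (0::real))"
      by (intro tendsto_eq_intros) auto
    then have "((\<lambda>s. rho (y + s *\<^sub>R (- n))) \<longlongrightarrow> rho y) (at_right 0)"
      by (rule continuous_on_tendsto_compose[OF rho_cont])
        (use frontier_subset_closure[OF y(1)] in' in auto)
    then show ?thesis
      by (rule order_tendstoD) (use \<delta> rho_zero[OF y(1)] in simp)
  qed
  \<comment> \<open>\<open>u\<close> and \<open>rho\<close> both vanish at \<open>y\<close>, so the
    barrier inequality passes to the difference quotients along the inward normal.\<close>
  have "u' (- n) \<ge> \<eta> * K * (P y \<bullet> - n)"
  proof (rule tendsto_le[OF _ lim1 tendsto_mult_left[OF lim2]])
    show "\<forall>\<^sub>F s in at_right 0. \<eta> * K * ((rho (y + s *\<^sub>R - n) - rho y) / s) \<le> (u (y + s *\<^sub>R - n) - u y) / s"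
      using in' small eventually_at_right_less[of 0]
    proof eventually_elim
      case (elim s)
      then have "u (y + s *\<^sub>R - n) \<ge> \<eta> * (K * rho (y + s *\<^sub>R - n))"
        by (intro barrier) (auto simp: S_def)
      then show ?case
        using elim y rho_zero[OF y(1)] by (simp add: divide_right_mono mult.assoc)
    qed
  qed simp
  moreover obtain c' where c': "c' > 0" "P y = - c' *\<^sub>R n"
    using gradient_outer_unit_normal[OF y(1) n] .
  moreover have "n \<bullet> n = 1"
    using n by (simp add: outer_unit_normal_def norm_eq_1)
  ultimately have "u' (- n) \<ge> \<eta> * K * c'" by simp
  moreover have "\<eta> * K * c' > 0" using \<eta> K c' by simp
  moreover have "u' (- n) = - u' n"
    using linear_neg[OF has_derivative_linear[OF y(3)]] .
  ultimately show ?thesis by linarith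
qed

text \<open>By the Riccati equation for \<open>V\<close>, the divergence of phi^2 V + phi G
  completes to the square |phi V + G|^2 plus terms without \<open>V\<close>. The field
  \<open>X\<close> is a free correction that can make the boundary sign strict at the cost of its
  divergence.\<close>

lemma integral_picone_le_0:
  assumes V: "continuous_on (closure Om) V" "has_divergence_on V (\<lambda>x. l + V x \<bullet> V x) Om"
    and \<phi>: "continuous_on (closure Om) \<phi>" "C1_on Om \<phi> (\<lambda>x h. G x \<bullet> h)"
      "continuous_on (closure Om) G" "has_divergence_on G L Om" "continuous_on (closure Om) L"
    and X: "continuous_on (closure Om) X" "has_divergence_on X dX Om" "continuous_on (closure Om) dX"
    and bd: "\<And>y. y \<in> frontier Om \<Longrightarrow> ((\<phi> y)\<^sup>2 *\<^sub>R V y + \<phi> y *\<^sub>R G y - X y) \<bullet> P y > 0"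
  shows "(LINT x:Om|lborel. (norm (\<phi> x *\<^sub>R V x + G x))\<^sup>2 + (l * (\<phi> x)\<^sup>2 + \<phi> x * L x - dX x)) \<le> 0"
proof -
  have sq: "C1_on Om (\<lambda>x. (\<phi> x)\<^sup>2) (\<lambda>x h. 2 * \<phi> x * (G x \<bullet> h))"
    by (rule C1_on_compose_real[OF \<phi>(2), where g="\<lambda>s. s\<^sup>2" and g'="\<lambda>s. 2 * s"])
      (auto intro!: derivative_eq_intros continuous_intros)
  have "has_divergence_on (\<lambda>x. ((\<phi> x)\<^sup>2 *\<^sub>R V x + \<phi> x *\<^sub>R G x) + (- 1) *\<^sub>R X x)
    (\<lambda>x. (((\<phi> x)\<^sup>2 * (l + V x \<bullet> V x) + 2 * \<phi> x * (G x \<bullet> V x)) + (\<phi> x * L x + G x \<bullet> G x)) + (- 1) * dX x) Om"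
    by (intro has_divergence_on_add has_divergence_on_cmul has_divergence_on_scaleR[OF sq]
        has_divergence_on_scaleR[OF \<phi>(2)] V(2) \<phi>(4) X(2))
  then have "has_divergence_on (\<lambda>x. (\<phi> x)\<^sup>2 *\<^sub>R V x + \<phi> x *\<^sub>R G x - X x)
    (\<lambda>x. (norm (\<phi> x *\<^sub>R V x + G x))\<^sup>2 + (l * (\<phi> x)\<^sup>2 + \<phi> x * L x - dX x)) Om"
    by (rule has_divergence_on_cong[OF open_Om])
      (simp_all only: power2_norm_eq_inner, simp_all add: inner_add_left inner_add_right
        inner_commute algebra_simps power2_eq_square)
  then show ?thesis
    by (rule integral_divergence_le_0[rotated]) (use bd in \<open>auto intro!: continuous_intros V \<phi> X\<close>)
qed

end

section \<open>Robin eigenfunctions and the radial solution\<close>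


lemma C1_on_inner_self: "C1_on S (\<lambda>x. x \<bullet> x) (\<lambda>x h. 2 * (x \<bullet> h))"
  by (rule C1_onI) (auto intro!: derivative_eq_intros continuous_intros simp: inner_commute)

text \<open>Quotient rule: -(div U) / u is the constant \<open>l\<close>, and differentiating 1 / u
  contributes |U|^2 / u^2.\<close>

lemma has_divergence_on_log_gradient:
  assumes "C1_on S u (\<lambda>x h. U x \<bullet> h)" "has_divergence_on U (\<lambda>x. - (l * u x)) S"
    "open S" "\<And>x. x \<in> S \<Longrightarrow> u x > 0"
  shows "has_divergence_on (\<lambda>x. - (1 / u x) *\<^sub>R U x)
    (\<lambda>x. l + (- (1 / u x) *\<^sub>R U x) \<bullet> (- (1 / u x) *\<^sub>R U x)) S"
proof -
  have nz: "u x \<noteq> 0" if "x \<in> S" for x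
    using assms(4)[OF that] by simp
  have "C1_on S (\<lambda>x. - (1 / u x)) (\<lambda>x h. 1 / (u x)\<^sup>2 * (U x \<bullet> h))"
    by (rule C1_on_compose_real[OF assms(1), where g="\<lambda>s. - (1 / s)" and g'="\<lambda>s. 1 / s\<^sup>2"])
      (auto intro!: derivative_eq_intros continuous_intros simp: nz power2_eq_square)
  from has_divergence_on_scaleR[OF this assms(2)] show ?thesis
    by (rule has_divergence_on_cong[OF assms(3)]) (auto simp: nz power2_eq_square)
qed

text \<open>The definition supplies one derivative on the closure and another, again C1, inside.
  Uniqueness identifies them in \<open>Om\<close>, so a single vector field \<open>U\<close> carries
  the boundary condition and has the Laplacian of \<open>u\<close> as divergence.\<close>

lemma robin_eigenfunction_gradient:
  assumes u: "robin_eigenfunction \<alpha> Om l u" and Om: "open Om"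
  obtains U where "C1_on Om u (\<lambda>x h. U x \<bullet> h)" "has_divergence_on U (\<lambda>x. - (l * u x)) Om"
    "continuous_on (closure Om) u" "continuous_on (closure Om) U"
    "\<And>x. x \<in> closure Om \<Longrightarrow> (u has_derivative (\<lambda>h. U x \<bullet> h)) (at x within closure Om)"
    "\<And>y. y \<in> frontier Om \<Longrightarrow> \<exists>n. outer_unit_normal Om y n \<and> U y \<bullet> n + \<alpha> * u y = 0"
proof -
  obtain Du where Du: "has_C1_derivative_on u Du (closure Om)"
    and bd: "\<And>y. y \<in> frontier Om \<Longrightarrow> \<exists>n. outer_unit_normal Om y n \<and> Du y n + \<alpha> * u y = 0"
    using u unfolding robin_eigenfunction_def by blast
  obtain Df D2f where D2: "has_C1_derivative_on u Df Om" "has_C1_derivative_on Df D2f Om"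
    using u unfolding robin_eigenfunction_def C2_on_def by blast
  have lap: "laplacian u x = - (l * u x)" if "x \<in> Om" for x
    using u that unfolding robin_eigenfunction_def by force
  define U where "U x = (\<Sum>b\<in>Basis. Du x b *\<^sub>R b)" for x
  have U: "U x \<bullet> h = Du x h" for x h
  proof -
    have "Du x h = Du x (\<Sum>b\<in>Basis. (h \<bullet> b) *\<^sub>R b)" by (simp add: euclidean_representation)
    also have "\<dots> = U x \<bullet> h"
      by (simp only: U_def blinfun.sum_right blinfun.scaleR_right inner_sum_left)
        (simp add: inner_commute mult.commute)
    finally show ?thesis ..
  qed
  have within: "(u has_derivative (\<lambda>h. U x \<bullet> h)) (at x within closure Om)" if "x \<in> closure Om" for x
    using Du that unfolding has_C1_derivative_on_def U by simp
  have cDu: "continuous_on (closure Om) Du"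
    using Du unfolding has_C1_derivative_on_def by simp
  then have cU: "continuous_on (closure Om) U"
    unfolding U_def by (intro continuous_intros)
  have cu: "continuous_on (closure Om) u"
    using within by (meson continuous_on_eq_continuous_within has_derivative_continuous)
  have at: "(u has_derivative (\<lambda>h. U x \<bullet> h)) (at x)" if "x \<in> Om" for x
    using within[of x] that closure_subset
    by (metis at_within_interior in_mono interior_maximal Om)
  have C1: "C1_on Om u (\<lambda>x h. U x \<bullet> h)"
    by (rule C1_onI) (auto intro!: at continuous_intros continuous_on_subset[OF cU] closure_subset)
  have Df: "Df x h = U x \<bullet> h" if "x \<in> Om" for x h
  proof -
    have "(u has_derivative Df x) (at x)"
      using D2(1) that unfolding has_C1_derivative_on_def by (metis at_within_open Om)
    then show ?thesis using has_derivative_unique[OF at[OF that]] by metis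
  qed
  have D2f: "(Df has_derivative D2f x) (at x)" if "x \<in> Om" for x
    using D2(2) that unfolding has_C1_derivative_on_def by (metis at_within_open Om)
  have cD2f: "continuous_on Om D2f"
    using D2(2) unfolding has_C1_derivative_on_def by simp
  define U' where "U' x h = (\<Sum>b\<in>Basis. D2f x h b *\<^sub>R b)" for x h
  have U': "C1_on Om U U'"
  proof (rule C1_onI)
    fix x assume x: "x \<in> Om"
    have "((\<lambda>x. \<Sum>b\<in>Basis. Df x b *\<^sub>R b) has_derivative U' x) (at x)"
      unfolding U'_def by (rule derivative_eq_intros D2f[OF x] refl)+ simp
    then show "(U has_derivative U' x) (at x)"
      by (rule has_derivative_transform_within_open[OF _ Om x])
        (simp add: Df euclidean_representation)
  next
    show "continuous_on Om (\<lambda>x. U' x h)" for h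
      unfolding U'_def by (intro continuous_intros cD2f)
  qed
  have "has_divergence_on U (\<lambda>x. - (l * u x)) Om"
    unfolding has_divergence_on_def
  proof (intro exI conjI ballI)
    fix x assume x: "x \<in> Om"
    have "frechet_derivative (\<lambda>z. frechet_derivative u (at z) b) (at x) b = U' x b \<bullet> b"
      if b: "b \<in> Basis" for b
    proof -
      have "((\<lambda>z. U z \<bullet> b) has_derivative (\<lambda>h. U' x h \<bullet> b)) (at x)"
        by (intro has_derivative_inner_left C1_onD(1)[OF U' x])
      moreover have "U z \<bullet> b = frechet_derivative u (at z) b" if "z \<in> Om" for z
        using frechet_derivative_at[OF at[OF that]] by metis
      ultimately have "((\<lambda>z. frechet_derivative u (at z) b) has_derivative (\<lambda>h. U' x h \<bullet> b)) (at x)"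
        by (rule has_derivative_transform_within_open[OF _ Om x])
      from frechet_derivative_at[OF this] show ?thesis by metis
    qed
    then have "laplacian u x = (\<Sum>b\<in>Basis. U' x b \<bullet> b)"
      unfolding laplacian_def by simp
    then show "- (l * u x) = (\<Sum>b\<in>Basis. U' x b \<bullet> b)"
      using lap[OF x] by simp
  qed (rule U')
  then show ?thesis
    by (rule that[OF C1 _ cu cU within]) (use bd U in auto)
qed

text \<open>At a boundary zero the Robin condition would make the normal derivative vanish, against
  the Hopf lemma. Positivity up to the boundary is what makes grad u / u continuous on the
  closure.\<close>

lemma (in C2_domain) robin_eigenfunction_positive:
  assumes u: "robin_eigenfunction \<alpha> Om l u" "\<And>x. x \<in> Om \<Longrightarrow> 0 < u x"
  obtains U where "C1_on Om u (\<lambda>x h. U x \<bullet> h)" "has_divergence_on U (\<lambda>x. - (l * u x)) Om"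
    "continuous_on (closure Om) u" "continuous_on (closure Om) U"
    "\<And>x. x \<in> closure Om \<Longrightarrow> u x > 0"
    "\<And>y. y \<in> frontier Om \<Longrightarrow> \<exists>n. outer_unit_normal Om y n \<and> U y \<bullet> n + \<alpha> * u y = 0"
proof -
  obtain U where U: "C1_on Om u (\<lambda>x h. U x \<bullet> h)" "has_divergence_on U (\<lambda>x. - (l * u x)) Om"
    "continuous_on (closure Om) u" "continuous_on (closure Om) U"
    "\<And>x. x \<in> closure Om \<Longrightarrow> (u has_derivative (\<lambda>h. U x \<bullet> h)) (at x within closure Om)"
    "\<And>y. y \<in> frontier Om \<Longrightarrow> \<exists>n. outer_unit_normal Om y n \<and> U y \<bullet> n + \<alpha> * u y = 0"
    using robin_eigenfunction_gradient[OF u(1) open_Om] by blast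
  have "u x > 0" if x: "x \<in> closure Om" for x
  proof (cases "x \<in> Om")
    case False
    then have fr: "x \<in> frontier Om" using x closure_cases by blast
    obtain n where n: "outer_unit_normal Om x n" "U x \<bullet> n + \<alpha> * u x = 0"
      using U(6)[OF fr] by blast
    have "u x \<noteq> 0"
      using hopf_boundary_point[OF U(3,1,2) u(2) fr _ U(5)[OF x] n(1)] n(2) by auto
    moreover have "u x \<ge> 0"
      using continuous_ge_on_closure[OF U(3) x, of 0] u(2) less_imp_le by blast
    ultimately show ?thesis by simp
  qed (use u in simp)
  with U that show ?thesis by blast
qed

text \<open>The function phi(x) = F(|x|^2) solves Delta phi + l phi = 0, because the Laplacian of
  F(|x|^2) is 4 s F'' + 2 n F' at s = |x|^2. The variable s in place of r = |x| keeps phi twice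
  continuously differentiable at the origin.\<close>

locale radial_solution =
  fixes n :: nat and l :: real and F F1 F2 :: "real \<Rightarrow> real"
  assumes n_pos: "n > 0"
    and F: "DERIV F s :> F1 s" and F1: "DERIV F1 s :> F2 s"
    and F2_cont: "continuous_on S F2" and F_0: "F 0 = 1"
    and ode: "4 * s * F2 s + 2 * real n * F1 s + l * F s = 0"

text \<open>Power series: comparing coefficients gives 2 (j + 1) (2 j + n) a_(j+1) + l a_j = 0, and
  the quadratically growing denominator makes the series converge everywhere.\<close>

lemma radial_solution_exists:
  assumes "n > 0"
  shows "\<exists>F F1 F2. radial_solution n l F F1 F2"
proof -
  define a where "a = rec_nat 1 (\<lambda>j x. - (l * x) / (2 * real (Suc j) * (2 * real j + real n)))"
  have a_Suc: "a (Suc j) = - (l * a j) / (2 * real (Suc j) * (2 * real j + real n))" for j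
    by (simp add: a_def)
  have summ: "summable (\<lambda>j. a j * s ^ j)" for s
  proof (rule summable_ratio_test[of "1/2"])
    fix j assume j: "nat \<lceil>\<bar>l * s\<bar>\<rceil> \<le> j"
    have "\<bar>l * s\<bar> \<le> real j" using j by linarith
    also have "real j \<le> real (Suc j) * (2 * real j + real n)"
      by (simp add: algebra_simps)
    finally have "\<bar>l * s\<bar> / (2 * real (Suc j) * (2 * real j + real n)) \<le> 1 / 2"
      using assms by (simp add: divide_simps) (simp add: algebra_simps)
    then have "\<bar>a j * s ^ j\<bar> * (\<bar>l * s\<bar> / (2 * real (Suc j) * (2 * real j + real n))) \<le> \<bar>a j * s ^ j\<bar> * (1 / 2)"
      by (rule mult_left_mono) simp
    moreover have "norm (a (Suc j) * s ^ Suc j) = \<bar>a j * s ^ j\<bar> * (\<bar>l * s\<bar> / (2 * real (Suc j) * (2 * real j + real n)))"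
      unfolding a_Suc by (simp add: abs_mult field_simps)
    ultimately show "norm (a (Suc j) * s ^ Suc j) \<le> 1 / 2 * norm (a j * s ^ j)"
      by (simp add: mult.commute)
  qed simp
  have summ1: "summable (\<lambda>j. diffs a j * s ^ j)" for s
    by (rule termdiff_converges_all) (rule summ)
  have summ2: "summable (\<lambda>j. diffs (diffs a) j * s ^ j)" for s
    by (rule termdiff_converges_all) (rule summ1)
  note D = termdiffs_strong_converges_everywhere
  define F F1 F2 where "F s = (\<Sum>j. a j * s ^ j)" and "F1 s = (\<Sum>j. diffs a j * s ^ j)"
    and "F2 s = (\<Sum>j. diffs (diffs a) j * s ^ j)" for s
  have "radial_solution n l F F1 F2"
  proof
    show "n > 0" by fact
    show "DERIV F s :> F1 s" "DERIV F1 s :> F2 s" for s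
      unfolding F_def[abs_def] F1_def[abs_def] F2_def by (intro D summ summ1)+
    have "isCont F2 s" for s
      unfolding F2_def[abs_def] by (rule DERIV_isCont[OF D[OF summ2]])
    then show "continuous_on S F2" for S
      by (simp add: continuous_at_imp_continuous_on)
    show "F 0 = 1" by (simp add: F_def a_def)
    fix s
    have "(\<lambda>j. diffs (diffs a) j * s ^ j * s) sums (F2 s * s)"
      unfolding F2_def by (intro sums_mult2 summable_sums summ2)
    then have "(\<lambda>j. real (Suc j) * diffs a (Suc j) * s ^ Suc j) sums (F2 s * s)"
      by (simp add: diffs_def mult_ac)
    \<comment> \<open>The index is shifted down by one; the added term at 0 vanishes through its
      factor \<open>real j\<close>.\<close>
    then have "(\<lambda>j. real j * diffs a j * s ^ j) sums (F2 s * s)"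
      using sums_Suc_iff[of "\<lambda>j. real j * diffs a j * s ^ j" "F2 s * s"] by simp
    then have "(\<lambda>j. 4 * (real j * diffs a j * s ^ j) + 2 * real n * (diffs a j * s ^ j) + l * (a j * s ^ j))
        sums (4 * (F2 s * s) + 2 * real n * F1 s + l * F s)"
      unfolding F1_def F_def by (intro sums_add sums_mult summable_sums summ summ1)
    moreover have "4 * (real j * diffs a j * s ^ j) + 2 * real n * (diffs a j * s ^ j) + l * (a j * s ^ j) = 0" for j
    proof -
      have "2 * real (Suc j) * (2 * real j + real n) * a (Suc j) + l * a j = 0"
      proof -
        have "2 * real (Suc j) * (2 * real j + real n) \<noteq> 0" using assms by simp
        then show ?thesis unfolding a_Suc by (simp only: nonzero_mult_div_cancel_left times_divide_eq_right) simp
      qed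
      moreover have "4 * (real j * diffs a j * s ^ j) + 2 * real n * (diffs a j * s ^ j) + l * (a j * s ^ j)
        = (2 * real (Suc j) * (2 * real j + real n) * a (Suc j) + l * a j) * s ^ j"
        by (simp add: diffs_def algebra_simps)
      ultimately show ?thesis by simp
    qed
    ultimately have "(\<lambda>j. 0) sums (4 * (F2 s * s) + 2 * real n * F1 s + l * F s)" by simp
    from sums_unique2[OF this sums_zero] show "4 * s * F2 s + 2 * real n * F1 s + l * F s = 0"
      by (simp add: mult_ac)
  qed
  then show ?thesis by blast
qed

text \<open>The last hypothesis says that s^a f(s) is nondecreasing, as its derivative is s^(a-1) (a
  f + s f'). This handles the first-order inequalities with a singular point at 0 that the radial
  equation produces.\<close>

lemma pos_if_powr_mult_increasing:
  fixes f :: "real \<Rightarrow> real"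
  assumes f: "\<And>s. DERIV f s :> f' s" "f 0 > 0" and "s1 > 0"
    and ge: "\<And>s. 0 < s \<Longrightarrow> s \<le> s1 \<Longrightarrow> a * f s + s * f' s \<ge> 0"
  shows "f s1 > 0"
proof -
  have "(f \<longlongrightarrow> f 0) (at_right 0)"
    using DERIV_isCont[OF f(1)] by (simp add: isCont_def filterlim_at_split)
  then have "\<forall>\<^sub>F s in at_right 0. f s > 0"
    using f(2) order_tendstoD(1) by blast
  moreover have "\<forall>\<^sub>F s in at_right 0. s < s1"
    using assms(3) eventually_at_right_field by blast
  ultimately have "\<forall>\<^sub>F s in at_right 0. f s > 0 \<and> s < s1 \<and> s > 0"
    using eventually_at_right_less by eventually_elim auto
  \<comment> \<open>The comparison starts slightly to the right of 0, because the weight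
    \<open>s powr a\<close> is 0 at the origin itself.\<close>
  then obtain e where e: "f e > 0" "e < s1" "e > 0"
    using eventually_happens[of _ "at_right (0::real)"] by auto
  have "e powr a * f e \<le> s1 powr a * f s1"
  proof (rule DERIV_nonneg_imp_nondecreasing[of e s1 "\<lambda>s. s powr a * f s"])
    fix s assume s: "e \<le> s" "s \<le> s1"
    have "DERIV (\<lambda>s. s powr a * f s) s :> s powr (a - 1) * (a * f s + s * f' s)"
      using s e by (auto intro!: derivative_eq_intros f(1) simp: algebra_simps powr_diff)
    moreover have "s powr (a - 1) * (a * f s + s * f' s) \<ge> 0"
      using ge[of s] s e by simp
    ultimately show "\<exists>y. DERIV (\<lambda>s. s powr a * f s) s :> y \<and> 0 \<le> y" by blast
  qed (use e in simp)
  moreover have "0 < e powr a * f e" using e by simp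
  ultimately have "0 < s1 powr a * f s1" by linarith
  then show ?thesis using assms(3) by (simp add: zero_less_mult_iff)
qed

context radial_solution
begin

lemma continuous_F: "continuous_on S F" "continuous_on S F1"
  using F F1 DERIV_isCont continuous_at_imp_continuous_on by blast+

lemma F1_0: "F1 0 = - l / (2 * real n)"
  using ode[of 0] n_pos F_0 by (simp add: field_simps)

text \<open>The equation reads (n / 2) F1 + s F2 = - l F / 4, so - l F1, with initial value l^2 / (2
  n), satisfies the inequality of \<open>pos_if_powr_mult_increasing\<close> with exponent n /
  2.\<close>

lemma l_F1_neg:
  assumes "l \<noteq> 0" "s1 > 0" "\<And>s. 0 < s \<Longrightarrow> s \<le> s1 \<Longrightarrow> F s \<ge> 0"
  shows "l * F1 s1 < 0"
proof -
  have "- l * F1 s1 > 0"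
  proof (rule pos_if_powr_mult_increasing[of _ "\<lambda>s. - l * F2 s" s1 "real n / 2"])
    show "DERIV (\<lambda>s. - l * F1 s) s :> - l * F2 s" for s
      by (rule DERIV_cmult[OF F1])
    show "- l * F1 0 > 0"
      using assms(1) n_pos by (simp add: F1_0 zero_less_mult_iff linorder_neq_iff disj_commute)
    fix s assume s: "0 < s" "s \<le> s1"
    have "real n / 2 * (- l * F1 s) + s * (- l * F2 s) = l * (l * F s) / 4"
      using ode[of s] by algebra
    also have "\<dots> \<ge> 0" using assms(3)[OF s] by (simp add: zero_le_mult_iff mult.assoc[symmetric])
    finally show "real n / 2 * (- l * F1 s) + s * (- l * F2 s) \<ge> 0" .
  qed (fact assms)
  then show ?thesis by simp
qed

text \<open>For the radial solution \<open>u(r) = F(r\<^sup>2)\<close> and \<open>k = - u'/u\<close>, the factor of \<open>l\<close> is \<open>- u\<^sup>2 k'(r) / 2\<close> at \<open>r\<^sup>2 = s1\<close>.\<close>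

lemma l_riccati_neg:
  assumes "l \<noteq> 0" "s1 > 0" "\<And>s. 0 < s \<Longrightarrow> s \<le> s1 \<Longrightarrow> F s > 0"
  shows "l * (F s1 * F1 s1 + 2 * s1 * F s1 * F2 s1 - 2 * s1 * (F1 s1)\<^sup>2) < 0"
proof -
  \<comment> \<open>\<open>Q\<close> is F^2 k' / 2 at r^2 = s, with F2 eliminated through the
    equation so that it can be differentiated once more.\<close>
  define Q where "Q s = (real n - 1) * F s * F1 s + l / 2 * (F s)\<^sup>2 + 2 * s * (F1 s)\<^sup>2" for s
  define Q' where "Q' s = (real n - 1) * (F s * F2 s - (F1 s)\<^sup>2)" for s
  have Q: "Q s = - (F s * F1 s + 2 * s * F s * F2 s - 2 * s * (F1 s)\<^sup>2)" for s
    unfolding Q_def using ode[of s] by algebra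
  have Q': "DERIV Q s :> Q' s" for s
  proof -
    have "DERIV Q s :> (real n - 1) * (F1 s * F1 s + F s * F2 s) + l / 2 * (2 * F s * F1 s)
      + (2 * (F1 s)\<^sup>2 + 2 * s * (2 * F1 s * F2 s))"
      unfolding Q_def[abs_def]
      by (auto intro!: derivative_eq_intros F F1 simp: power2_eq_square algebra_simps)
    moreover have "(real n - 1) * (F1 s * F1 s + F s * F2 s) + l / 2 * (2 * F s * F1 s)
      + (2 * (F1 s)\<^sup>2 + 2 * s * (2 * F1 s * F2 s)) = Q' s"
      unfolding Q'_def using ode[of s] by algebra
    ultimately show ?thesis by simp
  qed
  \<comment> \<open>The combination (n - 1) / 2 * Q + s Q' collapses to - (n - 1) / 2 * F F1, whose
    sign after multiplication by \<open>l\<close> comes from \<open>l_F1_neg\<close>.\<close>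
  have "l * Q s1 > 0"
  proof (rule pos_if_powr_mult_increasing[of _ "\<lambda>s. l * Q' s" s1 "(real n - 1) / 2"])
    show "DERIV (\<lambda>s. l * Q s) s :> l * Q' s" for s
      by (rule DERIV_cmult[OF Q'])
    have "l * Q 0 = l\<^sup>2 / (2 * real n)"
      using n_pos by (simp add: Q_def F_0 F1_0 field_simps power2_eq_square)
    then show "l * Q 0 > 0" using assms(1) n_pos by simp
    fix s assume s: "0 < s" "s \<le> s1"
    have "l * F1 s < 0"
      by (rule l_F1_neg) (use assms s in \<open>auto intro: less_imp_le\<close>)
    then have "F s * (- (l * F1 s)) \<ge> 0"
      using less_imp_le[OF assms(3)[OF s]] by (intro mult_nonneg_nonneg) linarith+
    moreover have "real n \<ge> 1" using n_pos by linarith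
    ultimately have "(real n - 1) / 2 * (F s * (- (l * F1 s))) \<ge> 0"
      by (intro mult_nonneg_nonneg[of "(real n - 1) / 2"]) simp_all
    also have "(real n - 1) / 2 * (F s * (- (l * F1 s))) = (real n - 1) / 2 * (l * Q s) + s * (l * Q' s)"
      unfolding Q Q'_def by algebra
    finally show "(real n - 1) / 2 * (l * Q s) + s * (l * Q' s) \<ge> 0" .
  qed (fact assms)
  then show ?thesis unfolding Q by (simp only: mult_minus_right neg_0_less_iff_less)
qed

lemma radial_C1: "C1_on S (\<lambda>x::'a::euclidean_space. F (x \<bullet> x)) (\<lambda>x h. ((2 * F1 (x \<bullet> x)) *\<^sub>R x) \<bullet> h)"
  using C1_on_compose_real[OF C1_on_inner_self, of S F F1] F continuous_F(2)
  by (simp add: mult_ac)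

lemma radial_divergence:
  assumes "n = DIM('a)"
  shows "has_divergence_on (\<lambda>x::'a::euclidean_space. (2 * F1 (x \<bullet> x)) *\<^sub>R x) (\<lambda>x. - (l * F (x \<bullet> x))) UNIV"
proof -
  have "C1_on UNIV (\<lambda>x::'a. 2 * F1 (x \<bullet> x)) (\<lambda>x h. 2 * F2 (x \<bullet> x) * (2 * (x \<bullet> h)))"
    by (rule C1_on_compose_real[OF C1_on_inner_self, where g="\<lambda>s. 2 * F1 s" and g'="\<lambda>s. 2 * F2 s"])
      (auto intro!: derivative_eq_intros continuous_intros F1 F2_cont)
  from has_divergence_on_scaleR[OF this has_divergence_on_id] show ?thesis
  proof (rule has_divergence_on_cong[OF open_UNIV])
    fix x :: 'a
    show "- (l * F (x \<bullet> x)) = 2 * F1 (x \<bullet> x) * real DIM('a) + 2 * F2 (x \<bullet> x) * (2 * (x \<bullet> x))"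
      using ode[of "x \<bullet> x"] by (simp add: assms algebra_simps)
  qed simp
qed

end

section \<open>The ball\<close>


lemma C2_domain_ball:
  assumes "r > 0"
  shows "C2_domain (ball (0::'a::euclidean_space) r) (\<lambda>x. r\<^sup>2 - x \<bullet> x) (\<lambda>x. (- 2) *\<^sub>R x) (\<lambda>x. - 2 * real DIM('a))"
proof
  fix x :: 'a
  show "((\<lambda>x. r\<^sup>2 - x \<bullet> x) has_derivative (\<bullet>) (- 2 *\<^sub>R x)) (at x within closure (ball 0 r))"
    by (auto intro!: derivative_eq_intros simp: inner_commute)
  show "r\<^sup>2 - x \<bullet> x > 0" if "x \<in> ball 0 r"
    using that by (auto simp: power2_norm_eq_inner[symmetric] intro!: power_strict_mono)
  show "r\<^sup>2 - x \<bullet> x = 0" if "x \<in> frontier (ball 0 r)"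
    using that assms by (simp add: power2_norm_eq_inner[symmetric])
  show "- 2 *\<^sub>R x \<noteq> 0" if "x \<in> frontier (ball 0 r)"
    using that assms by auto
  show "has_divergence_on (\<lambda>x. - 2 *\<^sub>R x) (\<lambda>x. - 2 * real DIM('a)) (ball (0::'a) r)"
    by (intro has_divergence_on_cmul has_divergence_on_id)
qed (auto intro!: continuous_intros)

text \<open>The subset of the open ball where \<open>h\<close> is positive is open and null, hence
  empty; continuity covers the sphere.\<close>

lemma nonneg_integral_le_0_imp_eq_0:
  fixes h :: "'a::euclidean_space \<Rightarrow> real"
  assumes h: "continuous_on (cball 0 r) h" "\<And>x. x \<in> cball 0 r \<Longrightarrow> h x \<ge> 0"
    and le: "(LINT x:ball 0 r|lborel. h x) \<le> 0" and x: "x \<in> cball 0 r" and "r > 0"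
  shows "h x = 0"
proof -
  have int: "set_integrable lborel (ball 0 r) h"
  proof (rule set_integrable_subset)
    show "set_integrable lborel (cball 0 r) h"
      unfolding set_integrable_def by (rule borel_integrable_compact[OF compact_cball h(1)])
  qed auto
  have nn: "AE x in lborel. 0 \<le> indicator (ball 0 r) x *\<^sub>R h x"
    using h(2) by (auto simp: indicator_def)
  have "(LINT x:ball 0 r|lborel. h x) = 0"
    using le integral_nonneg_AE[OF nn] by (simp add: set_lebesgue_integral_def)
  then have "AE x in lborel. indicator (ball 0 r) x *\<^sub>R h x = 0"
    using integral_nonneg_eq_0_iff_AE[OF int[unfolded set_integrable_def] nn]
    by (simp add: set_lebesgue_integral_def)
  then have ae: "AE x in lborel. x \<in> ball 0 r \<longrightarrow> h x = 0"
    by (rule eventually_mono) (auto simp: indicator_def split: if_splits)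
  define W where "W = ball 0 r \<inter> h -` {0<..}"
  have "open W"
    unfolding W_def
    by (rule continuous_open_preimage[OF continuous_on_subset[OF h(1)]]) auto
  have "{x \<in> space lborel. \<not> (x \<in> ball 0 r \<longrightarrow> h x = 0)} = W"
    using h(2) by (auto simp: W_def less_le)
  then have "W \<in> null_sets lborel"
    using ae \<open>open W\<close> AE_iff_null[of lborel "\<lambda>x. x \<in> ball 0 r \<longrightarrow> h x = 0"] by simp
  then have "negligible W"
    by (simp add: negligible_iff_null_sets null_sets_completionI)
  then have "W = {}"
    using \<open>open W\<close> open_not_negligible by blast
  then have "h x \<le> 0" if "x \<in> ball 0 r" for x
    using that by (auto simp: W_def not_less)
  then have "h x \<le> 0"
    using continuous_le_on_closure[of "ball 0 r" h x 0] h(1) x \<open>r > 0\<close> by simp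
  with h(2)[OF x] show ?thesis by simp
qed

text \<open>Rigidity in Picone's inequality: \<open>V\<close> and phi share the same
  \<open>l\<close>, so the zero-order terms cancel and only the integral of the square is left. The
  boundary sign is not strict; subtracting the field e x makes it so, and its cost, e n times the
  volume, disappears with e.\<close>

lemma ball_picone_equality:
  fixes V G :: "'a::euclidean_space \<Rightarrow> 'a"
  assumes r: "r > 0"
    and V: "continuous_on (cball 0 r) V" "has_divergence_on V (\<lambda>x. l + V x \<bullet> V x) (ball 0 r)"
    and \<phi>: "continuous_on (cball 0 r) \<phi>" "C1_on (ball 0 r) \<phi> (\<lambda>x h. G x \<bullet> h)"
      "continuous_on (cball 0 r) G" "has_divergence_on G (\<lambda>x. - (l * \<phi> x)) (ball 0 r)"
    and bd: "\<And>y. norm y = r \<Longrightarrow> ((\<phi> y)\<^sup>2 *\<^sub>R V y + \<phi> y *\<^sub>R G y) \<bullet> y \<le> 0"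
    and x: "x \<in> cball 0 r"
  shows "\<phi> x *\<^sub>R V x + G x = 0"
proof -
  interpret C2_domain "ball (0::'a) r" "\<lambda>x. r\<^sup>2 - x \<bullet> x" "\<lambda>x. (- 2) *\<^sub>R x" "\<lambda>x. - 2 * real DIM('a)"
    by (rule C2_domain_ball[OF r])
  have cl: "closure (ball 0 r) = cball (0::'a) r" using r by simp
  define h where "h x = (norm (\<phi> x *\<^sub>R V x + G x))\<^sup>2" for x
  have ch: "continuous_on (cball 0 r) h"
    unfolding h_def by (intro continuous_intros V \<phi>)
  define vol where "vol = measure lborel (ball (0::'a) r)"
  have bound: "(LINT x:ball 0 r|lborel. h x) \<le> e * (real DIM('a) * vol)" if e: "e > 0" for e
  proof -
    have "(LINT x:ball 0 r|lborel. (norm (\<phi> x *\<^sub>R V x + G x))\<^sup>2 +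
        (l * (\<phi> x)\<^sup>2 + \<phi> x * - (l * \<phi> x) - e * real DIM('a))) \<le> 0"
    proof (rule integral_picone_le_0[where X="\<lambda>x. e *\<^sub>R x"])
      fix y :: 'a assume "y \<in> frontier (ball 0 r)"
      then have y: "norm y = r" using r by simp
      have "((\<phi> y)\<^sup>2 *\<^sub>R V y + \<phi> y *\<^sub>R G y - e *\<^sub>R y) \<bullet> - 2 *\<^sub>R y
        = - 2 * (((\<phi> y)\<^sup>2 *\<^sub>R V y + \<phi> y *\<^sub>R G y) \<bullet> y) + 2 * e * r\<^sup>2"
        using y by (simp add: inner_diff_left power2_norm_eq_inner[symmetric])
      also have "\<dots> > 0"
        using bd[OF y] e r by (intro add_nonneg_pos) auto
      finally show "((\<phi> y)\<^sup>2 *\<^sub>R V y + \<phi> y *\<^sub>R G y - e *\<^sub>R y) \<bullet> - 2 *\<^sub>R y > 0" .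
    qed (unfold cl, auto intro!: V \<phi> continuous_intros has_divergence_on_cmul has_divergence_on_id)
    moreover have "(LINT x:ball 0 r|lborel. (norm (\<phi> x *\<^sub>R V x + G x))\<^sup>2 +
        (l * (\<phi> x)\<^sup>2 + \<phi> x * - (l * \<phi> x) - e * real DIM('a)))
      = (LINT x:ball 0 r|lborel. h x - e * real DIM('a))"
      by (simp add: h_def power2_eq_square mult_ac)
    moreover have "\<dots> = (LINT x:ball 0 r|lborel. h x) - (LINT x:ball (0::'a) r|lborel. e * real DIM('a))"
      by (intro set_integral_diff set_integrable_Om) (unfold cl, auto intro: ch)
    moreover have "(LINT x:ball (0::'a) r|lborel. e * real DIM('a)) = e * (real DIM('a) * vol)"
      by (simp add: vol_def set_lebesgue_integral_def)
    ultimately show ?thesis by (simp only: diff_le_0_iff_le)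
  qed
  have "(LINT x:ball 0 r|lborel. h x) \<le> 0 + \<epsilon>" if "\<epsilon> > 0" for \<epsilon>
  proof -
    define m where "m = real DIM('a) * vol"
    have m: "m \<ge> 0" by (simp add: m_def vol_def)
    have "(LINT x:ball 0 r|lborel. h x) \<le> \<epsilon> / (m + 1) * m"
      unfolding m_def using m that by (intro bound) (simp add: m_def)
    also have "\<dots> \<le> \<epsilon>" using m that by (simp add: field_simps)
    finally show ?thesis by simp
  qed
  then have "(LINT x:ball 0 r|lborel. h x) \<le> 0" by (rule field_le_epsilon)
  from nonneg_integral_le_0_imp_eq_0[OF ch _ this x r] show ?thesis
    by (simp add: h_def)
qed

lemma outer_unit_normal_ball:
  fixes y :: "'a::euclidean_space"
  assumes "r > 0" "norm y = r" "outer_unit_normal (ball 0 r) y n"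
  shows "n = y /\<^sub>R r"
proof -
  interpret C2_domain "ball (0::'a) r" "\<lambda>x. r\<^sup>2 - x \<bullet> x" "\<lambda>x. (- 2) *\<^sub>R x" "\<lambda>x. - 2 * real DIM('a)"
    by (rule C2_domain_ball[OF assms(1)])
  have "y \<in> frontier (ball 0 r)" using assms by simp
  then obtain c where c: "c > 0" "(- 2) *\<^sub>R y = - c *\<^sub>R n"
    using gradient_outer_unit_normal assms(3) by blast
  have "norm n = 1" using assms(3) by (simp add: outer_unit_normal_def)
  then have cr: "c = 2 * r" using arg_cong[OF c(2), of norm] c(1) assms by simp
  have "r *\<^sub>R n = y" using c(2) unfolding cr by (simp flip: scaleR_scaleR)
  then show ?thesis using assms(1) by (metis less_irrefl scaleR_scaleR left_inverse scaleR_one)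
qed

text \<open>The given eigenfunction \<open>u\<close> is not assumed radial. Comparing it with the
  radial solution through \<open>ball_picone_equality\<close> transfers positivity and the Robin
  condition to the latter.\<close>

lemma (in radial_solution) ball_principal_eigenfunction:
  fixes u :: "'a::euclidean_space \<Rightarrow> real"
  assumes n: "n = DIM('a)" and R: "R > 0"
    and u: "robin_eigenfunction \<alpha> (ball 0 R) l u" "\<And>x. x \<in> ball 0 R \<Longrightarrow> 0 < u x"
  shows "\<And>s. 0 \<le> s \<Longrightarrow> s \<le> R\<^sup>2 \<Longrightarrow> F s > 0" and "\<alpha> * F (R\<^sup>2) + 2 * R * F1 (R\<^sup>2) = 0"
proof -
  interpret C2_domain "ball (0::'a) R" "\<lambda>x. R\<^sup>2 - x \<bullet> x" "\<lambda>x. (- 2) *\<^sub>R x" "\<lambda>x. - 2 * real DIM('a)"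
    by (rule C2_domain_ball[OF R])
  have cl: "closure (ball 0 R) = cball (0::'a) R" "frontier (ball 0 R) = sphere (0::'a) R" using R by auto
  obtain U where U: "C1_on (ball 0 R) u (\<lambda>x h. U x \<bullet> h)"
    "has_divergence_on U (\<lambda>x. - (l * u x)) (ball 0 R)"
    "continuous_on (cball 0 R) u" "continuous_on (cball 0 R) U"
    "\<And>x. x \<in> cball 0 R \<Longrightarrow> u x > 0"
    "\<And>y. y \<in> sphere 0 R \<Longrightarrow> \<exists>n. outer_unit_normal (ball 0 R) y n \<and> U y \<bullet> n + \<alpha> * u y = 0"
    using robin_eigenfunction_positive[OF u] unfolding cl by blast
  have U_y: "U y \<bullet> y = - \<alpha> * R * u y" if y: "norm y = R" for y
  proof -
    obtain n where "outer_unit_normal (ball 0 R) y n" "U y \<bullet> n + \<alpha> * u y = 0"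
      using U(6)[of y] y by auto
    moreover from this(1) have "n = y /\<^sub>R R" by (rule outer_unit_normal_ball[OF R y])
    ultimately have "U y \<bullet> y / R = - \<alpha> * u y" by (simp add: divide_inverse mult.commute)
    then show ?thesis using R by (simp add: field_simps)
  qed
  define V where "V x = - (1 / u x) *\<^sub>R U x" for x
  have V: "continuous_on (cball 0 R) V" "has_divergence_on V (\<lambda>x. l + V x \<bullet> V x) (ball 0 R)"
  proof -
    show "continuous_on (cball 0 R) V"
      unfolding V_def by (intro continuous_intros U ballI) (use U(5) in force)
    show "has_divergence_on V (\<lambda>x. l + V x \<bullet> V x) (ball 0 R)"
      unfolding V_def[abs_def] by (rule has_divergence_on_log_gradient[OF U(1,2)]) (use U in auto)
  qed
  define \<phi> where "\<phi> x = F (x \<bullet> x)" for x :: 'a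
  define G where "G x = (2 * F1 (x \<bullet> x)) *\<^sub>R x" for x :: 'a
  have \<phi>: "C1_on S \<phi> (\<lambda>x h. G x \<bullet> h)" "has_divergence_on G (\<lambda>x. - (l * \<phi> x)) S" for S
    using radial_C1 has_divergence_on_subset[OF radial_divergence[OF n] subset_UNIV]
    unfolding \<phi>_def G_def by auto
  have c\<phi>: "continuous_on S \<phi>" "continuous_on S G" for S
    using C1_onD(3)[OF \<phi>(1)] has_divergence_on_continuous[OF \<phi>(2)] by auto
  \<comment> \<open>A zero of \<open>F\<close> makes the radial solution vanish on a sphere of
    radius r \<le> R, so its Picone flux there is 0. Rigidity then makes phi / u constant on that
    ball, although it is 0 on the sphere and positive at the origin.\<close>
  have F_nz: "F s \<noteq> 0" if "0 < s" "s \<le> R\<^sup>2" for s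
  proof
    assume F0: "F s = 0"
    define r where "r = sqrt s"
    have r: "r > 0" "r \<le> R" "r\<^sup>2 = s"
      using that R by (auto simp: r_def intro: real_le_lsqrt)
    have sub: "cball 0 r \<subseteq> cball (0::'a) R" "ball 0 r \<subseteq> ball (0::'a) R" using r by auto
    have \<phi>0: "\<phi> y = 0" if "norm y = r" for y
      using that r F0 by (simp add: \<phi>_def power2_norm_eq_inner[symmetric])
    have eq: "\<phi> x *\<^sub>R V x + G x = 0" if "x \<in> cball 0 r" for x
      by (rule ball_picone_equality[OF r(1) continuous_on_subset[OF V(1) sub(1)]
            has_divergence_on_subset[OF V(2) sub(2)] c\<phi>(1) \<phi>(1) c\<phi>(2) \<phi>(2) _ that])
        (simp add: \<phi>0)
    have D: "((\<lambda>x. \<phi> x / u x) has_derivative (\<lambda>h. 0)) (at x)" if x: "x \<in> ball 0 r" for x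
    proof -
      have ux: "u x > 0" "x \<in> ball 0 R" using U(5)[of x] x sub by auto
      have "((\<lambda>x. \<phi> x / u x) has_derivative
          (\<lambda>h. - \<phi> x * (inverse (u x) * (U x \<bullet> h) * inverse (u x)) + G x \<bullet> h / u x)) (at x)"
        by (rule has_derivative_divide[OF C1_onD(1)[OF \<phi>(1) UNIV_I] C1_onD(1)[OF U(1) ux(2)]])
          (use ux in simp)
      moreover have "G x = - (\<phi> x *\<^sub>R V x)" using eq[of x] x by (simp add: eq_neg_iff_add_eq_0 add.commute)
      ultimately show ?thesis
        using ux(1) by (simp add: V_def field_simps)
    qed
    obtain c where c: "\<And>x. x \<in> ball 0 r \<Longrightarrow> \<phi> x / u x = c"
      using has_derivative_zero_constant[of "ball 0 r" "\<lambda>x. \<phi> x / u x"] D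
      by (metis convex_ball has_derivative_at_withinI)
    obtain y :: 'a where y: "norm y = r"
      using vector_choose_size[of r] r by auto
    have "\<phi> y / u y = c"
    proof (rule continuous_constant_on_closure[of "ball 0 r" "\<lambda>x. \<phi> x / u x"])
      show "continuous_on (closure (ball 0 r)) (\<lambda>x. \<phi> x / u x)"
      proof (intro continuous_intros c\<phi> continuous_on_subset[OF U(3)] ballI)
        show "closure (ball (0::'a) r) \<subseteq> cball 0 R" using r(1) sub(1) by simp
        show "u x \<noteq> 0" if "x \<in> closure (ball 0 r)" for x
          using U(5)[of x] that r by simp
      qed
    qed (use c y r in auto)
    then have "c = 0" using \<phi>0[OF y] by simp
    then show False
      using c[of 0] r U(5)[of 0] R by (simp add: \<phi>_def F_0)
  qed
  show pos: "F s > 0" if s: "0 \<le> s" "s \<le> R\<^sup>2" for s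
  proof (rule ccontr)
    assume "\<not> F s > 0"
    then obtain z where "0 \<le> z" "z \<le> s" "F z = 0"
      using IVT2'[of F s 0 0] s continuous_F(1) F_0 by auto
    then show False using F_nz[of z] s F_0 by (cases "z = 0") auto
  qed
  define \<kappa> where "\<kappa> = \<alpha> * F (R\<^sup>2) + 2 * R * F1 (R\<^sup>2)"
  have FR: "F (R\<^sup>2) > 0" using pos by simp
  obtain y0 :: 'a where y0: "norm y0 = R"
    using vector_choose_size[of R] R by auto
  have V_y: "V y \<bullet> y = \<alpha> * R" and \<phi>_y: "\<phi> y = F (R\<^sup>2)" and G_y: "G y \<bullet> y = 2 * F1 (R\<^sup>2) * R\<^sup>2"
    and u_y: "u y > 0" if "norm y = R" for y
    using U_y[OF that] U(5)[of y] that
    by (auto simp: V_def \<phi>_def G_def power2_norm_eq_inner[symmetric] field_simps)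
  \<comment> \<open>\<open>\<kappa>\<close> is the Robin defect of the radial solution. Its sign
    decides the roles: if \<kappa> \<le> 0, phi is tested against the field of \<open>u\<close>,
    otherwise \<open>u\<close> against the field of phi. In both cases the resulting equality, read
    at one boundary point, gives \<kappa> = 0.\<close>
  have "\<kappa> = 0"
  proof (cases "\<kappa> \<le> 0")
    case True
    have "\<phi> y0 *\<^sub>R V y0 + G y0 = 0"
    proof (rule ball_picone_equality[OF R V c\<phi>(1) \<phi>(1) c\<phi>(2) \<phi>(2)])
      fix y :: 'a assume y: "norm y = R"
      have "((\<phi> y)\<^sup>2 *\<^sub>R V y + \<phi> y *\<^sub>R G y) \<bullet> y = F (R\<^sup>2) * R * \<kappa>"
        by (simp add: inner_add_left V_y[OF y] \<phi>_y[OF y] G_y[OF y] \<kappa>_def power2_eq_square algebra_simps)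
      also have "\<dots> \<le> 0" using True FR R by (simp add: mult_nonneg_nonpos)
      finally show "((\<phi> y)\<^sup>2 *\<^sub>R V y + \<phi> y *\<^sub>R G y) \<bullet> y \<le> 0" .
    qed (use y0 in simp)
    then have "(\<phi> y0 *\<^sub>R V y0 + G y0) \<bullet> y0 = 0" by simp
    then have "R * \<kappa> = 0"
      by (simp add: inner_add_left V_y[OF y0] \<phi>_y[OF y0] G_y[OF y0] \<kappa>_def power2_eq_square algebra_simps)
    then show ?thesis using R by simp
  next
    case False
    have \<phi>_pos: "\<phi> x > 0" if "x \<in> cball 0 R" for x
      using that pos[of "x \<bullet> x"] power_mono[of "norm x" R 2]
      by (simp add: \<phi>_def power2_norm_eq_inner[symmetric])
    define V' where "V' x = - (1 / \<phi> x) *\<^sub>R G x" for x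
    have V': "continuous_on (cball 0 R) V'" "has_divergence_on V' (\<lambda>x. l + V' x \<bullet> V' x) (ball 0 R)"
    proof -
      show "continuous_on (cball 0 R) V'"
        unfolding V'_def by (intro continuous_intros c\<phi> ballI) (use \<phi>_pos in force)
      show "has_divergence_on V' (\<lambda>x. l + V' x \<bullet> V' x) (ball 0 R)"
        unfolding V'_def[abs_def] by (rule has_divergence_on_log_gradient[OF \<phi>]) (use \<phi>_pos in auto)
    qed
    have V'_y: "V' y \<bullet> y = - 2 * F1 (R\<^sup>2) * R\<^sup>2 / F (R\<^sup>2)" if "norm y = R" for y
      using G_y[OF that] by (simp add: V'_def \<phi>_y[OF that])
    have "u y0 *\<^sub>R V' y0 + U y0 = 0"
    proof (rule ball_picone_equality[OF R V' U(3,1,4,2)])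
      fix y :: 'a assume y: "norm y = R"
      have "((u y)\<^sup>2 *\<^sub>R V' y + u y *\<^sub>R U y) \<bullet> y = - ((u y)\<^sup>2 * R * \<kappa> / F (R\<^sup>2))"
        using FR by (simp add: inner_add_left V'_y[OF y] U_y[OF y] \<kappa>_def power2_eq_square field_simps)
      also have "\<dots> \<le> 0" using False FR R by simp
      finally show "((u y)\<^sup>2 *\<^sub>R V' y + u y *\<^sub>R U y) \<bullet> y \<le> 0" .
    qed (use y0 in simp)
    then have "(u y0 *\<^sub>R V' y0 + U y0) \<bullet> y0 = 0" by simp
    then have "u y0 * R * \<kappa> = 0"
      using FR by (simp add: inner_add_left V'_y[OF y0] U_y[OF y0] \<kappa>_def power2_eq_square field_simps)
    then show ?thesis using R u_y[OF y0] by simp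
  qed
  then show "\<alpha> * F (R\<^sup>2) + 2 * R * F1 (R\<^sup>2) = 0" by (simp add: \<kappa>_def)
qed

section \<open>Perturbed balls\<close>


text \<open>Openness is invariance of domain; the image of the closed ball is compact and is the
  closure; injectivity separates the images of ball and sphere.\<close>

lemma perturbed_ball_topology:
  fixes f :: "'a::euclidean_space \<Rightarrow> 'a"
  assumes R: "R > 0" and f: "continuous_on (cball 0 R) f" "inj_on f (cball 0 R)"
  shows "open (f ` ball 0 R)" "closure (f ` ball 0 R) = f ` cball 0 R"
    "frontier (f ` ball 0 R) = f ` sphere 0 R"
proof -
  have sub: "ball (0::'a) R \<subseteq> cball 0 R" by auto
  show op: "open (f ` ball 0 R)"
    by (rule invariance_of_domain[OF continuous_on_subset[OF f(1) sub] _ inj_on_subset[OF f(2) sub]]) simp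
  have "compact (f ` cball 0 R)"
    by (rule compact_continuous_image[OF f(1)]) simp
  then have "closure (f ` ball 0 R) \<subseteq> f ` cball 0 R"
    using closure_minimal[of "f ` ball 0 R" "f ` cball 0 R"] sub compact_imp_closed by blast
  moreover have "f ` cball 0 R \<subseteq> closure (f ` ball 0 R)"
    using image_closure_subset[of "ball 0 R" f "closure (f ` ball 0 R)"] f(1) R closure_subset[of "f ` ball 0 R"] by simp
  ultimately show cl: "closure (f ` ball 0 R) = f ` cball 0 R" by blast
  have "f ` sphere 0 R = f ` (cball 0 R - ball 0 R)"
    by (rule arg_cong[of _ _ "(`) f"]) auto
  also have "\<dots> = f ` cball 0 R - f ` ball 0 R"
    by (rule inj_on_image_set_diff[OF f(2)]) auto
  finally show "frontier (f ` ball 0 R) = f ` sphere 0 R"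
    using op cl by (simp add: frontier_def interior_open)
qed

text \<open>For the inner inclusion, x - f x + z maps the closed ball into the open one when |z| < R
  - \<kappa>, and a Brouwer fixed point solves f x = z.\<close>

lemma perturbed_ball_between:
  fixes f :: "'a::euclidean_space \<Rightarrow> 'a"
  assumes R: "R > 0" and f: "continuous_on (cball 0 R) f"
    and close: "\<And>x. x \<in> cball 0 R \<Longrightarrow> norm (f x - x) \<le> \<kappa>"
  shows "ball 0 (R - \<kappa>) \<subseteq> f ` ball 0 R" "f ` ball 0 R \<subseteq> ball 0 (R + \<kappa>)"
proof -
  show "f ` ball 0 R \<subseteq> ball 0 (R + \<kappa>)"
  proof clarsimp
    fix x :: 'a assume "norm x < R"
    then show "norm (f x) < R + \<kappa>"
      using close[of x] norm_triangle_sub[of "f x" x] by simp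
  qed
  show "ball 0 (R - \<kappa>) \<subseteq> f ` ball 0 R"
  proof
    fix z :: 'a assume z: "z \<in> ball 0 (R - \<kappa>)"
    have lt: "norm (x - f x + z) < R" if "x \<in> cball 0 R" for x
      using close[OF that] z norm_triangle_ineq[of "x - f x" z] by (simp add: norm_minus_commute)
    obtain x where "x \<in> cball 0 R" "x - f x + z = x"
    proof (rule brouwer_ball[OF R, of 0 "\<lambda>x. x - f x + z"])
      show "continuous_on (cball 0 R) (\<lambda>x. x - f x + z)" by (intro continuous_intros f)
    qed (use lt in \<open>auto simp: less_imp_le\<close>)
    then have "f x = z" "x \<in> ball 0 R" using lt[of x] by (auto simp: algebra_simps)
    then show "z \<in> f ` ball 0 R" by blast
  qed
qed

text \<open>The function R^2 - |x|^2 is carried over by the inverse of \<open>f\<close>. The second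
  claim controls the turning of the normals; its scalar \<open>a\<close> stays free, and the unit
  length of \<open>n\<close> pins it down in \<open>normal_component_estimate\<close>.\<close>

lemma perturbed_ball_C2_domain:
  fixes f :: "'a::euclidean_space \<Rightarrow> 'a"
  assumes R: "R > 0" and diffeo: "C2_Holder_diffeo_on g (cball 0 R) f"
    and B: "\<And>x. x \<in> cball 0 R \<Longrightarrow> (f has_derivative blinfun_apply (B x)) (at x within cball 0 R)"
      "continuous_on (cball 0 R) B"
    and close: "\<And>x. x \<in> cball 0 R \<Longrightarrow> norm (B x - id_blinfun) \<le> \<kappa>"
  obtains rho P d where "C2_domain (f ` ball 0 R) rho P d"
    "\<And>x n. norm x = R \<Longrightarrow> outer_unit_normal (f ` ball 0 R) (f x) n \<Longrightarrow> \<exists>a>0. norm (n - a *\<^sub>R x) \<le> \<kappa>"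
proof -
  have inj: "inj_on f (cball 0 R)" using diffeo by (simp add: C2_Holder_diffeo_on_def)
  have cf: "continuous_on (cball 0 R) f"
    using B(1) by (meson continuous_on_eq_continuous_within has_derivative_continuous)
  define Om where "Om = f ` ball 0 R"
  note top = perturbed_ball_topology[OF R cf inj, folded Om_def]
  define \<Psi> where "\<Psi> = inv_into (cball 0 R) f"
  have \<Psi>f: "\<Psi> (f x) = x" if "x \<in> cball 0 R" for x
    unfolding \<Psi>_def by (rule inv_into_f_f[OF inj that])
  obtain A A2 where A: "has_C1_derivative_on \<Psi> A (f ` cball 0 R)" "has_C1_derivative_on A A2 (f ` cball 0 R)"
    using diffeo unfolding C2_Holder_diffeo_on_def C2_Holder_on_def \<Psi>_def by blast
  have A_within: "(\<Psi> has_derivative A y) (at y within f ` cball 0 R)"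
    and A2_within: "(A has_derivative A2 y) (at y within f ` cball 0 R)" if "y \<in> f ` cball 0 R" for y
    using A that unfolding has_C1_derivative_on_def by blast+
  have cA: "continuous_on (f ` cball 0 R) A" "continuous_on (f ` cball 0 R) A2"
    using A unfolding has_C1_derivative_on_def by blast+
  have c\<Psi>: "continuous_on (f ` cball 0 R) \<Psi>"
    using A_within by (meson continuous_on_eq_continuous_within has_derivative_continuous)
  have sub: "Om \<subseteq> f ` cball 0 R" by (auto simp: Om_def)
  have atOm: "at y within f ` cball 0 R = at y" if "y \<in> Om" for y
    using that sub top(1) by (metis at_within_interior in_mono interior_maximal)
  \<comment> \<open>Chain rule in the open ball; the sphere follows by continuity of both
    derivatives on the closed sets.\<close>
  have AB: "A (f x) (B x h) = h" if x: "x \<in> cball 0 R" for x h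
  proof (rule continuous_constant_on_closure[of "ball 0 R" "\<lambda>x. A (f x) (B x h)"])
    show "continuous_on (closure (ball 0 R)) (\<lambda>x. A (f x) (B x h))"
    proof -
      have "continuous_on (cball 0 R) (\<lambda>x. A (f x))"
        by (rule continuous_on_compose2[OF cA(1) cf]) auto
      then have "continuous_on (cball 0 R) (\<lambda>x. A (f x) (B x h))"
        by (intro continuous_intros B(2))
      then show ?thesis using R by simp
    qed
    show "x \<in> closure (ball 0 R)" using x R by simp
    fix z :: 'a assume z: "z \<in> ball 0 R"
    have "(f has_derivative B z) (at z)"
    proof -
      have "at z within cball 0 R = at z" using z by (intro at_within_interior) simp
      moreover have "z \<in> cball 0 R" using z by simp
      ultimately show ?thesis using B(1)[of z] by (simp only:)
    qed
    moreover have "(\<Psi> has_derivative A (f z)) (at (f z))"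
      using A_within[of "f z"] atOm[of "f z"] z by (simp add: Om_def)
    ultimately have "((\<lambda>z. \<Psi> (f z)) has_derivative (\<lambda>h. A (f z) (B z h))) (at z)"
      by (rule has_derivative_compose)
    moreover have "((\<lambda>z. \<Psi> (f z)) has_derivative (\<lambda>h. h)) (at z)"
      by (rule has_derivative_transform_within_open[OF has_derivative_ident open_ball z]) (simp add: \<Psi>f)
    ultimately show "A (f z) (B z h) = h" using has_derivative_unique by metis
  qed
  \<comment> \<open>The vector representing the derivative of R^2 - |\<Psi> y|^2.\<close>
  define P where "P y = (\<Sum>b\<in>Basis. (- 2 * (\<Psi> y \<bullet> A y b)) *\<^sub>R b)" for y
  have P_inner: "P y \<bullet> h = - 2 * (\<Psi> y \<bullet> A y h)" for y h
  proof -
    have "A y h = A y (\<Sum>b\<in>Basis. (h \<bullet> b) *\<^sub>R b)" by (simp add: euclidean_representation)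
    also have "\<dots> = (\<Sum>b\<in>Basis. (h \<bullet> b) *\<^sub>R A y b)"
      by (simp only: blinfun.sum_right blinfun.scaleR_right)
    finally show ?thesis
      by (simp add: P_def inner_sum_left inner_sum_right sum_distrib_left inner_commute mult_ac)
  qed
  have P_B: "P (f x) \<bullet> B x h = - 2 * (x \<bullet> h)" if "x \<in> cball 0 R" for x h
    by (simp add: P_inner AB[OF that] \<Psi>f[OF that])
  define P' where "P' y k = (\<Sum>b\<in>Basis. (- 2 * (\<Psi> y \<bullet> A2 y k b + A y k \<bullet> A y b)) *\<^sub>R b)" for y k
  define d where "d y = (\<Sum>b\<in>Basis. P' y b \<bullet> b)" for y
  interpret C2_domain Om "\<lambda>y. R\<^sup>2 - \<Psi> y \<bullet> \<Psi> y" P d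
  proof
    show "open Om" by (rule top)
    show "bounded Om"
      using compact_imp_bounded[OF compact_continuous_image[OF cf compact_cball]] bounded_subset sub by blast
    show "((\<lambda>y. R\<^sup>2 - \<Psi> y \<bullet> \<Psi> y) has_derivative (\<bullet>) (P y)) (at y within closure Om)" if "y \<in> closure Om" for y
    proof -
      have "(\<Psi> has_derivative A y) (at y within f ` cball 0 R)"
        using that by (intro A_within) (simp add: top(2))
      from has_derivative_diff[OF has_derivative_const has_derivative_inner[OF this this]]
      have "((\<lambda>y. R\<^sup>2 - \<Psi> y \<bullet> \<Psi> y) has_derivative (\<lambda>h. P y \<bullet> h)) (at y within f ` cball 0 R)"
        unfolding P_inner by (simp add: inner_commute)
      then show ?thesis by (simp add: top(2))
    qed
    show "0 < R\<^sup>2 - \<Psi> y \<bullet> \<Psi> y" if "y \<in> Om" for y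
      using that R by (auto simp: Om_def \<Psi>f power2_norm_eq_inner[symmetric] intro!: power_strict_mono)
    show "R\<^sup>2 - \<Psi> y \<bullet> \<Psi> y = 0" if "y \<in> frontier Om" for y
      using that R by (auto simp: top \<Psi>f power2_norm_eq_inner[symmetric])
    show "continuous_on (closure Om) P"
      unfolding top P_def by (intro continuous_intros c\<Psi> cA)
    show "P y \<noteq> 0" if y: "y \<in> frontier Om" for y
    proof -
      obtain x where x: "y = f x" "norm x = R" using y by (auto simp: top)
      then have "P y \<bullet> B x x \<noteq> 0"
        using P_B[of x x] R by auto
      then show ?thesis by auto
    qed
    have "C1_on Om P P'"
    proof (rule C1_onI)
      fix y assume y: "y \<in> Om"
      have A_at: "(\<Psi> has_derivative A y) (at y)" "(A has_derivative A2 y) (at y)"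
        using A_within[of y] A2_within[of y] atOm[OF y] subsetD[OF sub y] by simp_all
      have "((\<lambda>y. A y b) has_derivative (\<lambda>k. A2 y k b)) (at y)" for b
        by (rule bounded_linear.has_derivative[OF blinfun.bounded_linear_left A_at(2)])
      then have "((\<lambda>y. \<Sum>b\<in>Basis. (- 2 * (\<Psi> y \<bullet> A y b)) *\<^sub>R b) has_derivative P' y) (at y)"
        unfolding P'_def
        by (intro has_derivative_sum has_derivative_scaleR_left has_derivative_mult_right
            has_derivative_inner A_at(1))
      then show "(P has_derivative P' y) (at y)" unfolding P_def[abs_def] .
    next
      fix h show "continuous_on Om (\<lambda>x. P' x h)"
        unfolding P'_def
        by (intro continuous_intros continuous_on_subset[OF c\<Psi> sub] continuous_on_subset[OF cA(1) sub]
            continuous_on_subset[OF cA(2) sub])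
    qed
    then show "has_divergence_on P d Om"
      unfolding has_divergence_on_def d_def by blast
    have "continuous_on (f ` cball 0 R) d"
      unfolding d_def P'_def by (intro continuous_intros c\<Psi> cA)
    then have "bounded (d ` f ` cball 0 R)"
      by (intro compact_imp_bounded compact_continuous_image cf compact_cball)
    then show "\<exists>M. \<forall>x\<in>Om. \<bar>d x\<bar> \<le> M"
      using sub unfolding bounded_iff real_norm_def by blast
  qed
  show ?thesis
  proof (rule that)
    show "C2_domain (f ` ball 0 R) (\<lambda>y. R\<^sup>2 - \<Psi> y \<bullet> \<Psi> y) P d"
      using C2_domain_axioms by (simp add: Om_def)
    fix x n assume x: "norm x = R" and n: "outer_unit_normal (f ` ball 0 R) (f x) n"
    have "f x \<in> frontier Om" using x by (auto simp: top)
    then obtain c where c: "c > 0" "P (f x) = - c *\<^sub>R n"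
      using gradient_outer_unit_normal n unfolding Om_def by blast
    have xin: "x \<in> cball 0 R" using x by simp
    have nB: "n \<bullet> B x h = 2 / c * (x \<bullet> h)" for h
      using P_B[OF xin, of h] c by (simp add: field_simps)
    \<comment> \<open>Since n \<bullet> B x h = (2 / c) (x \<bullet> h), pairing \<open>e\<close>
      with h involves only the difference of \<open>B x\<close> and the identity; h = e then gives
      |e|^2 \<le> \<kappa> |e|.\<close>
    define e where "e = n - (2 / c) *\<^sub>R x"
    have "e \<bullet> h = - (n \<bullet> (B x - id_blinfun) h)" for h
      by (simp add: e_def inner_diff_left inner_diff_right nB blinfun.diff_left)
    then have "(norm e)\<^sup>2 = - (n \<bullet> (B x - id_blinfun) e)"
      by (simp add: power2_norm_eq_inner)
    also have "\<dots> \<le> norm n * norm ((B x - id_blinfun) e)"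
      using Cauchy_Schwarz_ineq2[of n "(B x - id_blinfun) e"] by linarith
    also have "\<dots> \<le> norm n * (norm (B x - id_blinfun) * norm e)"
      by (intro mult_left_mono norm_blinfun) auto
    also have "\<dots> \<le> \<kappa> * norm e"
      using n close[OF xin] by (simp add: outer_unit_normal_def mult_right_mono)
    finally have "norm e * norm e \<le> \<kappa> * norm e" by (simp add: power2_eq_square)
    moreover have "\<kappa> \<ge> 0" using close[OF xin] norm_ge_zero order_trans by blast
    ultimately have "norm e \<le> \<kappa>" by (cases "e = 0") auto
    then show "\<exists>a>0. norm (n - a *\<^sub>R x) \<le> \<kappa>"
      using c(1) unfolding e_def by (intro exI[of _ "2 / c"]) auto
  qed
qed

text \<open>Off the sphere, a null set, every point eventually lies in all \<open>Om n\<close> or in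
  none, so dominated convergence applies.\<close>

lemma set_integral_ball_between_tendsto:
  fixes f :: "'a::euclidean_space \<Rightarrow> real"
  assumes f: "continuous_on UNIV f" and "R > 0" and Om: "\<And>n. open (Om n)"
    "\<And>n. ball 0 (R - \<kappa> n) \<subseteq> Om n" "\<And>n. Om n \<subseteq> ball 0 (R + \<kappa> n)" and \<kappa>: "\<kappa> \<longlonglongrightarrow> 0"
  shows "(\<lambda>n. LINT x:Om n|lborel. f x) \<longlonglongrightarrow> (LINT x:ball 0 R|lborel. f x)"
proof -
  obtain K where K: "\<And>n. \<kappa> n \<le> K"
    using convergent_imp_bounded[OF \<kappa>] by (auto simp: bounded_iff abs_le_iff)
  have f_meas: "f \<in> borel_measurable borel"
    by (rule borel_measurable_continuous_onI[OF f])
  have null: "AE x in lborel. norm (x::'a) \<noteq> R"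
  proof -
    have "sphere (0::'a) R \<in> null_sets lborel"
      using negligible_sphere[of 0 R] by (simp add: negligible_iff_null_sets null_sets_completion_iff)
    from AE_not_in[OF this] show ?thesis by (rule eventually_mono) simp
  qed
  show ?thesis
    unfolding set_lebesgue_integral_def
  proof (rule integral_dominated_convergence[where w="\<lambda>x. indicator (cball 0 (R + K)) x *\<^sub>R \<bar>f x\<bar>"])
    show "(\<lambda>x. indicator (ball 0 R) x *\<^sub>R f x) \<in> borel_measurable lborel"
      "(\<lambda>x. indicator (Om n) x *\<^sub>R f x) \<in> borel_measurable lborel" for n
      using f_meas Om(1) by (auto intro!: borel_measurable_times borel_measurable_indicator)
    show "integrable lborel (\<lambda>x. indicator (cball 0 (R + K)) x *\<^sub>R \<bar>f x\<bar>)"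
      by (rule borel_integrable_compact) (auto intro!: continuous_intros continuous_on_subset[OF f])
    show "AE x in lborel. norm (indicator (Om n) x *\<^sub>R f x) \<le> indicator (cball 0 (R + K)) x *\<^sub>R \<bar>f x\<bar>" for n
    proof (rule AE_I2)
      fix x show "norm (indicator (Om n) x *\<^sub>R f x) \<le> indicator (cball 0 (R + K)) x *\<^sub>R \<bar>f x\<bar>"
        using subsetD[OF Om(3)[of n], of x] K[of n] by (auto simp: indicator_def)
    qed
    show "AE x in lborel. (\<lambda>n. indicator (Om n) x *\<^sub>R f x) \<longlonglongrightarrow> indicator (ball 0 R) x *\<^sub>R f x"
      using null
    proof eventually_elim
      case (elim x)
      have "\<forall>\<^sub>F n in sequentially. \<kappa> n < \<bar>R - norm x\<bar>"
        by (rule order_tendstoD(2)[OF \<kappa>]) (use elim in simp)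
      then have "\<forall>\<^sub>F n in sequentially. indicator (Om n) x *\<^sub>R f x = indicator (ball 0 R) x *\<^sub>R f x"
      proof eventually_elim
        case (elim n)
        then show ?case
          using subsetD[OF Om(3)[of n], of x] subsetD[OF Om(2)[of n], of x]
          by (cases "norm x < R") (auto simp: indicator_def)
      qed
      then show ?case by (rule tendsto_eventually)
    qed
  qed
qed

section \<open>The boundary flux of the perturbation field\<close>


text \<open>The normal component of \<open>v\<close> on the sphere, extended to be constant along rays (and \<open>0\<close> at the
  origin).\<close>

definition radial_ext :: "real \<Rightarrow> ('a::euclidean_space \<Rightarrow> 'a) \<Rightarrow> 'a \<Rightarrow> real" where
  "radial_ext R v x = v ((R / norm x) *\<^sub>R x) \<bullet> (x /\<^sub>R norm x)"

text \<open>The extension factors through the projection \<open>m\<close> onto the sphere, whose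
  range stays in the closed ball, so differentiability of \<open>v\<close> within that ball
  suffices. As \<open>m\<close> is constant along rays, the derivative kills the radial
  direction.\<close>

lemma radial_ext_C1:
  assumes "R > 0" and v: "has_C1_derivative_on v Dv (cball 0 R)"
  obtains g' where "C1_on (- {0}) (radial_ext R v) g'" "\<And>x. x \<noteq> 0 \<Longrightarrow> g' x x = 0"
proof -
  define a where "a x = R / sqrt (x \<bullet> x)" for x :: 'a
  define a' where "a' x h = - (R / (2 * (x \<bullet> x) * sqrt (x \<bullet> x))) * (2 * (x \<bullet> h))" for x h :: 'a
  define m where "m x = a x *\<^sub>R x" for x
  define m' where "m' x h = a x *\<^sub>R h + a' x h *\<^sub>R x" for x h
  have a: "C1_on (- {0}) a a'"
    unfolding a_def[abs_def] a'_def[abs_def]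
  proof (rule C1_on_compose_real[OF C1_on_inner_self, where g="\<lambda>s. R / sqrt s"
        and g'="\<lambda>s. - (R / (2 * s * sqrt s))"])
    fix x :: 'a assume "x \<in> - {0}"
    then have "x \<bullet> x > 0" using inner_gt_zero_iff[of x] by blast
    then show "((\<lambda>s. R / sqrt s) has_real_derivative - (R / (2 * (x \<bullet> x) * sqrt (x \<bullet> x)))) (at (x \<bullet> x))"
      by (auto intro!: derivative_eq_intros simp: field_simps simp del: inner_gt_zero_iff)
  qed (auto intro!: continuous_intros)
  have "C1_on (- {0}) (\<lambda>x::'a. x) (\<lambda>x h. h)" by (rule C1_onI) auto
  from C1_on_scaleR[OF a this] have m: "C1_on (- {0}) m m'"
    unfolding m_def[abs_def] m'_def[abs_def] .
  have m_in: "m x \<in> cball 0 R" for x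
    using assms(1) by (simp add: m_def a_def norm_eq_sqrt_inner[symmetric])
  have m'0: "m' x x = 0" if "x \<noteq> 0" for x
    using that by (simp add: m'_def a_def a'_def scaleR_add_left[symmetric] field_simps)
  define g' where "g' x h = (v (m x) \<bullet> m' x h + Dv (m x) (m' x h) \<bullet> m x) / R" for x h
  have ge: "radial_ext R v = (\<lambda>x. (v (m x) \<bullet> m x) / R)"
  proof
    show "radial_ext R v x = (v (m x) \<bullet> m x) / R" for x
      using assms(1) by (simp add: radial_ext_def m_def a_def norm_eq_sqrt_inner[symmetric] field_simps)
  qed
  have g: "C1_on (- {0}) (radial_ext R v) g'"
    unfolding ge
  proof (rule C1_onI)
    fix x :: 'a assume x: "x \<in> - {0}"
    have mx: "(m has_derivative m' x) (at x)" by (rule C1_onD(1)[OF m x])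
    have "(v has_derivative Dv (m x)) (at (m x) within range m)"
      using v m_in[of x] has_derivative_subset[of v "Dv (m x)" "m x" "cball 0 R" "range m"] m_in
      unfolding has_C1_derivative_on_def by blast
    from has_derivative_in_compose[OF mx this]
    have vm: "((\<lambda>x. v (m x)) has_derivative (\<lambda>h. Dv (m x) (m' x h))) (at x)" .
    show "((\<lambda>x. (v (m x) \<bullet> m x) / R) has_derivative g' x) (at x)"
      unfolding g'_def divide_inverse by (intro has_derivative_mult_left has_derivative_inner vm mx)
  next
    have cm: "continuous_on (- {0}) m" by (rule C1_onD(3)[OF m])
    have cv: "continuous_on (cball 0 R) v"
      using v unfolding has_C1_derivative_on_def
      by (meson continuous_on_eq_continuous_within has_derivative_continuous)
    have cDv: "continuous_on (cball 0 R) Dv"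
      using v unfolding has_C1_derivative_on_def by blast
    fix h show "continuous_on (- {0}) (\<lambda>x. g' x h)"
      unfolding g'_def
      using assms(1) m_in by (intro continuous_intros cm C1_onD(2)[OF m]
          continuous_on_compose2[OF cv cm] continuous_on_compose2[OF cDv cm]) auto
  qed
  have "g' x x = 0" if "x \<noteq> 0" for x
    using m'0[OF that] by (simp add: g'_def)
  with g that show ?thesis by blast
qed

text \<open>The extension along rays is in general discontinuous at the origin. This factor is 0 for
  |x| \<le> \<delta> and 1 for |x|^2 \<ge> 2 \<delta>^2.\<close>

definition cutoff_at_0 :: "real \<Rightarrow> 'a::euclidean_space \<Rightarrow> real" where
  "cutoff_at_0 \<delta> x = smooth_step ((x \<bullet> x) / \<delta>\<^sup>2 - 1)"

text \<open>Divergence of x times the cut-off extension: the dimension comes from div x, the second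
  summand from the radial derivative of the cutoff, while the radial derivative of
  \<open>radial_ext\<close> is 0.\<close>

definition radial_ext_divergence :: "real \<Rightarrow> real \<Rightarrow> ('a::euclidean_space \<Rightarrow> 'a) \<Rightarrow> 'a \<Rightarrow> real" where
  "radial_ext_divergence \<delta> R v x = (real DIM('a) * cutoff_at_0 \<delta> x
     + smooth_step' ((x \<bullet> x) / \<delta>\<^sup>2 - 1) * (2 * ((x \<bullet> x) / \<delta>\<^sup>2))) * radial_ext R v x"

lemma radial_ext_has_divergence:
  fixes v :: "'a::euclidean_space \<Rightarrow> 'a"
  assumes "R > 0" "\<delta> > 0" and v: "has_C1_derivative_on v Dv (cball 0 R)"
  shows "has_divergence_on (\<lambda>x. (cutoff_at_0 \<delta> x * radial_ext R v x) *\<^sub>R x) (radial_ext_divergence \<delta> R v) UNIV"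
proof -
  obtain g' where g': "C1_on (- {0}) (radial_ext R v) g'" "\<And>x. x \<noteq> 0 \<Longrightarrow> g' x x = 0"
    using radial_ext_C1[OF assms(1) v] by blast
  have "C1_on (- {0}) (cutoff_at_0 \<delta>) (\<lambda>x h. (smooth_step' ((x \<bullet> x) / \<delta>\<^sup>2 - 1) / \<delta>\<^sup>2) * (2 * (x \<bullet> h)))"
    unfolding cutoff_at_0_def[abs_def]
  proof (rule C1_on_compose_real[OF C1_on_inner_self, where g="\<lambda>s. smooth_step (s / \<delta>\<^sup>2 - 1)"
        and g'="\<lambda>s. smooth_step' (s / \<delta>\<^sup>2 - 1) / \<delta>\<^sup>2"])
    show "((\<lambda>s. smooth_step (s / \<delta>\<^sup>2 - 1)) has_real_derivative smooth_step' (s / \<delta>\<^sup>2 - 1) / \<delta>\<^sup>2) (at s)" for s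
    proof -
      have "((\<lambda>s. s / \<delta>\<^sup>2 - 1) has_real_derivative 1 / \<delta>\<^sup>2) (at s)"
        by (intro DERIV_cdivide DERIV_ident DERIV_diff[of _ _ _ _ "\<lambda>_. 1" 0, simplified])
      from DERIV_chain2[OF DERIV_smooth_step this] show ?thesis by simp
    qed
  qed (use assms(2) in \<open>auto intro!: continuous_intros continuous_on_compose2[OF continuous_smooth_step'[of UNIV]]\<close>)
  from C1_on_scaleR[OF this g'(1)]
  have C1: "C1_on (- {0}) (\<lambda>x. cutoff_at_0 \<delta> x * radial_ext R v x)
     (\<lambda>x h. cutoff_at_0 \<delta> x * g' x h + smooth_step' ((x \<bullet> x) / \<delta>\<^sup>2 - 1) / \<delta>\<^sup>2 * (2 * (x \<bullet> h)) * radial_ext R v x)"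
    by simp
  have 1: "has_divergence_on (\<lambda>x. (cutoff_at_0 \<delta> x * radial_ext R v x) *\<^sub>R x) (radial_ext_divergence \<delta> R v) (- {0})"
    by (rule has_divergence_on_cong[OF _ has_divergence_on_scaleR[OF C1 has_divergence_on_id]])
      (auto simp: radial_ext_divergence_def g'(2) algebra_simps)
  have small: "(x \<bullet> x) / \<delta>\<^sup>2 - 1 \<le> 0" if "x \<in> ball 0 \<delta>" for x :: 'a
  proof -
    have "x \<bullet> x \<le> \<delta>\<^sup>2"
      using that power_mono[of "norm x" \<delta> 2] by (simp add: power2_norm_eq_inner)
    then show ?thesis using assms(2) by (simp add: divide_simps)
  qed
  \<comment> \<open>Near the origin the field is identically 0, which covers the singular point of
    the extension.\<close>
  have 2: "has_divergence_on (\<lambda>x. (cutoff_at_0 \<delta> x * radial_ext R v x) *\<^sub>R x) (radial_ext_divergence \<delta> R v) (ball 0 \<delta>)"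
    by (rule has_divergence_on_cong[OF _ has_divergence_on_cmul[OF has_divergence_on_id, of 0]])
      (use small in \<open>auto simp: radial_ext_divergence_def cutoff_at_0_def smooth_step_simps\<close>)
  have "- {0} \<union> ball (0::'a) \<delta> = UNIV" using assms(2) by auto
  then show ?thesis
    using has_divergence_on_Un[OF _ _ 1 2] by (simp add: open_Compl)
qed

lemma radial_ext_bounded_measurable:
  fixes v :: "'a::euclidean_space \<Rightarrow> 'a"
  assumes "R > 0" and v: "has_C1_derivative_on v Dv (cball 0 R)"
  obtains M where "\<And>x. \<bar>radial_ext R v x\<bar> \<le> M" "radial_ext R v \<in> borel_measurable borel"
proof -
  have cv: "continuous_on (cball 0 R) v"
    using v unfolding has_C1_derivative_on_def
    by (meson continuous_on_eq_continuous_within has_derivative_continuous)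
  obtain M where M: "\<And>x. x \<in> cball 0 R \<Longrightarrow> norm (v x) \<le> M"
    using compact_imp_bounded[OF compact_continuous_image[OF cv compact_cball]] unfolding bounded_iff by blast
  have "\<bar>radial_ext R v x\<bar> \<le> M" for x
  proof -
    have "\<bar>radial_ext R v x\<bar> \<le> norm (v ((R / norm x) *\<^sub>R x)) * norm (x /\<^sub>R norm x)"
      unfolding radial_ext_def by (rule Cauchy_Schwarz_ineq2)
    also have "\<dots> \<le> norm (v ((R / norm x) *\<^sub>R x)) * 1"
      by (intro mult_left_mono) (cases "x = 0"; simp)+
    also have "\<dots> \<le> M" using assms(1) by (auto intro!: M)
    finally show ?thesis .
  qed
  moreover obtain g' where "C1_on (- {0}) (radial_ext R v) g'"
    using radial_ext_C1[OF assms] by blast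
  then have "radial_ext R v \<in> borel_measurable borel"
    by (intro borel_measurable_continuous_countable_exceptions[of "{0}"]) (auto dest: C1_onD(3))
  ultimately show ?thesis using that by blast
qed

text \<open>The gradient of the cutoff has size 1 / \<delta> but is multiplied by |x| of size
  \<delta>, so the integrands stay bounded, and at each fixed point the cutoff eventually
  disappears.\<close>

lemma radial_ext_divergence_integral_tendsto:
  fixes v :: "'a::euclidean_space \<Rightarrow> 'a"
  assumes R: "R > 0" and v: "has_C1_derivative_on v Dv (cball 0 R)"
    and \<delta>: "\<delta> \<longlonglongrightarrow> 0" "\<And>n. \<delta> n > 0"
  shows "(\<lambda>n. LINT x:ball 0 R|lborel. radial_ext_divergence (\<delta> n) R v x)
    \<longlonglongrightarrow> real DIM('a) * (LINT x:ball 0 R|lborel. radial_ext R v x)"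
proof -
  obtain M where M: "\<And>x. \<bar>radial_ext R v x\<bar> \<le> M" and meas: "radial_ext R v \<in> borel_measurable borel"
    using radial_ext_bounded_measurable[OF R v] by blast
  have "(\<lambda>n. LINT x:ball 0 R|lborel. radial_ext_divergence (\<delta> n) R v x)
    \<longlonglongrightarrow> (LINT x:ball 0 R|lborel. real DIM('a) * radial_ext R v x)"
    unfolding set_lebesgue_integral_def
  proof (rule integral_dominated_convergence[where w="\<lambda>x. indicator (cball 0 R) x *\<^sub>R ((real DIM('a) + 16) * M)"])
    show "(\<lambda>x. indicator (ball 0 R) x *\<^sub>R (real DIM('a) * radial_ext R v x)) \<in> borel_measurable lborel"
      by (intro borel_measurable_scaleR borel_measurable_indicator borel_measurable_times)
        (use meas in auto)
    have "continuous_on UNIV (radial_ext_divergence (\<delta> n) R v)" for n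
      by (rule has_divergence_on_continuous_divergence[OF radial_ext_has_divergence[OF R \<delta>(2) v]])
    then have "radial_ext_divergence (\<delta> n) R v \<in> borel_measurable borel" for n
      by (rule borel_measurable_continuous_onI)
    then show "(\<lambda>x. indicator (ball 0 R) x *\<^sub>R radial_ext_divergence (\<delta> n) R v x) \<in> borel_measurable lborel" for n
      by (intro borel_measurable_scaleR borel_measurable_indicator) auto
    show "integrable lborel (\<lambda>x::'a. indicator (cball 0 R) x *\<^sub>R ((real DIM('a) + 16) * M))"
      by (rule borel_integrable_compact) auto
    have "\<bar>radial_ext_divergence (\<delta> n) R v x\<bar> \<le> (real DIM('a) + 16) * M" for n x
    proof -
      define q where "q = (x \<bullet> x) / (\<delta> n)\<^sup>2"
      have q: "q \<ge> 0" by (simp add: q_def)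
      \<comment> \<open>The first factor is at most 4 and vanishes for q > 2, where the second could
        exceed 4; this is the 16 of the dominating function.\<close>
      have "smooth_step' (q - 1) * (2 * q) \<le> 4 * 4"
      proof (cases "q \<le> 2")
        case True then show ?thesis
          using q smooth_step_bounds[of "q - 1"] by (intro mult_mono) auto
      next
        case False then show ?thesis by (simp add: smooth_step_simps)
      qed
      moreover have "0 \<le> smooth_step' (q - 1) * (2 * q)"
        using q smooth_step_bounds by simp
      moreover have "real DIM('a) * cutoff_at_0 (\<delta> n) x \<le> real DIM('a) * 1"
        using smooth_step_bounds by (intro mult_left_mono) (auto simp: cutoff_at_0_def)
      moreover have "real DIM('a) * cutoff_at_0 (\<delta> n) x \<ge> 0"
        using smooth_step_bounds by (auto simp: cutoff_at_0_def)
      ultimately have "\<bar>real DIM('a) * cutoff_at_0 (\<delta> n) x + smooth_step' (q - 1) * (2 * q)\<bar> \<le> real DIM('a) + 16"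
        by linarith
      then show ?thesis
        unfolding radial_ext_divergence_def q_def[symmetric] abs_mult
        using M[of x] by (intro mult_mono) auto
    qed
    then show "AE x in lborel. norm (indicator (ball 0 R) x *\<^sub>R radial_ext_divergence (\<delta> n) R v x)
        \<le> indicator (cball 0 R) x *\<^sub>R ((real DIM('a) + 16) * M)" for n
      by (auto simp: indicator_def intro: order_trans[OF abs_ge_zero])
    have "(\<lambda>n. radial_ext_divergence (\<delta> n) R v x) \<longlonglongrightarrow> real DIM('a) * radial_ext R v x" for x
    proof (cases "x = 0")
      case True
      then show ?thesis by (simp add: radial_ext_divergence_def radial_ext_def)
    next
      case False
      have "\<forall>\<^sub>F n in sequentially. \<delta> n < norm x / 2"
        by (rule order_tendstoD(2)[OF \<delta>(1)]) (use False in simp)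
      then have "\<forall>\<^sub>F n in sequentially. radial_ext_divergence (\<delta> n) R v x = real DIM('a) * radial_ext R v x"
      proof eventually_elim
        case (elim n)
        have "(2 * \<delta> n)\<^sup>2 \<le> (norm x)\<^sup>2"
          using elim \<delta>(2)[of n] by (intro power_mono) auto
        then have "4 * (\<delta> n)\<^sup>2 \<le> x \<bullet> x"
          by (simp add: power2_norm_eq_inner)
        then have "4 \<le> (x \<bullet> x) / (\<delta> n)\<^sup>2"
          using \<delta>(2)[of n] by (simp add: pos_le_divide_eq)
        then have "(x \<bullet> x) / (\<delta> n)\<^sup>2 - 1 \<ge> 1" by simp
        then show ?case by (simp add: radial_ext_divergence_def cutoff_at_0_def smooth_step_simps)
      qed
      then show ?thesis by (rule tendsto_eventually)
    qed
    then show "AE x in lborel. (\<lambda>n. indicator (ball 0 R) x *\<^sub>R radial_ext_divergence (\<delta> n) R v x)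
       \<longlonglongrightarrow> indicator (ball 0 R) x *\<^sub>R (real DIM('a) * radial_ext R v x)"
      by (intro AE_I2 tendsto_intros)
  qed
  then show ?thesis by simp
qed

section \<open>Surface measure and the flux of the perturbation field\<close>

lemma integral_scale_measure:
  fixes f :: "'a \<Rightarrow> real"
  assumes "c \<ge> 0" "f \<in> borel_measurable M"
  shows "integral\<^sup>L (scale_measure (ennreal c) M) f = c * integral\<^sup>L M f"
proof -
  have "scale_measure (ennreal c) M = density M (\<lambda>_. ennreal c)"
    by (rule measure_eqI) (simp_all add: emeasure_density nn_integral_cmult)
  then show ?thesis
    using assms by (simp add: integral_density)
qed

text \<open>By the cone definition, integrating over the sphere means composing with the radial
  projection and integrating over the ball; composing the normal component of \<open>v\<close> with
  the projection gives its extension along rays.\<close>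

lemma sphere_measure_flux:
  fixes v :: "'a::euclidean_space \<Rightarrow> 'a"
  assumes R: "R > 0" and v: "continuous_on (cball 0 R) v"
  shows "(LINT x:sphere 0 R|sphere_measure R. v x \<bullet> (x /\<^sub>R R))
    = real DIM('a) / R * (LINT x:ball 0 R|lborel. radial_ext R v x)"
proof -
  define f where "f x = indicator (sphere 0 R) x *\<^sub>R (v x \<bullet> (x /\<^sub>R R))" for x :: 'a
  define m where "m x = (R / norm x) *\<^sub>R x" for x :: 'a
  have f: "f \<in> borel_measurable borel"
    unfolding f_def
    by (rule borel_measurable_continuous_on_indicator)
      (auto intro!: continuous_intros continuous_on_subset[OF v])
  have m: "m \<in> measurable (restrict_space lborel (ball 0 R)) borel"
    unfolding m_def by (rule measurable_restrict_space1) measurable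
  have "(LINT x:sphere 0 R|sphere_measure R. v x \<bullet> (x /\<^sub>R R)) = integral\<^sup>L (sphere_measure R) f"
    unfolding set_lebesgue_integral_def f_def ..
  also have "\<dots> = real DIM('a) / R * integral\<^sup>L (distr (restrict_space lborel (ball 0 R)) borel m) f"
    unfolding sphere_measure_def m_def using R f
    by (subst integral_scale_measure) auto
  also have "integral\<^sup>L (distr (restrict_space lborel (ball 0 R)) borel m) f
      = integral\<^sup>L (restrict_space lborel (ball 0 R)) (\<lambda>x. f (m x))"
    by (rule integral_distr[OF m f])
  also have "\<dots> = (LINT x:ball 0 R|lborel. f (m x))"
    unfolding set_lebesgue_integral_def by (rule integral_restrict_space) simp
  also have "(\<lambda>x. f (m x)) = radial_ext R v"
  proof
    fix x show "f (m x) = radial_ext R v x"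
    \<comment> \<open>At the origin both sides are 0: \<open>m 0\<close> is 0, off the sphere, and
      division by \<open>norm 0\<close> yields 0.\<close>
    proof (cases "x = 0")
      case False
      then have "m x \<in> sphere 0 R" using R by (simp add: m_def)
      then show ?thesis using R False by (simp add: f_def radial_ext_def m_def divide_inverse)
    qed (use R in \<open>simp add: f_def m_def radial_ext_def\<close>)
  qed
  finally show ?thesis .
qed

section \<open>Expansion of the perturbation\<close>


text \<open>Replacing y \<bullet> n by |y| costs only O(\<kappa>^2): y differs from a multiple b n
  by a vector z of size O(\<kappa>), and |y|^2 - (y \<bullet> n)^2 \<le> |z|^2, while |y| + y
  \<bullet> n stays above R / 2.\<close>

lemma normal_component_estimate:
  fixes x y n :: "'a::euclidean_space"
  assumes x: "norm x = R" "R > 0" and n: "norm n = 1" and a: "a > 0" "norm (n - a *\<^sub>R x) \<le> \<kappa>"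
    and y: "norm (y - x) \<le> \<kappa>" and \<kappa>: "\<kappa> \<le> 1 / 2" "(1 + 2 * R) * \<kappa> \<le> R / 2"
  shows "0 \<le> norm y - y \<bullet> n" "norm y - y \<bullet> n \<le> 2 * ((1 + 2 * R) * \<kappa>)\<^sup>2 / R"
proof -
  define b where "b = 1 / a"
  define z where "z = y - b *\<^sub>R n"
  have \<kappa>0: "\<kappa> \<ge> 0" using y norm_ge_zero order_trans by blast
  have aR: "norm (a *\<^sub>R x) = a * R" using a x by simp
  have "a * R \<le> 1 + \<kappa>"
    using norm_triangle_sub[of "a *\<^sub>R x" n] a(2) n aR by (simp add: norm_minus_commute)
  have "1 - \<kappa> \<le> a * R"
    using norm_triangle_sub[of n "a *\<^sub>R x"] a(2) n aR by simp
  then have "1 / 2 \<le> a * R" using \<kappa> by linarith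
  then have b: "0 < b" "b \<le> 2 * R" unfolding b_def using a by (auto simp: field_simps)
  have bR: "b \<ge> R / 2"
    using \<open>a * R \<le> 1 + \<kappa>\<close> \<kappa> a unfolding b_def by (simp add: field_simps)
  \<comment> \<open>The choice b = 1 / a makes b a x equal to x, leaving two differences that are
    both small.\<close>
  have z_eq: "z = (y - x) - b *\<^sub>R (n - a *\<^sub>R x)"
    using a by (simp add: z_def b_def scaleR_diff_right)
  have "norm z \<le> norm (y - x) + norm (b *\<^sub>R (n - a *\<^sub>R x))"
    unfolding z_eq by (rule norm_triangle_ineq4)
  also have "\<dots> \<le> \<kappa> + (2 * R) * \<kappa>"
    using b a y by (simp add: add_mono mult_mono)
  finally have z: "norm z \<le> (1 + 2 * R) * \<kappa>" by (simp add: algebra_simps)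
  have nn: "n \<bullet> n = 1" using n by (simp add: norm_eq_1)
  have y_eq: "y = b *\<^sub>R n + z" by (simp add: z_def)
  have yn: "y \<bullet> n = b + z \<bullet> n" by (simp add: y_eq inner_add_left nn)
  have "\<bar>z \<bullet> n\<bar> \<le> norm z" using Cauchy_Schwarz_ineq2[of z n] n by simp
  then have yn0: "y \<bullet> n \<ge> 0" using z \<kappa> bR unfolding yn by linarith
  have "\<bar>y \<bullet> n\<bar> \<le> norm y" using Cauchy_Schwarz_ineq2[of y n] n by simp
  then show le: "0 \<le> norm y - y \<bullet> n" by linarith
  have "(norm y)\<^sup>2 - (y \<bullet> n)\<^sup>2 = (norm z)\<^sup>2 - (z \<bullet> n)\<^sup>2"
    unfolding yn power2_norm_eq_inner
    by (simp add: y_eq inner_add_left inner_add_right nn inner_commute power2_eq_square algebra_simps)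
  moreover have "(norm y - y \<bullet> n) * (norm y + y \<bullet> n) = (norm y)\<^sup>2 - (y \<bullet> n)\<^sup>2"
    by (simp add: power2_eq_square algebra_simps)
  moreover have "(z \<bullet> n)\<^sup>2 \<ge> 0" by simp
  ultimately have "(norm y - y \<bullet> n) * (norm y + y \<bullet> n) \<le> (norm z)\<^sup>2" by linarith
  also have "\<dots> \<le> ((1 + 2 * R) * \<kappa>)\<^sup>2" using z by (intro power_mono) auto
  finally have 1: "(norm y - y \<bullet> n) * (norm y + y \<bullet> n) \<le> ((1 + 2 * R) * \<kappa>)\<^sup>2" .
  have "1 * \<kappa> \<le> (1 + 2 * R) * \<kappa>" using \<kappa>0 x by (intro mult_right_mono) auto
  then have "\<kappa> \<le> R / 2" using \<kappa> by linarith
  then have "norm y \<ge> R / 2"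
    using norm_triangle_sub[of x y] x y by (simp add: norm_minus_commute)
  then have "(norm y - y \<bullet> n) * (R / 2) \<le> (norm y - y \<bullet> n) * (norm y + y \<bullet> n)"
    using yn0 le by (intro mult_left_mono) auto
  with 1 show "norm y - y \<bullet> n \<le> 2 * ((1 + 2 * R) * \<kappa>)\<^sup>2 / R"
    using x by (simp add: field_simps)
qed

text \<open>The fields and their derivatives are bounded on the compact closed ball, so one constant
  \<open>C\<close> serves all estimates. The field \<open>w\<close> and the remainder are absorbed
  into the O(t^2) term, because only \<open>v\<close> enters the first derivative of the
  eigenvalue.\<close>

lemma ball_perturbation_expansion:
  fixes v w :: "'a::euclidean_space \<Rightarrow> 'a"
  assumes pert: "ball_perturbation R g v w Phi" and R: "R > 0"
  obtains C B Dv where "has_C1_derivative_on v Dv (cball 0 R)" "C > 0"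
    "\<And>x. x \<in> cball 0 R \<Longrightarrow> Phi 0 x = x"
    "\<forall>\<^sub>F t in nhds 0. C2_Holder_diffeo_on g (cball 0 R) (Phi t) \<and> continuous_on (cball 0 R) (B t) \<and>
      (\<forall>x\<in>cball 0 R. (Phi t has_derivative blinfun_apply (B t x)) (at x within cball 0 R) \<and>
        norm (B t x - id_blinfun) \<le> C * \<bar>t\<bar> \<and> norm (Phi t x - x) \<le> C * \<bar>t\<bar> \<and>
        norm (Phi t x - x - t *\<^sub>R v x) \<le> C * t\<^sup>2)"
proof -
  obtain Dv where Dv: "has_C1_derivative_on v Dv (cball 0 R)"
    using pert unfolding ball_perturbation_def C2_Holder_on_def by blast
  obtain Dw where Dw: "has_C1_derivative_on w Dw (cball 0 R)"
    using pert unfolding ball_perturbation_def C2_Holder_on_def by blast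
  obtain r Dr where
    r: "\<forall>\<^sub>F t in nhds 0. has_C1_derivative_on (r t) (Dr t) (cball 0 R) \<and>
         (\<forall>x\<in>cball 0 R. Phi t x = x + t *\<^sub>R v x + (t\<^sup>2 / 2) *\<^sub>R w x + r t x)"
    and re: "\<And>e. e > 0 \<Longrightarrow> \<forall>\<^sub>F t in nhds 0. \<forall>x\<in>cball 0 R. norm (r t x) \<le> e * t\<^sup>2 \<and> norm (Dr t x) \<le> e * t\<^sup>2"
    using pert unfolding ball_perturbation_def by blast
  have bounded: "\<exists>M\<ge>0. \<forall>x\<in>cball 0 R. norm (h x) \<le> M"
    if "continuous_on (cball 0 R) h" for h :: "'a \<Rightarrow> 'b::real_normed_vector"
  proof -
    have "bounded (h ` cball 0 R)"
      by (intro compact_imp_bounded compact_continuous_image that compact_cball)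
    then obtain M where M: "\<forall>x\<in>cball 0 R. norm (h x) \<le> M" unfolding bounded_iff by blast
    moreover have "norm (h 0) \<le> M" using M R by simp
    then have "M \<ge> 0" using norm_ge_zero order_trans by blast
    ultimately show ?thesis by blast
  qed
  have cont: "continuous_on (cball 0 R) f" "continuous_on (cball 0 R) Df"
    if "has_C1_derivative_on f Df (cball 0 R)" for f Df
    using that unfolding has_C1_derivative_on_def
    by (meson continuous_on_eq_continuous_within has_derivative_continuous)+
  obtain Mv where Mv: "Mv \<ge> 0" "\<And>x. x \<in> cball 0 R \<Longrightarrow> norm (v x) \<le> Mv"
    using bounded[OF cont(1)[OF Dv]] by blast
  obtain Mw where Mw: "Mw \<ge> 0" "\<And>x. x \<in> cball 0 R \<Longrightarrow> norm (w x) \<le> Mw"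
    using bounded[OF cont(1)[OF Dw]] by blast
  obtain Nv where Nv: "Nv \<ge> 0" "\<And>x. x \<in> cball 0 R \<Longrightarrow> norm (Dv x) \<le> Nv"
    using bounded[OF cont(2)[OF Dv]] by blast
  obtain Nw where Nw: "Nw \<ge> 0" "\<And>x. x \<in> cball 0 R \<Longrightarrow> norm (Dw x) \<le> Nw"
    using bounded[OF cont(2)[OF Dw]] by blast
  define C where "C = Mv + Mw + Nv + Nw + 1"
  define B where "B t x = id_blinfun + t *\<^sub>R Dv x + (t\<^sup>2 / 2) *\<^sub>R Dw x + Dr t x" for t x
  have small: "\<forall>\<^sub>F t in nhds (0::real). \<bar>t\<bar> \<le> 1"
    using eventually_nhds_in_open[of "{-1<..<1}" "0::real"] by (auto elim!: eventually_mono)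
  have diffeo: "\<forall>\<^sub>F t in nhds 0. C2_Holder_diffeo_on g (cball 0 R) (Phi t)"
    using pert unfolding ball_perturbation_def by blast
  show ?thesis
  proof (rule that[OF Dv])
    show "C > 0" unfolding C_def using Mv Mw Nv Nw by linarith
    \<comment> \<open>What holds eventually in \<open>nhds 0\<close> holds at t = 0, where the bound
      by e t^2 forces the remainder to be 0.\<close>
    show "Phi 0 x = x" if "x \<in> cball 0 R" for x
      using eventually_nhds_x_imp_x[OF r] eventually_nhds_x_imp_x[OF re[of 1]] that by simp
    show "\<forall>\<^sub>F t in nhds 0. C2_Holder_diffeo_on g (cball 0 R) (Phi t) \<and> continuous_on (cball 0 R) (B t) \<and>
      (\<forall>x\<in>cball 0 R. (Phi t has_derivative blinfun_apply (B t x)) (at x within cball 0 R) \<and>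
        norm (B t x - id_blinfun) \<le> C * \<bar>t\<bar> \<and> norm (Phi t x - x) \<le> C * \<bar>t\<bar> \<and>
        norm (Phi t x - x - t *\<^sub>R v x) \<le> C * t\<^sup>2)"
      using r re[of 1, simplified] small diffeo
    proof eventually_elim
      case (elim t)
      have t2: "t\<^sup>2 \<le> \<bar>t\<bar>"
        using elim(3) mult_left_mono[of "\<bar>t\<bar>" 1 "\<bar>t\<bar>"] by (simp add: power2_eq_square flip: abs_mult)
      have Phi: "Phi t x = x + t *\<^sub>R v x + (t\<^sup>2 / 2) *\<^sub>R w x + r t x" if "x \<in> cball 0 R" for x
        using elim(1) that by blast
      have rt: "norm (r t x) \<le> t\<^sup>2" "norm (Dr t x) \<le> t\<^sup>2" if "x \<in> cball 0 R" for x
        using elim(2) that by auto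
      have "continuous_on (cball 0 R) (B t)"
        unfolding B_def by (intro continuous_intros cont(2)[OF Dv] cont(2)[OF Dw] cont(2)[of "r t"])
          (use elim in blast)
      moreover have "(Phi t has_derivative blinfun_apply (B t x)) (at x within cball 0 R)" if x: "x \<in> cball 0 R" for x
      proof (rule has_derivative_transform[OF x Phi])
        have D: "(v has_derivative Dv x) (at x within cball 0 R)" "(w has_derivative Dw x) (at x within cball 0 R)"
          "(r t has_derivative Dr t x) (at x within cball 0 R)"
          using Dv Dw elim(1) x unfolding has_C1_derivative_on_def by blast+
        have "((\<lambda>x. x + t *\<^sub>R v x + (t\<^sup>2 / 2) *\<^sub>R w x + r t x) has_derivative
          (\<lambda>h. h + t *\<^sub>R Dv x h + (t\<^sup>2 / 2) *\<^sub>R Dw x h + Dr t x h)) (at x within cball 0 R)"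
          by (intro has_derivative_add has_derivative_scaleR_right has_derivative_ident D)
        moreover have "blinfun_apply (B t x) = (\<lambda>h. h + t *\<^sub>R Dv x h + (t\<^sup>2 / 2) *\<^sub>R Dw x h + Dr t x h)"
          by (rule ext) (simp add: B_def blinfun.add_left blinfun.scaleR_left)
        ultimately show "((\<lambda>x. x + t *\<^sub>R v x + (t\<^sup>2 / 2) *\<^sub>R w x + r t x) has_derivative
          blinfun_apply (B t x)) (at x within cball 0 R)"
          by simp
      qed
      moreover have rest: "norm (Phi t x - x - t *\<^sub>R v x) \<le> (Mw + 1) * t\<^sup>2" if x: "x \<in> cball 0 R" for x
      proof -
        have "norm (Phi t x - x - t *\<^sub>R v x) \<le> norm ((t\<^sup>2 / 2) *\<^sub>R w x) + norm (r t x)"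
          unfolding Phi[OF x] using norm_triangle_ineq[of "(t\<^sup>2 / 2) *\<^sub>R w x" "r t x"] by simp
        also have "norm ((t\<^sup>2 / 2) *\<^sub>R w x) \<le> t\<^sup>2 * Mw"
          using mult_mono[of "t\<^sup>2 / 2" "t\<^sup>2" "norm (w x)" Mw] Mw(2)[OF x] by simp
        finally show ?thesis using rt(1)[OF x] by (simp add: algebra_simps)
      qed
      moreover have "norm (Phi t x - x - t *\<^sub>R v x) \<le> C * t\<^sup>2" if x: "x \<in> cball 0 R" for x
      proof -
        have "(Mw + 1) * t\<^sup>2 \<le> C * t\<^sup>2"
          using Mv Nv Nw by (intro mult_right_mono) (auto simp: C_def)
        then show ?thesis using rest[OF x] by linarith
      qed
      moreover have "norm (Phi t x - x) \<le> C * \<bar>t\<bar>" if x: "x \<in> cball 0 R" for x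
      proof -
        have "norm (Phi t x - x) \<le> norm (Phi t x - x - t *\<^sub>R v x) + norm (t *\<^sub>R v x)"
          using norm_triangle_ineq[of "Phi t x - x - t *\<^sub>R v x" "t *\<^sub>R v x"] by simp
        also have "norm (t *\<^sub>R v x) \<le> \<bar>t\<bar> * Mv" using Mv(2)[OF x] by (simp add: mult_left_mono)
        also have "norm (Phi t x - x - t *\<^sub>R v x) \<le> (Mw + 1) * \<bar>t\<bar>"
          using rest[OF x] mult_left_mono[OF t2, of "Mw + 1"] Mw(1) by linarith
        also have "(Mw + 1) * \<bar>t\<bar> + \<bar>t\<bar> * Mv \<le> C * \<bar>t\<bar>"
          using Nv(1) Nw(1) by (simp add: C_def algebra_simps)
        finally show ?thesis by simp
      qed
      moreover have "norm (B t x - id_blinfun) \<le> C * \<bar>t\<bar>" if x: "x \<in> cball 0 R" for x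
      proof -
        have "norm (B t x - id_blinfun) \<le> norm (t *\<^sub>R Dv x) + norm ((t\<^sup>2 / 2) *\<^sub>R Dw x) + norm (Dr t x)"
          unfolding B_def
          using norm_triangle_ineq[of "t *\<^sub>R Dv x + (t\<^sup>2 / 2) *\<^sub>R Dw x" "Dr t x"]
            norm_triangle_ineq[of "t *\<^sub>R Dv x" "(t\<^sup>2 / 2) *\<^sub>R Dw x"] by simp
        also have "norm (t *\<^sub>R Dv x) \<le> \<bar>t\<bar> * Nv" using Nv(2)[OF x] by (simp add: mult_left_mono)
        also have "norm ((t\<^sup>2 / 2) *\<^sub>R Dw x) \<le> \<bar>t\<bar> * Nw"
          using mult_mono[of "t\<^sup>2 / 2" "\<bar>t\<bar>" "norm (Dw x)" Nw] Nw(2)[OF x] t2 by simp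
        also have "norm (Dr t x) \<le> \<bar>t\<bar>" using rt(2)[OF x] t2 by linarith
        also have "\<bar>t\<bar> * Nv + \<bar>t\<bar> * Nw + \<bar>t\<bar> \<le> C * \<bar>t\<bar>"
          using Mv(1) Mw(1) by (simp add: C_def algebra_simps)
        finally show ?thesis by simp
      qed
      ultimately show ?case using elim(4) by blast
    qed
  qed
qed

text \<open>For l = 0 both F1 and - F1 satisfy (n / 2) f + s f' = 0 with value 0 at the origin;
  adding e > 0 supplies the strict initial positivity that the comparison lemma asks for.\<close>

lemma (in radial_solution) F1_eq_0:
  assumes "l = 0" "s > 0"
  shows "F1 s = 0"
proof -
  have pos: "\<sigma> * F1 s + e > 0" if "e > 0" for e \<sigma> :: real
  proof (rule pos_if_powr_mult_increasing[of "\<lambda>s. \<sigma> * F1 s + e" "\<lambda>s. \<sigma> * F2 s" s "real n / 2"])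
    show "DERIV (\<lambda>s. \<sigma> * F1 s + e) s :> \<sigma> * F2 s" for s
      by (auto intro!: derivative_eq_intros F1)
    fix s :: real
    have "real n / 2 * (\<sigma> * F1 s + e) + s * (\<sigma> * F2 s) = real n / 2 * e"
      using ode[of s] assms(1) by algebra
    also have "\<dots> \<ge> 0" using that by simp
    finally show "real n / 2 * (\<sigma> * F1 s + e) + s * (\<sigma> * F2 s) \<ge> 0" .
  qed (use assms that F1_0 in auto)
  have "\<bar>F1 s\<bar> \<le> 0 + e" if "e > 0" for e
    using pos[OF that, of 1] pos[OF that, of "- 1"] by simp
  then have "\<bar>F1 s\<bar> \<le> 0" by (rule field_le_epsilon)
  then show ?thesis by simp
qed

text \<open>The Robin condition reads alpha F = - 2 R F1, and l F1 < 0, so alpha has the sign of l;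
  \<open>l_riccati_neg\<close> gives the sign of l times the bracket.\<close>

lemma (in radial_solution) robin_sign:
  assumes R: "R > 0" and F_pos: "\<And>s. 0 \<le> s \<Longrightarrow> s \<le> R\<^sup>2 \<Longrightarrow> F s > 0"
    and bc: "\<alpha> * F (R\<^sup>2) + 2 * R * F1 (R\<^sup>2) = 0" and \<alpha>: "\<alpha> \<noteq> 0"
  shows "\<alpha> * (F (R\<^sup>2) * F1 (R\<^sup>2) + 2 * R\<^sup>2 * F (R\<^sup>2) * F2 (R\<^sup>2) - 2 * R\<^sup>2 * (F1 (R\<^sup>2))\<^sup>2) < 0"
proof -
  have R2: "R\<^sup>2 > 0" using R by simp
  have FR: "F (R\<^sup>2) > 0" using F_pos by simp
  define K where "K = F (R\<^sup>2) * F1 (R\<^sup>2) + 2 * R\<^sup>2 * F (R\<^sup>2) * F2 (R\<^sup>2) - 2 * R\<^sup>2 * (F1 (R\<^sup>2))\<^sup>2"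
  have l: "l \<noteq> 0"
    using F1_eq_0[OF _ R2] bc FR \<alpha> by auto
  have lF1: "l * F1 (R\<^sup>2) < 0"
    using l_F1_neg[OF l R2] F_pos by (auto intro: less_imp_le)
  have lK: "l * K < 0"
    unfolding K_def using l_riccati_neg[OF l R2] F_pos by auto
  have "(l * \<alpha>) * F (R\<^sup>2) = - 2 * R * (l * F1 (R\<^sup>2))" using bc by algebra
  also have "\<dots> > 0" using lF1 R by (simp add: mult_pos_neg)
  finally have "l * \<alpha> > 0" using FR by (simp add: zero_less_mult_iff)
  then have "(l * \<alpha>) * (l * K) < 0" using lK by (rule mult_pos_neg)
  then have "l\<^sup>2 * (\<alpha> * K) < 0" by (simp add: power2_eq_square mult_ac)
  then have "\<alpha> * K < 0" using l by (simp add: mult_less_0_iff)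
  then show ?thesis by (simp add: K_def)
qed

text \<open>The first-order expansion of the boundary flux of the comparison field: its derivative in
  \<open>t\<close> is cancelled by the choice of the factor \<open>2 * \<beta>'\<close>, and the term with \<open>\<epsilon>\<close> dominates the rest.\<close>

lemma perturbed_boundary_flux_negative:
  fixes g :: "'a::euclidean_space \<Rightarrow> real" and v :: "'a \<Rightarrow> 'a" and F F1 :: "real \<Rightarrow> real"
  assumes R: "R > 0" and C: "C > 0" and \<epsilon>: "\<epsilon> > 0"
    and F: "continuous_on UNIV F" "continuous_on UNIV F1" "F (R\<^sup>2) > 0"
    and \<beta>: "((\<lambda>s. \<alpha> * (F s)\<^sup>2 + 2 * sqrt s * F s * F1 s) has_real_derivative \<beta>') (at (R\<^sup>2))"
      "\<alpha> * (F (R\<^sup>2))\<^sup>2 + 2 * R * F (R\<^sup>2) * F1 (R\<^sup>2) = 0"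
    and g: "continuous_on (- {0}) g" "\<And>x. \<bar>g x\<bar> \<le> M" "\<forall>x. norm x = R \<longrightarrow> x \<bullet> v x = R * g x"
  shows "\<forall>\<^sub>F t in nhds 0. t \<noteq> 0 \<longrightarrow> (\<forall>x y n a. norm x = R \<longrightarrow> norm (y - x) \<le> C * \<bar>t\<bar> \<longrightarrow>
     norm (y - x - t *\<^sub>R v x) \<le> C * t\<^sup>2 \<longrightarrow> norm n = 1 \<longrightarrow> a > 0 \<longrightarrow> norm (n - a *\<^sub>R x) \<le> C * \<bar>t\<bar> \<longrightarrow>
     R / 2 \<le> norm y \<and> \<alpha> * (F (y \<bullet> y))\<^sup>2 + 2 * F (y \<bullet> y) * F1 (y \<bullet> y) * (y \<bullet> n)
       - (t * (2 * \<beta>') * g y + \<epsilon> * \<bar>t\<bar> * (F (y \<bullet> y))\<^sup>2) * (y \<bullet> n) < 0)"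
proof -
  \<comment> \<open>The flux phi^2 (alpha - k) at distance sqrt s from the origin when the normal is
    radial.\<close>
  define \<beta> where "\<beta> s = \<alpha> * (F s)\<^sup>2 + 2 * sqrt s * F s * F1 s" for s
  \<comment> \<open>A lower bound for the \<epsilon> term divided by |t|: F^2 stays above half its
    value at R^2, and y \<bullet> n above R / 2. The tolerances \<open>e1\<close> and
    \<open>e3\<close> are set so that each costs m / 8.\<close>
  define m where "m = \<epsilon> * (F (R\<^sup>2))\<^sup>2 * R / 4"
  have m: "m > 0" using \<epsilon> F R by (simp add: m_def)
  define e1 where "e1 = m / (8 * ((2 * R + 1) * C))"
  define e3 where "e3 = m / (8 * (\<bar>2 * \<beta>'\<bar> * R + 1))"
  have e1: "e1 > 0" "e1 * ((2 * R + 1) * C) = m / 8"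
    using m R C by (auto simp: e1_def)
  have e3: "e3 > 0" "\<bar>2 * \<beta>'\<bar> * (R * e3) \<le> m / 8"
  proof -
    have pos: "\<bar>2 * \<beta>'\<bar> * R + 1 > 0" using R by (simp add: add_nonneg_pos)
    then show "e3 > 0" using m unfolding e3_def by simp
    have "\<bar>2 * \<beta>'\<bar> * R * (m / (8 * (\<bar>2 * \<beta>'\<bar> * R + 1))) \<le> m / 8"
      using pos m by (simp add: field_simps)
    then show "\<bar>2 * \<beta>'\<bar> * (R * e3) \<le> m / 8" by (simp add: e3_def mult_ac)
  qed
  have M: "M \<ge> 0" using g(2)[of 0] by linarith
  obtain d1 where d1: "d1 > 0" "\<And>s. \<bar>s - R\<^sup>2\<bar> < d1 \<Longrightarrow> \<bar>\<beta> s - \<beta>' * (s - R\<^sup>2)\<bar> \<le> e1 * \<bar>s - R\<^sup>2\<bar>"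
  proof -
    have "(\<beta> has_derivative (\<lambda>h. \<beta>' * h)) (at (R\<^sup>2))"
      using \<beta>(1) unfolding \<beta>_def[abs_def] by (simp add: has_field_derivative_def)
    then obtain d where "d > 0" "\<And>s. norm (s - R\<^sup>2) < d \<Longrightarrow>
        norm (\<beta> s - \<beta> (R\<^sup>2) - \<beta>' * (s - R\<^sup>2)) \<le> e1 * norm (s - R\<^sup>2)"
      using e1(1) unfolding has_derivative_at_alt by blast
    moreover have "\<beta> (R\<^sup>2) = 0" using \<beta>(2) R by (simp add: \<beta>_def)
    ultimately show ?thesis using that[of d] by auto
  qed
  obtain d2 where d2: "d2 > 0" "\<And>s. \<bar>s - R\<^sup>2\<bar> < d2 \<Longrightarrow> (F s)\<^sup>2 > (F (R\<^sup>2))\<^sup>2 / 2"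
  proof -
    have "isCont (\<lambda>s. (F s)\<^sup>2) (R\<^sup>2)"
      using F(1) by (intro continuous_intros) (simp add: continuous_on_eq_continuous_at)
    then have "\<forall>\<^sub>F s in at (R\<^sup>2). (F s)\<^sup>2 > (F (R\<^sup>2))\<^sup>2 / 2"
      using F(3) unfolding isCont_def by (intro order_tendstoD(1)) auto
    then obtain d where "d > 0" "\<And>s. s \<noteq> R\<^sup>2 \<Longrightarrow> dist s (R\<^sup>2) < d \<Longrightarrow> (F s)\<^sup>2 > (F (R\<^sup>2))\<^sup>2 / 2"
      unfolding eventually_at by blast
    moreover have "(F (R\<^sup>2))\<^sup>2 > (F (R\<^sup>2))\<^sup>2 / 2" using F(3) by simp
    ultimately show ?thesis using that[of d] by (metis dist_real_def)
  qed
  \<comment> \<open>\<open>g\<close> is used only as a continuous function, so its change between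
    \<open>x\<close> and the displaced \<open>y\<close> is made small by uniform continuity on a
    compact annulus, without a rate in t.\<close>
  obtain d3 where d3: "d3 > 0"
    "\<And>x y. norm x = R \<Longrightarrow> norm (y - x) < d3 \<Longrightarrow> norm (y - x) \<le> R / 2 \<Longrightarrow> \<bar>g y - g x\<bar> < e3"
  proof -
    define A where "A = {y::'a. R / 2 \<le> norm y \<and> norm y \<le> 2 * R}"
    have "A = cball 0 (2 * R) - ball 0 (R / 2)" by (auto simp: A_def)
    then have "compact A" by (simp add: compact_diff)
    moreover have "continuous_on A g"
      by (rule continuous_on_subset[OF g(1)]) (use R in \<open>auto simp: A_def\<close>)
    ultimately have "uniformly_continuous_on A g" by (rule compact_uniformly_continuous[rotated])
    then obtain d where d: "d > 0" "\<And>x y. x \<in> A \<Longrightarrow> y \<in> A \<Longrightarrow> dist y x < d \<Longrightarrow> dist (g y) (g x) < e3"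
      using e3(1) unfolding uniformly_continuous_on_def by blast
    have "\<bar>g y - g x\<bar> < e3" if "norm x = R" "norm (y - x) < d" "norm (y - x) \<le> R / 2" for x y
    proof -
      have "x \<in> A" using that R by (simp add: A_def)
      moreover have "y \<in> A"
        using that R norm_triangle_sub[of y x] norm_triangle_sub[of x y]
        by (simp add: A_def norm_minus_commute)
      ultimately show ?thesis using d(2)[of x y] that by (simp add: dist_norm)
    qed
    with d(1) that show ?thesis by blast
  qed
  obtain M2 where M2: "M2 \<ge> 0" "\<And>s. s \<in> {0..(2 * R)\<^sup>2} \<Longrightarrow> \<bar>2 * F s * F1 s\<bar> \<le> M2"
  proof -
    have "continuous_on {0..(2 * R)\<^sup>2} (\<lambda>s. 2 * F s * F1 s)"
      by (intro continuous_intros continuous_on_subset[OF F(1)] continuous_on_subset[OF F(2)]) auto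
    then have "bounded ((\<lambda>s. 2 * F s * F1 s) ` {0..(2 * R)\<^sup>2})"
      by (intro compact_imp_bounded compact_continuous_image compact_Icc)
    then obtain K where K: "\<forall>s\<in>{0..(2 * R)\<^sup>2}. norm (2 * F s * F1 s) \<le> K"
      unfolding bounded_iff by blast
    show ?thesis by (rule that[of "max K 0"]) (use K in \<open>auto simp: le_max_iff_disj\<close>)
  qed
  define C3 where "C3 = 2 * ((1 + 2 * R) * C)\<^sup>2 / R"
  have C3: "C3 \<ge> 0" using R by (simp add: C3_def)
  \<comment> \<open>Collects the coefficients of all errors quadratic in t.\<close>
  define L where "L = \<bar>\<beta>'\<bar> * (2 * R * C + C\<^sup>2) + M2 * C3 + \<bar>2 * \<beta>'\<bar> * (M * (C + C3))"
  have L: "L \<ge> 0" unfolding L_def using R C M2(1) C3 M by simp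
  have lin: "\<forall>\<^sub>F t in nhds (0::real). K * \<bar>t\<bar> < e" if "e > 0" for K e
  proof -
    have "((\<lambda>t. K * \<bar>t\<bar>) \<longlongrightarrow> K * \<bar>0::real\<bar>) (nhds 0)" by (intro tendsto_intros filterlim_ident)
    then show ?thesis using that by (intro order_tendstoD(2)) auto
  qed
  have pos: "1 / 2 > (0::real)" "R / 2 > 0" "R / 4 > 0" "m / 4 > 0" using R m by auto
  show ?thesis
    using lin[OF zero_less_one, of 1] lin[OF zero_less_one, of C] lin[OF pos(1), of C]
      lin[OF pos(2), of "(1 + 2 * R) * C"] lin[OF pos(3), of "C + C3"]
      lin[OF d1(1), of "(2 * R + 1) * C"] lin[OF d2(1), of "(2 * R + 1) * C"]
      lin[OF d3(1), of C] lin[OF pos(4), of L]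
  proof eventually_elim
    case (elim t)
    show ?case
    proof (intro impI allI)
      fix x y n :: 'a and a :: real
      assume t: "t \<noteq> 0" and x: "norm x = R" and y: "norm (y - x) \<le> C * \<bar>t\<bar>" "norm (y - x - t *\<^sub>R v x) \<le> C * t\<^sup>2"
        and n: "norm n = 1" "a > 0" "norm (n - a *\<^sub>R x) \<le> C * \<bar>t\<bar>"
      have small: "\<bar>t\<bar> < 1" "C * \<bar>t\<bar> < 1" "C * \<bar>t\<bar> < 1 / 2" "(1 + 2 * R) * C * \<bar>t\<bar> < R / 2"
        "(C + C3) * \<bar>t\<bar> < R / 4" "(2 * R + 1) * C * \<bar>t\<bar> < d1" "(2 * R + 1) * C * \<bar>t\<bar> < d2"
        "C * \<bar>t\<bar> < d3" "L * \<bar>t\<bar> < m / 4"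
        using elim by simp_all
      define s where "s = y \<bullet> y"
      define N where "N = y \<bullet> n"
      define z where "z = y - x"
      have z: "norm z \<le> C * \<bar>t\<bar>" using y by (simp add: z_def)
      have t2: "t\<^sup>2 = \<bar>t\<bar> * \<bar>t\<bar>" by (simp add: power2_eq_square flip: abs_mult)
      have t2le: "t\<^sup>2 \<le> \<bar>t\<bar>" using small(1) mult_left_mono[of "\<bar>t\<bar>" 1 "\<bar>t\<bar>"] t2 by simp
      have CtR: "C * \<bar>t\<bar> \<le> R / 4"
        using small(5) mult_right_mono[of C "C + C3" "\<bar>t\<bar>"] C3 by linarith
      have normy: "R / 2 \<le> norm y" "norm y \<le> 2 * R" "\<bar>norm y - R\<bar> \<le> C * \<bar>t\<bar>"
        using norm_triangle_ineq3[of y x] y x CtR R by (auto simp: abs_le_iff)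
      have s_eq: "s - R\<^sup>2 = 2 * (x \<bullet> z) + z \<bullet> z"
        using x by (auto simp: s_def z_def inner_diff_left inner_diff_right inner_commute power2_norm_eq_inner)
      have zz: "z \<bullet> z \<le> C\<^sup>2 * t\<^sup>2"
        using power_mono[OF z, of 2] by (simp add: power2_norm_eq_inner power_mult_distrib)
      have xz: "\<bar>x \<bullet> z\<bar> \<le> R * (C * \<bar>t\<bar>)"
      proof -
        have "\<bar>x \<bullet> z\<bar> \<le> norm x * norm z" by (rule Cauchy_Schwarz_ineq2)
        also have "\<dots> \<le> R * (C * \<bar>t\<bar>)" unfolding x using z R by (intro mult_left_mono) auto
        finally show ?thesis .
      qed
      have zz': "z \<bullet> z \<le> C * \<bar>t\<bar>"
      proof -
        have "z \<bullet> z = norm z * norm z" by (simp add: power2_norm_eq_inner[symmetric] power2_eq_square)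
        also have "\<dots> \<le> 1 * (C * \<bar>t\<bar>)" using z small(2) by (intro mult_mono) auto
        finally show ?thesis by simp
      qed
      have sR: "\<bar>s - R\<^sup>2\<bar> \<le> (2 * R + 1) * C * \<bar>t\<bar>"
      proof -
        have "\<bar>s - R\<^sup>2\<bar> \<le> 2 * \<bar>x \<bullet> z\<bar> + z \<bullet> z"
          unfolding s_eq using inner_ge_zero[of z] by linarith
        also have "\<dots> \<le> 2 * (R * (C * \<bar>t\<bar>)) + C * \<bar>t\<bar>" using xz zz' by linarith
        finally show ?thesis by (simp add: algebra_simps)
      qed
      \<comment> \<open>The first-order displacement of |y|^2 is 2 t x \<bullet> v x = 2 R t g
        x.\<close>
      have sR2: "\<bar>s - R\<^sup>2 - 2 * R * t * g x\<bar> \<le> (2 * R * C + C\<^sup>2) * t\<^sup>2"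
      proof -
        have "s - R\<^sup>2 - 2 * R * t * g x = 2 * (x \<bullet> (z - t *\<^sub>R v x)) + z \<bullet> z"
          unfolding s_eq using g(3) x by (simp add: inner_diff_right)
        moreover have "\<bar>x \<bullet> (z - t *\<^sub>R v x)\<bar> \<le> R * (C * t\<^sup>2)"
        proof -
          have "\<bar>x \<bullet> (z - t *\<^sub>R v x)\<bar> \<le> norm x * norm (z - t *\<^sub>R v x)" by (rule Cauchy_Schwarz_ineq2)
          also have "\<dots> \<le> R * (C * t\<^sup>2)"
            unfolding x z_def using y(2) R by (intro mult_left_mono) auto
          finally show ?thesis .
        qed
        ultimately have "\<bar>s - R\<^sup>2 - 2 * R * t * g x\<bar> \<le> 2 * (R * (C * t\<^sup>2)) + C\<^sup>2 * t\<^sup>2"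
          using zz inner_ge_zero[of z] by linarith
        then show ?thesis by (simp add: algebra_simps)
      qed
      have E1: "\<bar>\<beta> s - 2 * R * \<beta>' * t * g x\<bar> \<le> m / 8 * \<bar>t\<bar> + \<bar>\<beta>'\<bar> * (2 * R * C + C\<^sup>2) * \<bar>t\<bar> * \<bar>t\<bar>"
      proof -
        have "\<bar>\<beta> s - \<beta>' * (s - R\<^sup>2)\<bar> \<le> e1 * \<bar>s - R\<^sup>2\<bar>" using sR small(6) by (intro d1) linarith
        also have "\<dots> \<le> e1 * ((2 * R + 1) * C * \<bar>t\<bar>)" using sR e1(1) by (intro mult_left_mono) auto
        also have "\<dots> = m / 8 * \<bar>t\<bar>" using e1(2) by (simp add: mult.assoc[symmetric])
        finally have 1: "\<bar>\<beta> s - \<beta>' * (s - R\<^sup>2)\<bar> \<le> m / 8 * \<bar>t\<bar>" .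
        have "\<bar>\<beta>' * (s - R\<^sup>2 - 2 * R * t * g x)\<bar> \<le> \<bar>\<beta>'\<bar> * ((2 * R * C + C\<^sup>2) * t\<^sup>2)"
          unfolding abs_mult by (intro mult_left_mono sR2) auto
        then have 2: "\<bar>\<beta>' * (s - R\<^sup>2 - 2 * R * t * g x)\<bar> \<le> \<bar>\<beta>'\<bar> * (2 * R * C + C\<^sup>2) * \<bar>t\<bar> * \<bar>t\<bar>"
          by (simp only: t2 mult.assoc)
        have "\<beta> s - 2 * R * \<beta>' * t * g x = (\<beta> s - \<beta>' * (s - R\<^sup>2)) + \<beta>' * (s - R\<^sup>2 - 2 * R * t * g x)"
          by (simp add: algebra_simps)
        then show ?thesis using 1 2 by linarith
      qed
      have N: "0 \<le> norm y - N" "norm y - N \<le> C3 * t\<^sup>2"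
      proof -
        note nce = normal_component_estimate[OF x R n(1,2,3) y(1)]
        have c1: "C * \<bar>t\<bar> \<le> 1 / 2" "(1 + 2 * R) * (C * \<bar>t\<bar>) \<le> R / 2" using small(3,4) by (simp_all add: mult.assoc)
        show "0 \<le> norm y - N" using nce(1)[OF c1] by (simp add: N_def)
        have "((1 + 2 * R) * (C * \<bar>t\<bar>))\<^sup>2 = ((1 + 2 * R) * C)\<^sup>2 * t\<^sup>2"
          by (simp add: power_mult_distrib)
        then show "norm y - N \<le> C3 * t\<^sup>2" using nce(2)[OF c1] by (simp add: N_def C3_def)
      qed
      have NR: "\<bar>N - R\<bar> \<le> (C + C3) * \<bar>t\<bar>"
      proof -
        have "C3 * t\<^sup>2 \<le> C3 * \<bar>t\<bar>" using C3 t2le by (rule mult_left_mono[rotated])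
        then show ?thesis using N normy(3) by (simp add: algebra_simps abs_le_iff)
      qed
      have Nhalf: "N \<ge> R / 2" using NR small(5) R by linarith
      have s_in: "s \<in> {0..(2 * R)\<^sup>2}"
        using power_mono[OF normy(2), of 2] by (simp add: s_def power2_norm_eq_inner)
      have sq: "sqrt s = norm y" by (simp add: s_def norm_eq_sqrt_inner)
      have E2: "\<bar>2 * F s * F1 s * (N - norm y)\<bar> \<le> M2 * C3 * \<bar>t\<bar> * \<bar>t\<bar>"
      proof -
        have "\<bar>2 * F s * F1 s\<bar> * \<bar>N - norm y\<bar> \<le> M2 * (C3 * t\<^sup>2)"
          using M2(2)[OF s_in] N M2(1) by (intro mult_mono) auto
        then show ?thesis by (simp add: abs_mult t2 mult.assoc)
      qed
      have E3: "\<bar>2 * \<beta>' * (N * g y - R * g x)\<bar> \<le> \<bar>2 * \<beta>'\<bar> * (M * (C + C3)) * \<bar>t\<bar> + m / 8"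
      proof -
        have "\<bar>g y - g x\<bar> \<le> e3"
          using d3(2)[OF x, of y] y(1) small(8) CtR R by linarith
        then have "\<bar>R * (g y - g x)\<bar> \<le> R * e3" using R by (simp add: abs_mult)
        moreover have "\<bar>(N - R) * g y\<bar> \<le> (C + C3) * \<bar>t\<bar> * M"
          unfolding abs_mult using NR g(2)[of y] C C3 by (intro mult_mono) auto
        moreover have "N * g y - R * g x = (N - R) * g y + R * (g y - g x)" by (simp add: algebra_simps)
        ultimately have "\<bar>N * g y - R * g x\<bar> \<le> (C + C3) * \<bar>t\<bar> * M + R * e3" by linarith
        then have "\<bar>2 * \<beta>'\<bar> * \<bar>N * g y - R * g x\<bar> \<le> \<bar>2 * \<beta>'\<bar> * ((C + C3) * \<bar>t\<bar> * M + R * e3)"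
          by (rule mult_left_mono) simp
        also have "\<dots> \<le> \<bar>2 * \<beta>'\<bar> * (M * (C + C3)) * \<bar>t\<bar> + m / 8"
          using e3(2) by (simp add: distrib_left mult_ac)
        finally show ?thesis by (simp only: abs_mult)
      qed
      have E4: "\<epsilon> * (F s)\<^sup>2 * N \<ge> m"
      proof -
        have "(F s)\<^sup>2 > (F (R\<^sup>2))\<^sup>2 / 2" using sR small(7) by (intro d2) linarith
        then have "\<epsilon> * ((F (R\<^sup>2))\<^sup>2 / 2) * (R / 2) \<le> \<epsilon> * (F s)\<^sup>2 * N"
          using \<epsilon> R Nhalf by (intro mult_mono) auto
        then show ?thesis by (simp add: m_def)
      qed
      define Q where "Q = \<alpha> * (F s)\<^sup>2 + 2 * F s * F1 s * N - (t * (2 * \<beta>') * g y + \<epsilon> * \<bar>t\<bar> * (F s)\<^sup>2) * N"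
      \<comment> \<open>The term 2 R \<beta>' t g x is subtracted from \<open>\<beta>\<close> and
        given back in the comparison part: this is the first-order cancellation that fixes the
        factor 2 \<beta>'.\<close>
      have Q_eq: "Q = (\<beta> s - 2 * R * \<beta>' * t * g x) + 2 * F s * F1 s * (N - norm y)
          - t * (2 * \<beta>' * (N * g y - R * g x)) - \<bar>t\<bar> * (\<epsilon> * (F s)\<^sup>2 * N)"
        unfolding Q_def \<beta>_def sq by (simp add: algebra_simps)
      have T3: "\<bar>t * (2 * \<beta>' * (N * g y - R * g x))\<bar> \<le> \<bar>t\<bar> * (\<bar>2 * \<beta>'\<bar> * (M * (C + C3)) * \<bar>t\<bar> + m / 8)"
        unfolding abs_mult[of t] by (intro mult_left_mono E3) auto
      have T4: "\<bar>t\<bar> * (\<epsilon> * (F s)\<^sup>2 * N) \<ge> \<bar>t\<bar> * m"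
        by (intro mult_left_mono E4) auto
      have "Q \<le> (m / 8 * \<bar>t\<bar> + \<bar>\<beta>'\<bar> * (2 * R * C + C\<^sup>2) * \<bar>t\<bar> * \<bar>t\<bar>) + M2 * C3 * \<bar>t\<bar> * \<bar>t\<bar>
        + \<bar>t\<bar> * (\<bar>2 * \<beta>'\<bar> * (M * (C + C3)) * \<bar>t\<bar> + m / 8) - \<bar>t\<bar> * m"
        unfolding Q_eq using E1 E2 T3 T4 by linarith
      \<comment> \<open>Two errors of m / 8 are taken off m, leaving 3 / 4 m, and the threshold L
        |t| < m / 4 keeps the bracket negative.\<close>
      also have "\<dots> = \<bar>t\<bar> * (L * \<bar>t\<bar> - 3 / 4 * m)"
        unfolding L_def by (simp add: algebra_simps)
      also have "\<dots> < 0" using t small(9) m by (intro mult_pos_neg) auto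
      finally show "R / 2 \<le> norm y \<and> \<alpha> * (F (y \<bullet> y))\<^sup>2 + 2 * F (y \<bullet> y) * F1 (y \<bullet> y) * (y \<bullet> n)
         - (t * (2 * \<beta>') * g y + \<epsilon> * \<bar>t\<bar> * (F (y \<bullet> y))\<^sup>2) * (y \<bullet> n) < 0"
        using normy(1) by (simp add: Q_def s_def N_def)
    qed
  qed
qed

section \<open>The derivative of the eigenvalue\<close>


text \<open>Picone's inequality with the radial eigenfunction of the ball as test function.\<close>

lemma (in radial_solution) perturbed_eigenvalue_upper_bound:
  fixes Om :: "'a::euclidean_space set"
  assumes n: "n = DIM('a)" and dom: "C2_domain Om rho P d"
    and u: "robin_eigenfunction \<alpha> Om m u" "\<And>x. x \<in> Om \<Longrightarrow> 0 < u x"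
    and \<psi>: "has_divergence_on (\<lambda>x. \<psi> x *\<^sub>R x) d\<psi> UNIV"
    and bd: "\<And>y \<nu>. y \<in> frontier Om \<Longrightarrow> outer_unit_normal Om y \<nu> \<Longrightarrow>
      \<alpha> * (F (y \<bullet> y))\<^sup>2 + 2 * F (y \<bullet> y) * F1 (y \<bullet> y) * (y \<bullet> \<nu>)
        - (c * \<psi> y + e * (F (y \<bullet> y))\<^sup>2) * (y \<bullet> \<nu>) < 0"
  shows "(m - l) * (LINT x:Om|lborel. (F (x \<bullet> x))\<^sup>2)
    \<le> c * (LINT x:Om|lborel. d\<psi> x)
      + e * (LINT x:Om|lborel. (F (x \<bullet> x))\<^sup>2 * real DIM('a) + 2 * F (x \<bullet> x) * (2 * F1 (x \<bullet> x) * (x \<bullet> x)))"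
proof -
  interpret C2_domain Om rho P d by (rule dom)
  obtain U where U: "C1_on Om u (\<lambda>x h. U x \<bullet> h)" "has_divergence_on U (\<lambda>x. - (m * u x)) Om"
    "continuous_on (closure Om) u" "continuous_on (closure Om) U"
    "\<And>x. x \<in> closure Om \<Longrightarrow> u x > 0"
    "\<And>y. y \<in> frontier Om \<Longrightarrow> \<exists>\<nu>. outer_unit_normal Om y \<nu> \<and> U y \<bullet> \<nu> + \<alpha> * u y = 0"
    using robin_eigenfunction_positive[OF u] by blast
  define V where "V x = - (1 / u x) *\<^sub>R U x" for x
  have V: "continuous_on (closure Om) V" "has_divergence_on V (\<lambda>x. m + V x \<bullet> V x) Om"
  proof -
    show "continuous_on (closure Om) V"
      unfolding V_def by (intro continuous_intros U ballI) (use U(5) in force)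
    show "has_divergence_on V (\<lambda>x. m + V x \<bullet> V x) Om"
      unfolding V_def[abs_def] by (rule has_divergence_on_log_gradient[OF U(1,2) open_Om u(2)])
  qed
  define \<phi> where "\<phi> x = F (x \<bullet> x)" for x :: 'a
  define G where "G x = (2 * F1 (x \<bullet> x)) *\<^sub>R x" for x :: 'a
  have \<phi>: "C1_on S \<phi> (\<lambda>x h. G x \<bullet> h)" "has_divergence_on G (\<lambda>x. - (l * \<phi> x)) S" for S
    using radial_C1 has_divergence_on_subset[OF radial_divergence[OF n] subset_UNIV]
    unfolding \<phi>_def G_def by auto
  have c\<phi>: "continuous_on S \<phi>" "continuous_on S G" for S
    using C1_onD(3)[OF \<phi>(1)] has_divergence_on_continuous[OF \<phi>(2)] by auto
  \<comment> \<open>The \<open>c\<close> term is to compensate the first-order change of the flux,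
    the \<open>e\<close> term to make the boundary sign strict.\<close>
  define X where "X x = c *\<^sub>R (\<psi> x *\<^sub>R x) + e *\<^sub>R ((\<phi> x)\<^sup>2 *\<^sub>R x)" for x
  define k where "k x = (\<phi> x)\<^sup>2 * real DIM('a) + 2 * \<phi> x * (G x \<bullet> x)" for x
  have sq: "C1_on UNIV (\<lambda>x. (\<phi> x)\<^sup>2) (\<lambda>x h. 2 * \<phi> x * (G x \<bullet> h))"
    by (rule C1_on_compose_real[OF \<phi>(1), where g="\<lambda>s. s\<^sup>2" and g'="\<lambda>s. 2 * s"])
      (auto intro!: derivative_eq_intros continuous_intros)
  have X: "has_divergence_on X (\<lambda>x. c * d\<psi> x + e * k x) UNIV"
    unfolding X_def[abs_def] k_def
    by (intro has_divergence_on_add has_divergence_on_cmul \<psi> has_divergence_on_scaleR[OF sq]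
        has_divergence_on_id)
  have cd\<psi>: "continuous_on S d\<psi>" for S
    using continuous_on_subset[OF has_divergence_on_continuous_divergence[OF \<psi>]] by blast
  have ck: "continuous_on S k" for S
    unfolding k_def by (intro continuous_intros c\<phi>)
  have le: "(LINT x:Om|lborel. (norm (\<phi> x *\<^sub>R V x + G x))\<^sup>2
      + (m * (\<phi> x)\<^sup>2 + \<phi> x * - (l * \<phi> x) - (c * d\<psi> x + e * k x))) \<le> 0"
  proof (rule integral_picone_le_0[OF V c\<phi>(1) \<phi>(1) c\<phi>(2) \<phi>(2)])
    show "continuous_on (closure Om) X"
      using continuous_on_subset[OF has_divergence_on_continuous[OF X]] by blast
    show "has_divergence_on X (\<lambda>x. c * d\<psi> x + e * k x) Om"
      using has_divergence_on_subset[OF X] by blast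
    fix y assume y: "y \<in> frontier Om"
    obtain \<nu> where \<nu>: "outer_unit_normal Om y \<nu>" "U y \<bullet> \<nu> + \<alpha> * u y = 0"
      using U(6)[OF y] by blast
    obtain a where a: "a > 0" "P y = - a *\<^sub>R \<nu>"
      using gradient_outer_unit_normal[OF y \<nu>(1)] by blast
    have "u y > 0" using U(5) frontier_subset_closure[OF y] by blast
    moreover have "U y \<bullet> \<nu> = - (\<alpha> * u y)" using \<nu>(2) by linarith
    ultimately have V\<nu>: "V y \<bullet> \<nu> = \<alpha>" by (simp add: V_def)
    have "((\<phi> y)\<^sup>2 *\<^sub>R V y + \<phi> y *\<^sub>R G y - X y) \<bullet> \<nu>
       = \<alpha> * (F (y \<bullet> y))\<^sup>2 + 2 * F (y \<bullet> y) * F1 (y \<bullet> y) * (y \<bullet> \<nu>)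
        - (c * \<psi> y + e * (F (y \<bullet> y))\<^sup>2) * (y \<bullet> \<nu>)"
      by (simp add: inner_add_left inner_diff_left V\<nu> X_def \<phi>_def G_def algebra_simps)
    then have "((\<phi> y)\<^sup>2 *\<^sub>R V y + \<phi> y *\<^sub>R G y - X y) \<bullet> \<nu> < 0"
      using bd[OF y \<nu>(1)] by simp
    \<comment> \<open>Strictness against the outer normal turns into strictness against
      \<open>P y\<close>, a negative multiple of it.\<close>
    then have "0 < a * - (((\<phi> y)\<^sup>2 *\<^sub>R V y + \<phi> y *\<^sub>R G y - X y) \<bullet> \<nu>)"
      using a(1) by (intro mult_pos_pos) auto
    then show "0 < ((\<phi> y)\<^sup>2 *\<^sub>R V y + \<phi> y *\<^sub>R G y - X y) \<bullet> P y"
      unfolding a(2) by simp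
  qed (intro continuous_intros c\<phi> cd\<psi> ck)+
  \<comment> \<open>The Picone square is dropped here, which makes the bound one-sided.\<close>
  have "(LINT x:Om|lborel. (m - l) * (\<phi> x)\<^sup>2 - (c * d\<psi> x + e * k x)) \<le>
    (LINT x:Om|lborel. (norm (\<phi> x *\<^sub>R V x + G x))\<^sup>2
      + (m * (\<phi> x)\<^sup>2 + \<phi> x * - (l * \<phi> x) - (c * d\<psi> x + e * k x)))"
  proof (rule set_integral_mono)
    show "set_integrable lborel Om (\<lambda>x. (m - l) * (\<phi> x)\<^sup>2 - (c * d\<psi> x + e * k x))"
      by (intro set_integrable_Om continuous_intros c\<phi> cd\<psi> ck)
    show "set_integrable lborel Om (\<lambda>x. (norm (\<phi> x *\<^sub>R V x + G x))\<^sup>2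
      + (m * (\<phi> x)\<^sup>2 + \<phi> x * - (l * \<phi> x) - (c * d\<psi> x + e * k x)))"
      by (intro set_integrable_Om continuous_intros V c\<phi> cd\<psi> ck)
    fix x
    have "(m - l) * (\<phi> x)\<^sup>2 = m * (\<phi> x)\<^sup>2 + \<phi> x * - (l * \<phi> x)"
      by (simp add: power2_eq_square algebra_simps)
    then show "(m - l) * (\<phi> x)\<^sup>2 - (c * d\<psi> x + e * k x) \<le> (norm (\<phi> x *\<^sub>R V x + G x))\<^sup>2
      + (m * (\<phi> x)\<^sup>2 + \<phi> x * - (l * \<phi> x) - (c * d\<psi> x + e * k x))"
      using zero_le_power2[of "norm (\<phi> x *\<^sub>R V x + G x)"] by linarith
  qed
  also note le
  also have "(LINT x:Om|lborel. (m - l) * (\<phi> x)\<^sup>2 - (c * d\<psi> x + e * k x))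
    = (m - l) * (LINT x:Om|lborel. (\<phi> x)\<^sup>2) - (c * (LINT x:Om|lborel. d\<psi> x) + e * (LINT x:Om|lborel. k x))"
  proof -
    have int: "set_integrable lborel Om (\<lambda>x. (m - l) * (\<phi> x)\<^sup>2)"
      "set_integrable lborel Om (\<lambda>x. c * d\<psi> x)" "set_integrable lborel Om (\<lambda>x. e * k x)"
      by (intro set_integrable_Om continuous_intros c\<phi> cd\<psi> ck)+
    show ?thesis
      by (subst set_integral_diff(2)[OF int(1) set_integral_add(1)[OF int(2,3)]])
        (subst set_integral_add(2)[OF int(2,3)], simp)
  qed
  finally have "(m - l) * (LINT x:Om|lborel. (\<phi> x)\<^sup>2)
      \<le> c * (LINT x:Om|lborel. d\<psi> x) + e * (LINT x:Om|lborel. k x)"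
    by linarith
  moreover have "k = (\<lambda>x. (F (x \<bullet> x))\<^sup>2 * real DIM('a) + 2 * F (x \<bullet> x) * (2 * F1 (x \<bullet> x) * (x \<bullet> x)))"
    by (simp add: fun_eq_iff k_def \<phi>_def G_def)
  ultimately show ?thesis by (simp only: \<phi>_def)
qed

text \<open>The upper bound for \<open>lam t - lam 0\<close> is linear in t up to an error e |t|.
  Dividing by t of either sign bounds \<open>L\<close> from both sides; the domains have then shrunk
  to the fixed ball, on which e and finally the cutoff radius tend to 0.\<close>

lemma eigenvalue_derivative:
  fixes v w :: "'a::euclidean_space \<Rightarrow> 'a"
  assumes R: "R > 0" and pert: "ball_perturbation R g v w Phi"
    and eig: "\<forall>\<^sub>F t in nhds 0. robin_principal_eigenvalue \<alpha> (Phi t ` ball 0 R) (lam t)"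
    and lam: "DERIV lam 0 :> L"
    and rad: "radial_solution DIM('a) (lam 0) F F1 F2"
  shows "\<And>s. 0 \<le> s \<Longrightarrow> s \<le> R\<^sup>2 \<Longrightarrow> F s > 0" "\<alpha> * F (R\<^sup>2) + 2 * R * F1 (R\<^sup>2) = 0"
    "L * (LINT x:ball (0::'a) R|lborel. (F (x \<bullet> x))\<^sup>2)
      = 2 * (F (R\<^sup>2) * F1 (R\<^sup>2) + 2 * R\<^sup>2 * F (R\<^sup>2) * F2 (R\<^sup>2) - 2 * R\<^sup>2 * (F1 (R\<^sup>2))\<^sup>2)
        * (real DIM('a) / R * (LINT x:ball 0 R|lborel. radial_ext R v x))"
proof -
  interpret radial_solution "DIM('a)" "lam 0" F F1 F2 by (rule rad)
  obtain C B Dv where v: "has_C1_derivative_on v Dv (cball 0 R)" and C: "C > 0"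
    and Phi0: "\<And>x. x \<in> cball 0 R \<Longrightarrow> Phi 0 x = x"
    and ev: "\<forall>\<^sub>F t in nhds 0. C2_Holder_diffeo_on g (cball 0 R) (Phi t) \<and> continuous_on (cball 0 R) (B t) \<and>
      (\<forall>x\<in>cball 0 R. (Phi t has_derivative blinfun_apply (B t x)) (at x within cball 0 R) \<and>
        norm (B t x - id_blinfun) \<le> C * \<bar>t\<bar> \<and> norm (Phi t x - x) \<le> C * \<bar>t\<bar> \<and>
        norm (Phi t x - x - t *\<^sub>R v x) \<le> C * t\<^sup>2)"
    by (rule ball_perturbation_expansion[OF pert R]) (rule that; assumption)
  have Om0: "Phi 0 ` ball 0 R = ball 0 R"
    using Phi0 by (force simp: image_iff)
  have "robin_principal_eigenvalue \<alpha> (ball (0::'a) R) (lam 0)"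
    using eventually_nhds_x_imp_x[OF eig] unfolding Om0 .
  then obtain u0 where u0: "robin_eigenfunction \<alpha> (ball (0::'a) R) (lam 0) u0" "\<And>x. x \<in> ball 0 R \<Longrightarrow> 0 < u0 x"
    unfolding robin_principal_eigenvalue_def by blast
  show F_pos: "\<And>s. 0 \<le> s \<Longrightarrow> s \<le> R\<^sup>2 \<Longrightarrow> F s > 0" and bc: "\<alpha> * F (R\<^sup>2) + 2 * R * F1 (R\<^sup>2) = 0"
    using ball_principal_eigenfunction[OF refl R u0] by blast+
  have FR: "F (R\<^sup>2) > 0" using F_pos by simp
  define K where "K = F (R\<^sup>2) * F1 (R\<^sup>2) + 2 * R\<^sup>2 * F (R\<^sup>2) * F2 (R\<^sup>2) - 2 * R\<^sup>2 * (F1 (R\<^sup>2))\<^sup>2"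
  \<comment> \<open>The derivative of the flux function at s = R^2: after elimination of alpha by
    the Robin condition, - phi^2 k' / (2 R) remains.\<close>
  define \<beta>' where "\<beta>' = K / R"
  have \<beta>0: "\<alpha> * (F (R\<^sup>2))\<^sup>2 + 2 * R * F (R\<^sup>2) * F1 (R\<^sup>2) = 0"
    using bc by algebra
  have \<beta>: "((\<lambda>s. \<alpha> * (F s)\<^sup>2 + 2 * sqrt s * F s * F1 s) has_real_derivative \<beta>') (at (R\<^sup>2))"
  proof -
    have "DERIV sqrt (R\<^sup>2) :> 1 / (2 * R)"
      using DERIV_real_sqrt[of "R\<^sup>2"] R by (simp add: field_simps)
    note der = DERIV_add[OF DERIV_cmult[OF DERIV_power[OF F, of 2]]
        DERIV_mult[OF DERIV_mult[OF DERIV_cmult[OF this, of 2] F] F1]]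
    define a b c where abc: "a = F (R\<^sup>2)" "b = F1 (R\<^sup>2)" "c = F2 (R\<^sup>2)"
    have "\<alpha> * a = - 2 * R * b" using bc by (simp add: abc)
    then have "\<alpha> * (2 * (a * b)) = - 4 * R * (b * b)" by algebra
    moreover have "(a * b + 2 * R\<^sup>2 * a * c - 2 * R\<^sup>2 * b\<^sup>2) / R = a * b / R + 2 * R * a * c - 2 * R * (b * b)"
      using R by (simp add: add_divide_distrib diff_divide_distrib power2_eq_square)
    ultimately have "\<alpha> * (2 * (a * b)) + (a * b / R + 2 * R * (b * b) + 2 * R * a * c) = \<beta>'"
      unfolding \<beta>'_def K_def abc[symmetric] by linarith
    then show ?thesis
      by (intro DERIV_cong[OF der]) (use R in \<open>simp add: abc algebra_simps\<close>)
  qed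
  obtain M where M: "\<And>x. \<bar>radial_ext R v x\<bar> \<le> M"
    using radial_ext_bounded_measurable[OF R v] by blast
  obtain g' where g': "C1_on (- {0}) (radial_ext R v) g'"
    using radial_ext_C1[OF R v] by blast
  have ext_sphere: "\<forall>x. norm x = R \<longrightarrow> x \<bullet> v x = R * radial_ext R v x"
    using R by (simp add: radial_ext_def inner_commute)
  define A where "A S = (LINT x:S|lborel. (F (x \<bullet> x))\<^sup>2)" for S :: "'a set"
  define D where "D S = (LINT x:S|lborel. (F (x \<bullet> x))\<^sup>2 * real DIM('a)
      + 2 * F (x \<bullet> x) * (2 * F1 (x \<bullet> x) * (x \<bullet> x)))" for S :: "'a set"
  define E where "E \<delta> S = (LINT x:S|lborel. radial_ext_divergence \<delta> R v x)" for \<delta> S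
  \<comment> \<open>\<open>e\<close> and \<open>\<delta>\<close> stay fixed while t tends to 0. The
    condition \<delta> \<le> R / 4 makes the cutoff equal to 1 on the perturbed boundary, where |y|
    \<ge> R / 2.\<close>
  have bound: "\<forall>\<^sub>F t in nhds 0. t \<noteq> 0 \<longrightarrow> open (Phi t ` ball 0 R) \<and>
      ball 0 (R - C * \<bar>t\<bar>) \<subseteq> Phi t ` ball 0 R \<and> Phi t ` ball 0 R \<subseteq> ball 0 (R + C * \<bar>t\<bar>) \<and>
      (lam t - lam 0) * A (Phi t ` ball 0 R)
        \<le> t * (2 * \<beta>') * E \<delta> (Phi t ` ball 0 R) + e * \<bar>t\<bar> * D (Phi t ` ball 0 R)"
    if e: "e > 0" and \<delta>: "\<delta> > 0" "\<delta> \<le> R / 4" for e \<delta>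
    using ev eig perturbed_boundary_flux_negative[OF R C e continuous_F FR \<beta> \<beta>0 C1_onD(3)[OF g'] M ext_sphere]
  proof eventually_elim
    case (elim t)
    show ?case
    proof (intro impI)
      assume t: "t \<noteq> 0"
      have diffeo: "C2_Holder_diffeo_on g (cball 0 R) (Phi t)" and cB: "continuous_on (cball 0 R) (B t)"
        and B: "\<And>x. x \<in> cball 0 R \<Longrightarrow> (Phi t has_derivative blinfun_apply (B t x)) (at x within cball 0 R)"
        and Bid: "\<And>x. x \<in> cball 0 R \<Longrightarrow> norm (B t x - id_blinfun) \<le> C * \<bar>t\<bar>"
        and Phi1: "\<And>x. x \<in> cball 0 R \<Longrightarrow> norm (Phi t x - x) \<le> C * \<bar>t\<bar>"
        and Phi2: "\<And>x. x \<in> cball 0 R \<Longrightarrow> norm (Phi t x - x - t *\<^sub>R v x) \<le> C * t\<^sup>2"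
        using elim(1) by blast+
      have cPhi: "continuous_on (cball 0 R) (Phi t)"
        using B by (meson continuous_on_eq_continuous_within has_derivative_continuous)
      have inj: "inj_on (Phi t) (cball 0 R)"
        using diffeo by (simp add: C2_Holder_diffeo_on_def)
      define Om where "Om = Phi t ` ball 0 R"
      obtain rho P d where dom: "C2_domain Om rho P d"
        and normal: "\<And>x n. norm x = R \<Longrightarrow> outer_unit_normal Om (Phi t x) n \<Longrightarrow> \<exists>a>0. norm (n - a *\<^sub>R x) \<le> C * \<bar>t\<bar>"
        using perturbed_ball_C2_domain[OF R diffeo B cB Bid] unfolding Om_def by blast
      obtain u where u: "robin_eigenfunction \<alpha> Om (lam t) u" "\<And>x. x \<in> Om \<Longrightarrow> 0 < u x"
        using elim(2) unfolding robin_principal_eigenvalue_def Om_def by blast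
      have "(lam t - lam 0) * A Om \<le> t * (2 * \<beta>') * E \<delta> Om + (e * \<bar>t\<bar>) * D Om"
        unfolding A_def D_def E_def
      proof (rule perturbed_eigenvalue_upper_bound[OF refl dom u radial_ext_has_divergence[OF R \<delta>(1) v]])
        fix y \<nu> assume y: "y \<in> frontier Om" and \<nu>: "outer_unit_normal Om y \<nu>"
        obtain x where x: "norm x = R" "y = Phi t x"
          using y perturbed_ball_topology(3)[OF R cPhi inj] by (auto simp: Om_def)
        have xin: "x \<in> cball 0 R" using x by simp
        obtain a where a: "a > 0" "norm (\<nu> - a *\<^sub>R x) \<le> C * \<bar>t\<bar>"
          using normal[OF x(1)] \<nu> x(2) by blast
        have "norm \<nu> = 1" using \<nu> by (simp add: outer_unit_normal_def)
        then have neg: "R / 2 \<le> norm y"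
            "\<alpha> * (F (y \<bullet> y))\<^sup>2 + 2 * F (y \<bullet> y) * F1 (y \<bullet> y) * (y \<bullet> \<nu>)
              - (t * (2 * \<beta>') * radial_ext R v y + e * \<bar>t\<bar> * (F (y \<bullet> y))\<^sup>2) * (y \<bullet> \<nu>) < 0"
          using elim(3) t x Phi1[OF xin] Phi2[OF xin] a by blast+
        have "cutoff_at_0 \<delta> y = 1"
        proof -
          have "(2 * \<delta>)\<^sup>2 \<le> (norm y)\<^sup>2"
            using neg(1) \<delta> by (intro power_mono) auto
          then have "4 \<le> (y \<bullet> y) / \<delta>\<^sup>2"
            using \<delta>(1) by (simp add: power2_norm_eq_inner pos_le_divide_eq)
          then show ?thesis by (simp add: cutoff_at_0_def smooth_step_simps)
        qed
        then show "\<alpha> * (F (y \<bullet> y))\<^sup>2 + 2 * F (y \<bullet> y) * F1 (y \<bullet> y) * (y \<bullet> \<nu>)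
              - (t * (2 * \<beta>') * (cutoff_at_0 \<delta> y * radial_ext R v y) + e * \<bar>t\<bar> * (F (y \<bullet> y))\<^sup>2) * (y \<bullet> \<nu>) < 0"
          using neg(2) by simp
      qed
      then show "open (Phi t ` ball 0 R) \<and>
        ball 0 (R - C * \<bar>t\<bar>) \<subseteq> Phi t ` ball 0 R \<and> Phi t ` ball 0 R \<subseteq> ball 0 (R + C * \<bar>t\<bar>) \<and>
        (lam t - lam 0) * A (Phi t ` ball 0 R)
          \<le> t * (2 * \<beta>') * E \<delta> (Phi t ` ball 0 R) + e * \<bar>t\<bar> * D (Phi t ` ball 0 R)"
        using perturbed_ball_topology(1)[OF R cPhi inj] perturbed_ball_between[OF R cPhi Phi1]
        unfolding Om_def by blast
    qed
  qed
  \<comment> \<open>\<open>\<sigma>\<close> is the sign of t: along t = \<sigma> |t| the bound is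
    divided by |t| before passing to the limit, so the values 1 and - 1 give opposite
    estimates.\<close>
  have one_sided: "\<sigma> * (L * A (ball 0 R)) \<le> \<sigma> * (2 * \<beta>' * E \<delta> (ball 0 R)) + e * D (ball 0 R)"
    if \<sigma>: "\<sigma> = 1 \<or> \<sigma> = - 1" and e: "e > 0" and \<delta>: "\<delta> > 0" "\<delta> \<le> R / 4" for \<sigma> e \<delta> :: real
  proof -
    obtain t0 where t0: "t0 > 0" and P: "\<And>t. \<bar>t\<bar> < t0 \<Longrightarrow> t \<noteq> 0 \<Longrightarrow> open (Phi t ` ball 0 R) \<and>
      ball 0 (R - C * \<bar>t\<bar>) \<subseteq> Phi t ` ball 0 R \<and> Phi t ` ball 0 R \<subseteq> ball 0 (R + C * \<bar>t\<bar>) \<and>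
      (lam t - lam 0) * A (Phi t ` ball 0 R)
        \<le> t * (2 * \<beta>') * E \<delta> (Phi t ` ball 0 R) + e * \<bar>t\<bar> * D (Phi t ` ball 0 R)"
      using bound[OF e \<delta>] unfolding eventually_nhds_metric dist_real_def by auto
    define \<tau> where "\<tau> k = \<sigma> * (t0 / 2 * inverse (real (Suc k)))" for k
    have abs\<tau>: "\<bar>\<tau> k\<bar> = t0 / 2 * inverse (real (Suc k))" for k
      using \<sigma> t0 by (auto simp: \<tau>_def abs_mult)
    have \<sigma>\<tau>: "\<sigma> * \<tau> k = \<bar>\<tau> k\<bar>" for k
      using \<sigma> abs\<tau>[of k] by (auto simp: \<tau>_def)
    have \<tau>: "\<bar>\<tau> k\<bar> < t0" "\<tau> k \<noteq> 0" for k
    proof -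
      have "inverse (real (Suc k)) \<le> 1" by (simp add: inverse_eq_divide)
      then have "t0 / 2 * inverse (real (Suc k)) \<le> t0 / 2 * 1"
        using t0 by (intro mult_left_mono) auto
      then show "\<bar>\<tau> k\<bar> < t0" using t0 unfolding abs\<tau> by linarith
      show "\<tau> k \<noteq> 0" using abs\<tau>[of k] t0 by auto
    qed
    have \<tau>_lim: "\<tau> \<longlonglongrightarrow> 0"
    proof -
      have "\<tau> \<longlonglongrightarrow> \<sigma> * (t0 / 2 * 0)"
        unfolding \<tau>_def by (intro tendsto_intros LIMSEQ_inverse_real_of_nat)
      then show ?thesis by simp
    qed
    define Om where "Om k = Phi (\<tau> k) ` ball 0 R" for k
    have conv: "(\<lambda>k. LINT x:Om k|lborel. f x) \<longlonglongrightarrow> (LINT x:ball 0 R|lborel. f x)"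
      if "continuous_on UNIV f" for f :: "'a \<Rightarrow> real"
    proof (rule set_integral_ball_between_tendsto[OF that R, where \<kappa>="\<lambda>k. C * \<bar>\<tau> k\<bar>"])
      have "(\<lambda>k. C * \<bar>\<tau> k\<bar>) \<longlonglongrightarrow> C * \<bar>0\<bar>" by (intro tendsto_intros \<tau>_lim)
      then show "(\<lambda>k. C * \<bar>\<tau> k\<bar>) \<longlonglongrightarrow> 0" by simp
    qed (use P[OF \<tau>] in \<open>auto simp only: Om_def\<close>)
    have cF: "continuous_on UNIV (\<lambda>x::'a. F (x \<bullet> x))" "continuous_on UNIV (\<lambda>x::'a. F1 (x \<bullet> x))"
      by (intro continuous_on_compose2[OF continuous_F(1)[of UNIV]] continuous_on_compose2[OF continuous_F(2)[of UNIV]]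
          continuous_intros; simp)+
    have limits: "(\<lambda>k. A (Om k)) \<longlonglongrightarrow> A (ball 0 R)" "(\<lambda>k. D (Om k)) \<longlonglongrightarrow> D (ball 0 R)"
      "(\<lambda>k. E \<delta> (Om k)) \<longlonglongrightarrow> E \<delta> (ball 0 R)"
      unfolding A_def D_def E_def
      by (intro conv continuous_intros cF
          has_divergence_on_continuous_divergence[OF radial_ext_has_divergence[OF R \<delta>(1) v]])+
    have quotient: "(\<lambda>k. (lam (\<tau> k) - lam 0) / \<tau> k) \<longlonglongrightarrow> L"
    proof -
      have "filterlim \<tau> (at 0) sequentially"
        using \<tau>_lim \<tau>(2) by (simp add: filterlim_at)
      moreover have "((\<lambda>t. (lam t - lam 0) / t) \<longlongrightarrow> L) (at 0)"
        using lam by (simp add: DERIV_def)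
      ultimately show ?thesis by (rule filterlim_compose[rotated])
    qed
    note lim = tendsto_mult_left[OF tendsto_mult[OF quotient limits(1)], of \<sigma>]
      tendsto_add[OF tendsto_mult_left[OF tendsto_mult_left[OF limits(3), of "2 * \<beta>'"], of \<sigma>]
        tendsto_mult_left[OF limits(2), of e]]
    show ?thesis
    proof (rule LIMSEQ_le[OF lim], intro exI allI impI)
      fix k :: nat
      have "(lam (\<tau> k) - lam 0) * A (Om k) \<le> \<tau> k * (2 * \<beta>') * E \<delta> (Om k) + e * \<bar>\<tau> k\<bar> * D (Om k)"
        using P[OF \<tau>[of k]] unfolding Om_def by blast
      also have "\<tau> k = \<sigma> * \<bar>\<tau> k\<bar>"
        using \<sigma> \<sigma>\<tau>[of k] by auto
      then have "\<tau> k * (2 * \<beta>') * E \<delta> (Om k) + e * \<bar>\<tau> k\<bar> * D (Om k)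
          = (\<sigma> * (2 * \<beta>' * E \<delta> (Om k)) + e * D (Om k)) * \<bar>\<tau> k\<bar>"
        by algebra
      finally have "(lam (\<tau> k) - lam 0) * A (Om k) / \<bar>\<tau> k\<bar>
          \<le> \<sigma> * (2 * \<beta>' * E \<delta> (Om k)) + e * D (Om k)"
        using \<tau>(2)[of k] by (simp only: pos_divide_le_eq zero_less_abs_iff not_False_eq_True)
      moreover have inv: "\<sigma> / \<tau> k = 1 / \<bar>\<tau> k\<bar>"
        unfolding \<sigma>\<tau>[symmetric] using \<sigma> by (elim disjE) simp_all
      have "\<sigma> * ((lam (\<tau> k) - lam 0) / \<tau> k * A (Om k)) = (\<sigma> / \<tau> k) * ((lam (\<tau> k) - lam 0) * A (Om k))"
        by simp
      then have "\<sigma> * ((lam (\<tau> k) - lam 0) / \<tau> k * A (Om k))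
          = (lam (\<tau> k) - lam 0) * A (Om k) / \<bar>\<tau> k\<bar>"
        unfolding inv by simp
      ultimately show "\<sigma> * ((lam (\<tau> k) - lam 0) / \<tau> k * A (Om k)) \<le> \<sigma> * (2 * \<beta>' * E \<delta> (Om k)) + e * D (Om k)"
        by (simp only:)
    qed
  qed
  \<comment> \<open>The estimates for both signs leave a gap of at most e D, with e
    arbitrary.\<close>
  have eq: "L * A (ball 0 R) = 2 * \<beta>' * E \<delta> (ball 0 R)" if \<delta>: "\<delta> > 0" "\<delta> \<le> R / 4" for \<delta>
  proof -
    define x where "x = L * A (ball 0 R) - 2 * \<beta>' * E \<delta> (ball 0 R)"
    have "\<bar>x\<bar> \<le> 0 + \<epsilon>" if "\<epsilon> > 0" for \<epsilon>
    proof -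
      define e where "e = \<epsilon> / (\<bar>D (ball 0 R)\<bar> + 1)"
      have e: "e > 0" using that by (simp add: e_def add_nonneg_pos)
      have "\<bar>x\<bar> \<le> e * D (ball 0 R)"
        using one_sided[OF _ e \<delta>, of 1] one_sided[OF _ e \<delta>, of "- 1"] by (simp add: x_def)
      also have "\<dots> \<le> e * (\<bar>D (ball 0 R)\<bar> + 1)"
        using e by (intro mult_left_mono) auto
      also have "\<dots> = \<epsilon>" by (simp add: e_def add_nonneg_eq_0_iff)
      finally show ?thesis by simp
    qed
    then have "\<bar>x\<bar> \<le> 0" by (rule field_le_epsilon)
    then show ?thesis by (simp add: x_def)
  qed
  \<comment> \<open>Admissible cutoff radii tending to 0; the left side of \<open>eq\<close> is
    independent of them.\<close>
  define \<delta> where "\<delta> k = R / 4 * inverse (real (Suc k))" for k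
  have \<delta>: "\<delta> k > 0" "\<delta> k \<le> R / 4" for k
  proof -
    show "\<delta> k > 0" using R by (simp add: \<delta>_def)
    have "inverse (real (Suc k)) \<le> 1" by (simp add: inverse_eq_divide)
    then show "\<delta> k \<le> R / 4" using R unfolding \<delta>_def by (intro mult_left_le) auto
  qed
  have "\<delta> \<longlonglongrightarrow> R / 4 * 0"
    unfolding \<delta>_def by (intro tendsto_intros LIMSEQ_inverse_real_of_nat)
  then have "(\<lambda>k. 2 * \<beta>' * E (\<delta> k) (ball 0 R))
      \<longlonglongrightarrow> 2 * \<beta>' * (real DIM('a) * (LINT x:ball 0 R|lborel. radial_ext R v x))"
    unfolding E_def using \<delta> by (intro tendsto_intros radial_ext_divergence_integral_tendsto[OF R v]) auto
  then have "(\<lambda>k. L * A (ball 0 R)) \<longlonglongrightarrow> 2 * \<beta>' * (real DIM('a) * (LINT x:ball 0 R|lborel. radial_ext R v x))"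
    by (simp only: eq[OF \<delta>, symmetric])
  then have "L * A (ball 0 R) = 2 * \<beta>' * (real DIM('a) * (LINT x:ball 0 R|lborel. radial_ext R v x))"
    by (simp add: LIMSEQ_const_iff)
  then show "L * (LINT x:ball (0::'a) R|lborel. (F (x \<bullet> x))\<^sup>2)
      = 2 * (F (R\<^sup>2) * F1 (R\<^sup>2) + 2 * R\<^sup>2 * F (R\<^sup>2) * F2 (R\<^sup>2) - 2 * R\<^sup>2 * (F1 (R\<^sup>2))\<^sup>2)
        * (real DIM('a) / R * (LINT x:ball 0 R|lborel. radial_ext R v x))"
    unfolding K_def[symmetric] A_def[symmetric] by (simp add: \<beta>'_def)
qed

theorem mainTheorem8:
  fixes R \<alpha> \<gamma> :: real
    and v w :: "real ^ 'n \<Rightarrow> real ^ 'n"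
    and Phi :: "real \<Rightarrow> real ^ 'n \<Rightarrow> real ^ 'n"
    and lam :: "real \<Rightarrow> real"
  assumes "0 < R"
    and "0 < \<gamma>" and "\<gamma> \<le> 1"
    and "ball_perturbation R \<gamma> v w Phi"
    and "\<forall>\<^sub>F t in nhds 0. robin_principal_eigenvalue \<alpha> (Phi t ` ball 0 R) (lam t)"
    and "lam differentiable (at 0)"
  defines "flux \<equiv> LINT x:sphere 0 R|sphere_measure R. v x \<bullet> (x /\<^sub>R R)"
  shows "(\<alpha> > 0 \<longrightarrow> (flux > 0 \<longrightarrow> deriv lam 0 < 0) \<and> (flux < 0 \<longrightarrow> deriv lam 0 > 0)) \<and>
         (\<alpha> < 0 \<longrightarrow> (flux > 0 \<longrightarrow> deriv lam 0 > 0) \<and> (flux < 0 \<longrightarrow> deriv lam 0 < 0))"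
proof -
  note R = assms(1)
  obtain F F1 F2 where rad: "radial_solution DIM(real ^ 'n) (lam 0) F F1 F2"
    using radial_solution_exists[OF DIM_positive] by blast
  interpret radial_solution "DIM(real ^ 'n)" "lam 0" F F1 F2 by (rule rad)
  have D: "DERIV lam 0 :> deriv lam 0"
    using assms(6) by (simp add: DERIV_deriv_iff_real_differentiable)
  note der = eigenvalue_derivative[OF R assms(4,5) D rad]
  define K where "K = F (R\<^sup>2) * F1 (R\<^sup>2) + 2 * R\<^sup>2 * F (R\<^sup>2) * F2 (R\<^sup>2) - 2 * R\<^sup>2 * (F1 (R\<^sup>2))\<^sup>2"
  define I where "I = (LINT x:ball (0::real^'n) R|lborel. (F (x \<bullet> x))\<^sup>2)"
  have cv: "continuous_on (cball 0 R) v"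
    using assms(4) unfolding ball_perturbation_def C2_Holder_on_def has_C1_derivative_on_def
    by (meson continuous_on_eq_continuous_within has_derivative_continuous)
  have eq: "deriv lam 0 * I = 2 * K * flux"
    using der(3) sphere_measure_flux[OF R cv] by (simp add: K_def I_def flux_def)
  \<comment> \<open>The integrand is continuous, nonnegative and equal to 1 at the origin.\<close>
  have "I > 0"
  proof (rule ccontr)
    assume "\<not> I > 0"
    then have "(F ((0::real^'n) \<bullet> 0))\<^sup>2 = 0"
      using R by (intro nonneg_integral_le_0_imp_eq_0[of R "\<lambda>x::real^'n. (F (x \<bullet> x))\<^sup>2"])
        (auto simp: I_def intro!: continuous_intros continuous_on_compose2[OF continuous_F(1)[of UNIV]])
    then show False by (simp add: F_0)
  qed
  then have sgn: "sgn (deriv lam 0) = sgn K * sgn flux"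
    using arg_cong[OF eq, of sgn] by (simp add: sgn_mult)
  have "\<alpha> * K < 0" if "\<alpha> \<noteq> 0"
    unfolding K_def by (rule robin_sign[OF R der(1,2) that])
  then have "\<alpha> > 0 \<Longrightarrow> K < 0" "\<alpha> < 0 \<Longrightarrow> K > 0"
    by (auto simp: mult_less_0_iff)
  with sgn show ?thesis by (auto simp: sgn_if split: if_splits)
qed

end
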